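(* Let $f,\tilde f\in L^1(\mathbb{R}^N)\cap L^\infty(\mathbb{R}^N)$ and let $u,\tilde u\in L^\infty(\mathbb{R}^N)$ be entropy solutions to $$b(u)+\operatorname{div}(F(u))+(-\Delta)^{\frac s2}u=f\quad\text{and}\quad b(\tilde u)+\operatorname{div}(F(\tilde u))+(-\Delta)^{\frac s2}\tilde u=\tilde f\quad\text{in }\mathbb{R}^N,$$ respectively, such that $b(u),b(\tilde u)\in L^1(\mathbb{R}^N)$. Then $$\int_{\mathbb{R}^N}(b(u(x))-b(\tilde u(x)))^+\,dx\leq\int_{\mathbb{R}^N}(f(x)-\tilde f(x))^+\,dx$$ and $$\int_{\mathbb{R}^N}(b(u(x))-b(\tilde u(x)))^-\,dx\leq\int_{\mathbb{R}^N}(f(x)-\tilde f(x))^-\,dx.$$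
   Context: Here $a^+=\max\{a,0\}$ and $a^-=\max\{-a,0\}$. Standing assumptions: $N\in\mathbb{N}$, $s\in(0,1]$; $b:\mathbb{R}\to\mathbb{R}$ is Lipschitz continuous and nondecreasing with $b(0)=0$ and $b(r)r\geq\lambda|r|^2$ for all $r\in\mathbb{R}$, for some $\lambda>0$; $F=(F_1,\dots,F_N):\mathbb{R}\to\mathbb{R}^N$ is locally Lipschitz continuous with $F(0)=0$. The constant is $C(N,s)=\frac{s\,\Gamma(\frac{N+s}{2})}{2\pi^{\frac N2+s}\Gamma(1-\frac s2)}$. $\mathcal{D}(\mathbb{R}^N)=C_c^\infty(\mathbb{R}^N)$. Entropy solution: a function $u\in L^\infty(\mathbb{R}^N)$ is called an entropy solution to $b(u)+\operatorname{div}(F(u))+(-\Delta)^{s/2}u=f$ if for all $r>0$, all $\varphi\in\mathcal{D}(\mathbb{R}^N)$ with $\varphi\geq0$, all convex $\eta\in C^2(\mathbb{R})$ and all $\phi=(\phi_1,\dots,\phi_N):\mathbb{R}\to\mathbb{R}^N$ locally Lipschitz with $\phi_i'=\eta'F_i'$ (a.e.) for $i=1,\dots,N$, it holds $$\int_{\mathbb{R}^N}(f(x)-b(u(x)))\eta'(u(x))\varphi(x)+\phi(u(x))\cdot\nabla\varphi(x)\,dx$$ $$+C(N,s)\int_{\mathbb{R}^N}\int_{\{|z|\geq r\}}\eta'(u(x))\frac{u(x+z)-u(x)}{|z|^{N+s}}\varphi(x)\,dz\,dx$$ $$+C(N,s)\int_{\mathbb{R}^N}\int_{\{|z|\leq r\}}\eta(u(x))\frac{\varphi(x+z)-\varphi(x)-\nabla\varphi(x)\cdot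 z}{|z|^{N+s}}\,dz\,dx\geq0.$$ *)

theory Defs
  imports "HOL-Analysis.Analysis"
begin

text \<open>Elements of \<open>L\<^sup>\<infinity>\<close> are represented by Lebesgue measurable functions.\<close>

definition ess_bounded :: "(real ^ 'n \<Rightarrow> real) \<Rightarrow> bool" where
  "ess_bounded u \<longleftrightarrow>
     u \<in> borel_measurable lebesgue \<and> (\<exists>M. AE x in lebesgue. \<bar>u x\<bar> \<le> M)"

text \<open>The library notion carries a time parameter, on which the function does not depend here.\<close>

definition locally_lipschitz :: "(real \<Rightarrow> 'b::metric_space) \<Rightarrow> bool" where
  "locally_lipschitz g \<longleftrightarrow> local_lipschitz (UNIV :: real set) UNIV (\<lambda>_. g)"

definition C2_real :: "(real \<Rightarrow> real) \<Rightarrow> bool" where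
  "C2_real \<eta> \<longleftrightarrow>
     (\<exists>\<eta>' \<eta>''. (\<forall>r. (\<eta> has_real_derivative \<eta>' r) (at r)) \<and>
             (\<forall>r. (\<eta>' has_real_derivative \<eta>'' r) (at r)) \<and>
             continuous_on UNIV \<eta>'')"

definition partial_deriv :: "'n \<Rightarrow> (real ^ 'n \<Rightarrow> real) \<Rightarrow> real ^ 'n \<Rightarrow> real" where
  "partial_deriv i f x = frechet_derivative f (at x) (axis i 1)"

definition grad :: "(real ^ 'n \<Rightarrow> real) \<Rightarrow> real ^ 'n \<Rightarrow> real ^ 'n" where
  "grad f x = (\<chi> i. partial_deriv i f x)"

text \<open>A function is \<open>C\<^sup>k\<^sup>+\<^sup>1\<close> iff it is (totally) differentiable with \<open>C\<^sup>k\<close> partial derivatives.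
  Requiring differentiability makes the partial derivatives meaningful, since
  \<open>frechet_derivative\<close> is arbitrary at points of non-differentiability.\<close>

primrec Ck :: "nat \<Rightarrow> (real ^ 'n \<Rightarrow> real) \<Rightarrow> bool" where
  "Ck 0 f \<longleftrightarrow> continuous_on UNIV f"
| "Ck (Suc k) f \<longleftrightarrow> (\<forall>x. f differentiable (at x)) \<and> (\<forall>i. Ck k (partial_deriv i f))"

definition test_function :: "(real ^ 'n \<Rightarrow> real) \<Rightarrow> bool" where
  "test_function \<phi> \<longleftrightarrow> (\<forall>k. Ck k \<phi>) \<and> compact (closure {x. \<phi> x \<noteq> 0})"

definition C_const :: "nat \<Rightarrow> real \<Rightarrow> real" where
  "C_const N s =
     s * Gamma ((real N + s) / 2) /
       (2 * pi powr (real N / 2 + s) * Gamma (1 - s / 2))"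

text \<open>\<open>entropy_flux F \<eta> \<Phi>\<close>: \<open>\<Phi>\<close> is locally Lipschitz and \<open>\<Phi>\<^sub>i' = \<eta>' F\<^sub>i'\<close> almost everywhere.\<close>

definition entropy_flux ::
  "(real \<Rightarrow> real ^ 'n) \<Rightarrow> (real \<Rightarrow> real) \<Rightarrow> (real \<Rightarrow> real ^ 'n) \<Rightarrow> bool" where
  "entropy_flux F \<eta> \<Phi> \<longleftrightarrow>
     locally_lipschitz \<Phi> \<and>
     (\<forall>i. AE r in lebesgue. \<exists>D. ((\<lambda>t. F t $ i) has_real_derivative D) (at r) \<and>
          ((\<lambda>t. \<Phi> t $ i) has_real_derivative deriv \<eta> r * D) (at r))"

definition entropy_solution ::
  "(real \<Rightarrow> real) \<Rightarrow> (real \<Rightarrow> real ^ 'n) \<Rightarrow> real \<Rightarrow> (real ^ 'n \<Rightarrow> real) \<Rightarrow> (real ^ 'n \<Rightarrow> real) \<Rightarrow> bool"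
where
  "entropy_solution b F s f u \<longleftrightarrow>
     ess_bounded u \<and>
     (\<forall>r>0. \<forall>\<phi> \<eta> \<Phi>.
        test_function \<phi> \<longrightarrow> (\<forall>x. 0 \<le> \<phi> x) \<longrightarrow>
        convex_on UNIV \<eta> \<longrightarrow> C2_real \<eta> \<longrightarrow> entropy_flux F \<eta> \<Phi> \<longrightarrow>
        0 \<le> (LINT x|lebesgue.
                (f x - b (u x)) * deriv \<eta> (u x) * \<phi> x + \<Phi> (u x) \<bullet> grad \<phi> x)
          + C_const CARD('n) s *
              (LINT x|lebesgue. (LINT z:{z. r \<le> norm z}|lebesgue.
                 deriv \<eta> (u x) * ((u (x + z) - u x) / norm z powr (real CARD('n) + s)) * \<phi> x))
          + C_const CARD('n) s *
              (LINT x|lebesgue. (LINT z:{z. norm z \<le> r}|lebesgue.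
                 \<eta> (u x) * ((\<phi> (x + z) - \<phi> x - grad \<phi> x \<bullet> z) / norm z powr (real CARD('n) + s)))))"

end

theory Submission
  imports Defs
begin

text \<open>
  The proof is Kruzhkov's doubling of variables, in the form that Alibaud gave it for nonlocal
  equations. Write \<open>v\<close>, \<open>g\<close> for the second solution and its right-hand side.

  The entropy inequalities extend by approximation to the half entropies \<open>r \<mapsto> (r - k)\<^sup>+\<close> and
  \<open>r \<mapsto> (k - r)\<^sup>+\<close> (\<open>entropy_solution_kruzhkov\<close>). One uses the first for \<open>u\<close> at \<open>x\<close> with \<open>k = v y\<close>, the
  second for \<open>v\<close> at \<open>y\<close> with \<open>k = u x\<close>, both with the test function \<open>\<phi> x * \<rho> (x - y)\<close>, integrates
  over the remaining variable and adds. All terms except the near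
  part of the nonlocal one then carry the factor \<open>heaviside (u x - v y)\<close>. Three things happen. The zeroth order terms are bounded by
  \<open>(f x - g y)\<^sup>+ - (b (u x) - b (v y))\<^sup>+\<close>, because \<open>b\<close> is monotone. In the flux terms the gradient of \<open>\<rho>\<close>
  cancels, and only the gradient of \<open>\<phi>\<close> stays. In the far part of the nonlocal term, convexity of the
  positive part bounds the integrand by a difference of \<open>(u - v)\<^sup>+\<close> under the joint shift
  \<open>(x, y) \<mapsto> (x + z, y + z)\<close>; that shift leaves \<open>x - y\<close> unchanged, so after moving it to the test function
  (\<open>diff_adjoint\<close>) only differences of \<open>\<phi>\<close> remain. The near part of the nonlocal term acts on smooth
  functions from the start and vanishes as its radius tends to 0. The outcome is \<open>doubling\<close>.

  The growth condition \<open>b r * r \<ge> lam * \<bar>r\<bar>\<^sup>2\<close> puts \<open>u\<close> and \<open>v\<close> into \<open>L\<^sup>1\<close>. Hence for \<open>\<phi> (x / n)\<close> in place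
  of \<open>\<phi>\<close> the flux and nonlocal terms tend to 0 as \<open>n\<close> grows (\<open>mollified_contraction\<close>); for the nonlocal
  term the first order part of \<open>\<phi> (x - z) - \<phi> x\<close> cancels by symmetry of the kernel, and
  the second order part is integrable against it (\<open>far_diff_bound\<close>, \<open>levy_integrable\<close>). Finally \<open>\<rho>\<close>
  tends to the Dirac measure, and continuity of translations in \<open>L\<^sup>1\<close> gives the
  inequality for positive parts (\<open>contraction\<close>). The one for negative parts is the same inequality with the two
  solutions exchanged.

  Two preliminaries take room. An entropy flux exists only if \<open>F\<close> is differentiable almost
  everywhere, which is Rademacher's theorem in one variable (\<open>locally_lipschitz_differentiable_AE\<close>).
  And test functions must be supplied, with bounds on their second order Taylor remainders
  that are uniform in the parameter \<open>y\<close> (\<open>tame\<close>).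
\<close>

section \<open>Test functions\<close>

lemma partial_deriv_eq:
  "(f has_derivative D) (at x) \<Longrightarrow> partial_deriv i f x = D (axis i 1)"
  unfolding partial_deriv_def by (metis frechet_derivative_at)

lemma Ck_continuous: "Ck k f \<Longrightarrow> continuous_on UNIV f"
proof (cases k)
  case (Suc m)
  assume "Ck k f"
  with Suc have "\<forall>x. f differentiable (at x)" by simp
  then show ?thesis
    by (simp add: continuous_at_imp_continuous_on differentiable_imp_continuous_within)
qed simp

lemma Ck_antimono: "Ck (Suc k) f \<Longrightarrow> Ck k f"
proof (induction k arbitrary: f)
  case 0
  then show ?case using Ck_continuous[of "Suc 0" f] by simp
qed auto

lemma Ck_add: "Ck k f \<Longrightarrow> Ck k g \<Longrightarrow> Ck k (\<lambda>x. f x + g x)"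
proof (induction k arbitrary: f g)
  case 0
  then show ?case by (auto intro: continuous_on_add)
next
  case (Suc k)
  have "partial_deriv i (\<lambda>x. f x + g x) = (\<lambda>x. partial_deriv i f x + partial_deriv i g x)" for i
  proof
    fix x
    have "(f has_derivative frechet_derivative f (at x)) (at x)"
         "(g has_derivative frechet_derivative g (at x)) (at x)"
      using Suc.prems by (auto simp: frechet_derivative_works)
    from has_derivative_add[OF this]
    show "partial_deriv i (\<lambda>x. f x + g x) x = partial_deriv i f x + partial_deriv i g x"
      by (subst partial_deriv_eq) (auto simp: partial_deriv_def)
  qed
  with Suc show ?case by auto
qed

lemma Ck_mult: "Ck k f \<Longrightarrow> Ck k g \<Longrightarrow> Ck k (\<lambda>x. f x * g x)"
proof (induction k arbitrary: f g)
  case 0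
  then show ?case by (auto intro: continuous_on_mult)
next
  case (Suc k)
  have "partial_deriv i (\<lambda>x. f x * g x) = (\<lambda>x. f x * partial_deriv i g x + partial_deriv i f x * g x)" for i
  proof
    fix x
    have "(f has_derivative frechet_derivative f (at x)) (at x)"
         "(g has_derivative frechet_derivative g (at x)) (at x)"
      using Suc.prems by (auto simp: frechet_derivative_works)
    from has_derivative_mult[OF this]
    show "partial_deriv i (\<lambda>x. f x * g x) x = f x * partial_deriv i g x + partial_deriv i f x * g x"
      by (subst partial_deriv_eq) (auto simp: partial_deriv_def)
  qed
  moreover have "Ck k f" "Ck k g" using Suc.prems Ck_antimono by blast+
  ultimately show ?case using Suc by (auto intro!: Ck_add)
qed

lemma Ck_const: "Ck k (\<lambda>x. c)"
proof (induction k arbitrary: c)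
  case (Suc k)
  have "partial_deriv i (\<lambda>x::real^'a. c) = (\<lambda>x. 0)" for i
    by (auto simp: partial_deriv_eq[OF has_derivative_const])
  with Suc show ?case by auto
qed simp

lemma Ck_prod: "finite I \<Longrightarrow> (\<And>i. i \<in> I \<Longrightarrow> Ck k (f i)) \<Longrightarrow> Ck k (\<lambda>x. \<Prod>i\<in>I. f i x)"
  by (induction I rule: finite_induct) (auto intro: Ck_mult Ck_const)

lemma Ck_affine: "Ck k f \<Longrightarrow> Ck k (\<lambda>x. f (a *\<^sub>R x + c))"
proof (induction k arbitrary: f)
  case 0
  then show ?case
    by (auto intro!: continuous_on_compose2[of UNIV f] continuous_intros)
next
  case (Suc k)
  have D: "((\<lambda>x. f (a *\<^sub>R x + c)) has_derivative (\<lambda>z. frechet_derivative f (at (a *\<^sub>R x + c)) (a *\<^sub>R z))) (at x)" for x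
  proof -
    have "(f has_derivative frechet_derivative f (at (a *\<^sub>R x + c))) (at (a *\<^sub>R x + c))"
      using Suc.prems by (auto simp: frechet_derivative_works)
    moreover have "((\<lambda>x. a *\<^sub>R x + c) has_derivative (\<lambda>z. a *\<^sub>R z)) (at x)"
      by (auto intro!: derivative_eq_intros)
    ultimately show ?thesis by (rule has_derivative_compose[rotated])
  qed
  have "partial_deriv i (\<lambda>x. f (a *\<^sub>R x + c)) = (\<lambda>x. a * partial_deriv i f (a *\<^sub>R x + c))" for i
  proof
    fix x
    have "linear (frechet_derivative f (at (a *\<^sub>R x + c)))"
      using Suc.prems by (auto intro!: linear_frechet_derivative)
    then show "partial_deriv i (\<lambda>x. f (a *\<^sub>R x + c)) x = a * partial_deriv i f (a *\<^sub>R x + c)"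
      by (subst partial_deriv_eq[OF D]) (auto simp: partial_deriv_def linear_cmul)
  qed
  then show ?case using Suc D by (auto simp: differentiable_def intro!: Ck_mult Ck_const)
qed

text \<open>The sequence \<open>D\<close> lists a smooth function of one variable and all its derivatives; the induction
  needs the statement for every member of the sequence at once.\<close>

lemma Ck_coordinate:
  fixes i :: "'b::finite"
  assumes "\<And>n t. (D n has_real_derivative D (Suc n) t) (at t)"
  shows "Ck k (\<lambda>x. D n (x $ i))"
proof (induction k arbitrary: n)
  case 0
  have "continuous_on UNIV (D n)"
    using assms[of n] by (meson DERIV_continuous_on has_field_derivative_at_within)
  then show ?case
    by (auto intro!: continuous_on_compose2[of UNIV "D n"] continuous_intros)
next
  case (Suc k)
  have D: "((\<lambda>x. D n (x $ i)) has_derivative (\<lambda>z. D (Suc n) (x $ i) * (z $ i))) (at x)" for x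
  proof -
    have "((\<lambda>x::real^'b. x $ i) has_derivative (\<lambda>z. z $ i)) (at x)"
      by (rule bounded_linear.has_derivative[OF bounded_linear_vec_nth has_derivative_ident])
    from has_derivative_compose[OF this, of "D n" "\<lambda>z. D (Suc n) (x $ i) * z"] assms[of n "x $ i"]
    show ?thesis by (simp add: has_field_derivative_def)
  qed
  have "partial_deriv j (\<lambda>x. D n (x $ i)) = (\<lambda>x. D (Suc n) (x $ i) * axis j 1 $ i)" for j
    using partial_deriv_eq[OF D] by auto
  then show ?case using Suc D by (auto simp: differentiable_def intro!: Ck_mult Ck_const)
qed

lemma test_functionI:
  assumes "\<And>k. Ck k \<phi>" "\<And>x. norm x > R \<Longrightarrow> \<phi> x = 0"
  shows "test_function \<phi>"
proof -
  have "{x. \<phi> x \<noteq> 0} \<subseteq> cball 0 R" using assms(2) by (force simp: not_less)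
  then have "bounded (closure {x. \<phi> x \<noteq> 0})"
    by (meson bounded_cball bounded_closure bounded_subset)
  then show ?thesis using assms(1) by (auto simp: test_function_def compact_eq_bounded_closed)
qed

lemma test_function_support:
  assumes "test_function \<phi>"
  obtains R where "R > 0" "\<And>x. norm x > R \<Longrightarrow> \<phi> x = 0"
proof -
  have "bounded {x. \<phi> x \<noteq> 0}"
    using assms unfolding test_function_def
    by (meson bounded_subset closure_subset compact_imp_bounded)
  then obtain R where R: "R > 0" "\<And>x. \<phi> x \<noteq> 0 \<Longrightarrow> norm x \<le> R"
    unfolding bounded_pos by auto
  show ?thesis by (rule that[OF R(1)]) (use R(2) in force)
qed

lemma test_function_has_derivative:
  assumes "test_function \<phi>"
  shows "(\<phi> has_derivative (\<lambda>z. grad \<phi> x \<bullet> z)) (at x)"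
proof -
  have "Ck (Suc 0) \<phi>" using assms by (auto simp: test_function_def)
  then have d: "(\<phi> has_derivative frechet_derivative \<phi> (at x)) (at x)"
    by (auto simp: frechet_derivative_works)
  then have lin: "linear (frechet_derivative \<phi> (at x))" by (rule has_derivative_linear)
  have "frechet_derivative \<phi> (at x) z = grad \<phi> x \<bullet> z" for z
  proof -
    have "frechet_derivative \<phi> (at x) z = frechet_derivative \<phi> (at x) (\<Sum>i\<in>UNIV. z $ i *\<^sub>R axis i 1)"
      by (metis (no_types, lifting) basis_expansion scalar_mult_eq_scaleR sum.cong)
    also have "\<dots> = (\<Sum>i\<in>UNIV. z $ i *\<^sub>R frechet_derivative \<phi> (at x) (axis i 1))"
      using lin by (simp add: linear_sum linear_cmul)
    also have "\<dots> = grad \<phi> x \<bullet> z"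
      by (auto simp: grad_def partial_deriv_def inner_vec_def intro!: sum.cong)
    finally show ?thesis .
  qed
  then show ?thesis using d by (metis (no_types, lifting) ext)
qed

lemma grad_eq:
  assumes "(\<phi> has_derivative (\<lambda>z. g \<bullet> z)) (at x)"
  shows "grad \<phi> x = g"
  by (auto simp: vec_eq_iff grad_def partial_deriv_eq[OF assms] inner_axis)

lemma grad_zero_outside:
  assumes "test_function \<phi>" "\<And>x. norm x > R \<Longrightarrow> \<phi> x = 0" "norm x > R"
  shows "grad \<phi> x = 0"
proof -
  have "open {x::real^'a. norm x > R}" by (intro open_Collect_less continuous_intros)
  then have "((\<lambda>x. 0) has_derivative (\<lambda>z. grad \<phi> x \<bullet> z)) (at x)"
    by (rule has_derivative_transform_within_open[OF test_function_has_derivative[OF assms(1)]])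
       (use assms in auto)
  then have "(\<lambda>z. grad \<phi> x \<bullet> z) = (\<lambda>z. 0)"
    using has_derivative_const has_derivative_unique by blast
  then show ?thesis by (metis inner_eq_zero_iff)
qed

text \<open>Iterating this turns bounds on test functions into bounds on their derivatives of any order.\<close>

lemma test_function_partial_deriv:
  assumes "test_function \<phi>"
  shows "test_function (partial_deriv i \<phi>)"
proof -
  obtain R where R: "R > 0" "\<And>x. norm x > R \<Longrightarrow> \<phi> x = 0" using test_function_support[OF assms] by blast
  have "\<And>k. Ck (Suc k) \<phi>" using assms by (auto simp: test_function_def)
  then have "\<And>k. Ck k (partial_deriv i \<phi>)" by auto
  moreover have "partial_deriv i \<phi> x = 0" if "norm x > R" for x
    using grad_zero_outside[OF assms R(2) that] by (auto simp: grad_def vec_eq_iff)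
  ultimately show ?thesis by (rule test_functionI)
qed

lemma test_function_continuous: "test_function \<phi> \<Longrightarrow> continuous_on UNIV \<phi>"
  unfolding test_function_def using Ck_continuous by blast

lemma test_function_bounded:
  assumes "test_function \<phi>"
  obtains B where "B > 0" "\<And>x. \<bar>\<phi> x\<bar> \<le> B"
proof -
  obtain R where R: "R > 0" "\<And>x. norm x > R \<Longrightarrow> \<phi> x = 0" using test_function_support[OF assms] by blast
  have "compact (\<phi> ` cball 0 R)"
    by (intro compact_continuous_image continuous_on_subset[OF test_function_continuous[OF assms]]) auto
  then obtain B where B: "B > 0" "\<And>x. norm x \<le> R \<Longrightarrow> \<bar>\<phi> x\<bar> \<le> B"
    using compact_imp_bounded bounded_pos by (metis imageI mem_cball_0 real_norm_def)
  show ?thesis by (rule that[OF B(1)]) (metis B R(2) abs_zero linorder_not_less order_less_imp_le)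
qed

lemma grad_continuous:
  assumes "test_function \<phi>"
  shows "continuous_on UNIV (grad \<phi>)"
  unfolding grad_def
  by (intro continuous_on_vec_lambda) (use test_function_continuous[OF test_function_partial_deriv[OF assms]] in auto)

lemma grad_bounded:
  fixes \<phi> :: "real^'n \<Rightarrow> real"
  assumes "test_function \<phi>"
  obtains B where "B > 0" "\<And>x. norm (grad \<phi> x) \<le> B"
proof -
  have "\<forall>i. \<exists>B>0. \<forall>x. \<bar>partial_deriv i \<phi> x\<bar> \<le> B"
    using test_function_bounded[OF test_function_partial_deriv[OF assms]] by metis
  then obtain B where B: "\<And>i. B i > 0" "\<And>i x. \<bar>partial_deriv i \<phi> x\<bar> \<le> B i" by metis
  have "norm (grad \<phi> x) \<le> sum B UNIV" for x
    using order_trans[OF norm_le_l1_cart sum_mono[of UNIV "\<lambda>i. \<bar>grad \<phi> x $ i\<bar>" B]] B(2)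
    by (simp add: grad_def)
  moreover have "sum B UNIV > 0" using B by (auto intro!: sum_pos)
  ultimately show ?thesis using that by blast
qed

lemma test_function_Lipschitz:
  assumes "test_function \<phi>" "\<And>x. norm (grad \<phi> x) \<le> B"
  shows "\<bar>\<phi> y - \<phi> x\<bar> \<le> B * norm (y - x)"
proof -
  have "norm (\<phi> y - \<phi> x) \<le> B * norm (y - x)"
  proof (rule differentiable_bound[of UNIV])
    show "(\<phi> has_derivative (\<lambda>z. grad \<phi> x \<bullet> z)) (at x within UNIV)" for x
      using test_function_has_derivative[OF assms(1)] by auto
    show "onorm (\<lambda>z. grad \<phi> x \<bullet> z) \<le> B" for x
      using assms(2)[of x] by (intro onorm_le) (metis Cauchy_Schwarz_ineq2 mult_right_mono norm_ge_zero order_trans real_norm_def)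
  qed auto
  then show ?thesis by simp
qed

text \<open>Differentiability with gradient \<open>g\<close>, in a quantitative form whose constant survives translations
  and products. The doubling argument needs a bound for \<open>x \<mapsto> \<phi> x * \<rho> (x - y)\<close> that does not depend on \<open>y\<close>.\<close>

definition tame :: "real \<Rightarrow> (real^'n \<Rightarrow> real) \<Rightarrow> (real^'n \<Rightarrow> real^'n) \<Rightarrow> bool" where
  "tame B \<phi> g \<longleftrightarrow> B \<ge> 0 \<and> (\<forall>x. \<bar>\<phi> x\<bar> \<le> B) \<and> (\<forall>x. norm (g x) \<le> B) \<and>
     (\<forall>x z. \<bar>\<phi> (x + z) - \<phi> x\<bar> \<le> B * norm z) \<and>
     (\<forall>x z. \<bar>\<phi> (x + z) - \<phi> x - g x \<bullet> z\<bar> \<le> B * (norm z)\<^sup>2)"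

lemma tame_mono: "tame B \<phi> g \<Longrightarrow> B \<le> B' \<Longrightarrow> tame B' \<phi> g"
  unfolding tame_def by (meson mult_right_mono norm_ge_zero order_trans zero_le_power2)

text \<open>The partial derivatives are test functions, hence Lipschitz; by the mean value theorem the
  Taylor remainder is a difference of gradients applied to the increment.\<close>

lemma tame_test_function:
  assumes "test_function \<phi>"
  obtains B where "tame B \<phi> (grad \<phi>)"
proof -
  obtain B0 where B0: "B0 > 0" "\<And>x. \<bar>\<phi> x\<bar> \<le> B0" using test_function_bounded[OF assms] by blast
  obtain B1 where B1: "B1 > 0" "\<And>x. norm (grad \<phi> x) \<le> B1" using grad_bounded[OF assms] by blast
  have "\<forall>i. \<exists>B>0. \<forall>x. norm (grad (partial_deriv i \<phi>) x) \<le> B"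
    using grad_bounded[OF test_function_partial_deriv[OF assms]] by metis
  then obtain C where C: "\<And>i. C i > 0" "\<And>i x. norm (grad (partial_deriv i \<phi>) x) \<le> C i" by metis
  define B2 where "B2 = sum C UNIV"
  have lip: "norm (grad \<phi> y - grad \<phi> x) \<le> B2 * norm (y - x)" for x y
  proof -
    have "norm (grad \<phi> y - grad \<phi> x) \<le> (\<Sum>i\<in>UNIV. \<bar>partial_deriv i \<phi> y - partial_deriv i \<phi> x\<bar>)"
      using norm_le_l1_cart[of "grad \<phi> y - grad \<phi> x"] by (simp add: grad_def)
    also have "\<dots> \<le> (\<Sum>i\<in>UNIV. C i * norm (y - x))"
      by (intro sum_mono test_function_Lipschitz[OF test_function_partial_deriv[OF assms]] C)
    finally show ?thesis by (simp add: B2_def sum_distrib_right)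
  qed
  have B2: "B2 \<ge> 0" unfolding B2_def using C by (simp add: sum_nonneg less_imp_le)
  have rem: "\<bar>\<phi> (x + z) - \<phi> x - grad \<phi> x \<bullet> z\<bar> \<le> B2 * (norm z)\<^sup>2" for x z
  proof -
    have "\<exists>t\<in>{0<..<1}. \<phi> (x + z) - \<phi> x = grad \<phi> (x + t *\<^sub>R z) \<bullet> z"
    proof -
      have D: "((\<lambda>t. \<phi> (x + t *\<^sub>R z)) has_derivative (\<lambda>h. grad \<phi> (x + t *\<^sub>R z) \<bullet> (h *\<^sub>R z))) (at t within S)" for t S
        by (rule has_derivative_at_withinI, rule has_derivative_compose[OF _ test_function_has_derivative[OF assms]])
           (auto intro!: derivative_eq_intros)
      then have "\<exists>t\<in>{0<..<1}. \<phi> (x + 1 *\<^sub>R z) - \<phi> (x + 0 *\<^sub>R z) = grad \<phi> (x + t *\<^sub>R z) \<bullet> ((1 - 0) *\<^sub>R z)"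
        by (intro mvt_simple) auto
      then show ?thesis by simp
    qed
    then obtain t where t: "0 < t" "t < 1" "\<phi> (x + z) - \<phi> x = grad \<phi> (x + t *\<^sub>R z) \<bullet> z" by auto
    have "\<bar>\<phi> (x + z) - \<phi> x - grad \<phi> x \<bullet> z\<bar> = \<bar>(grad \<phi> (x + t *\<^sub>R z) - grad \<phi> x) \<bullet> z\<bar>"
      using t by (simp add: inner_diff_left)
    also have "\<dots> \<le> norm (grad \<phi> (x + t *\<^sub>R z) - grad \<phi> x) * norm z" by (rule Cauchy_Schwarz_ineq2)
    also have "\<dots> \<le> (B2 * norm (t *\<^sub>R z)) * norm z"
      using lip[of "x + t *\<^sub>R z" x] by (intro mult_right_mono) auto
    also have "\<dots> \<le> (B2 * norm z) * norm z"
      using t B2 by (intro mult_right_mono mult_left_mono) (auto simp: mult_left_le_one_le)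
    finally show ?thesis by (simp add: power2_eq_square)
  qed
  define B where "B = Max {B0, B1, B2}"
  have B: "B0 \<le> B" "B1 \<le> B" "B2 \<le> B" by (auto simp: B_def)
  have "tame B \<phi> (grad \<phi>)"
    unfolding tame_def
  proof (intro conjI allI)
    show "0 \<le> B" using B B0 by linarith
    show "\<bar>\<phi> x\<bar> \<le> B" "norm (grad \<phi> x) \<le> B" for x using B B0(2)[of x] B1(2)[of x] by linarith+
    show "\<bar>\<phi> (x + z) - \<phi> x\<bar> \<le> B * norm z" for x z
      using test_function_Lipschitz[OF assms B1(2), of "x+z" x] mult_right_mono[OF B(2), of "norm z"] by simp
    show "\<bar>\<phi> (x + z) - \<phi> x - grad \<phi> x \<bullet> z\<bar> \<le> B * (norm z)\<^sup>2" for x z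
      using rem[of x z] mult_right_mono[OF B(3), of "(norm z)\<^sup>2"] by simp
  qed
  then show ?thesis using that by blast
qed

text \<open>With increments \<open>\<Delta>\<close> and remainders \<open>R\<close>, the remainder of a product is
  \<open>f * R g + g * R f + \<Delta> f * \<Delta> g\<close>; each of the three terms contributes one \<open>A * B\<close>.\<close>

lemma tame_mult:
  assumes f: "tame A f f'" and g: "tame B g g'"
  shows "tame (3 * A * B) (\<lambda>x. f x * g x) (\<lambda>x. f x *\<^sub>R g' x + g x *\<^sub>R f' x)"
proof -
  have A: "A \<ge> 0" "\<And>x. \<bar>f x\<bar> \<le> A" "\<And>x. norm (f' x) \<le> A" "\<And>x z. \<bar>f (x + z) - f x\<bar> \<le> A * norm z"
    "\<And>x z. \<bar>f (x + z) - f x - f' x \<bullet> z\<bar> \<le> A * (norm z)\<^sup>2"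
    and B: "B \<ge> 0" "\<And>x. \<bar>g x\<bar> \<le> B" "\<And>x. norm (g' x) \<le> B" "\<And>x z. \<bar>g (x + z) - g x\<bar> \<le> B * norm z"
    "\<And>x z. \<bar>g (x + z) - g x - g' x \<bullet> z\<bar> \<le> B * (norm z)\<^sup>2"
    using f g unfolding tame_def by auto
  have AB: "0 \<le> A * B" using A B by simp
  have p1: "\<bar>f x * b\<bar> \<le> A * B'" if "\<bar>b\<bar> \<le> B'" for x b B' 
    using that A by (simp add: abs_mult mult_mono)
  have p2: "\<bar>g x * b\<bar> \<le> B * B'" if "\<bar>b\<bar> \<le> B'" for x b B' 
    using that B by (simp add: abs_mult mult_mono)
  show ?thesis unfolding tame_def
  proof (intro conjI allI)
    show "0 \<le> 3 * A * B" using AB by simp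
    show "\<bar>f x * g x\<bar> \<le> 3 * A * B" for x using p1[OF B(2)[of x], of x] AB by simp
    show "norm (f x *\<^sub>R g' x + g x *\<^sub>R f' x) \<le> 3 * A * B" for x
    proof -
      have "norm (f x *\<^sub>R g' x) \<le> A * B" using p1[of "norm (g' x)" B x] B by (simp add: abs_mult)
      moreover have "norm (g x *\<^sub>R f' x) \<le> B * A" using p2[of "norm (f' x)" A x] A by (simp add: abs_mult)
      moreover have "3 * A * B = A * B + B * A + A * B" by simp
      ultimately show ?thesis using AB norm_triangle_ineq[of "f x *\<^sub>R g' x" "g x *\<^sub>R f' x"] by linarith
    qed
    show "\<bar>f (x + z) * g (x + z) - f x * g x\<bar> \<le> 3 * A * B * norm z" for x z
    proof -
      have "f (x + z) * g (x + z) - f x * g x = f (x + z) * (g (x + z) - g x) + g x * (f (x + z) - f x)"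
        by (simp add: algebra_simps)
      moreover have "\<bar>f (x + z) * (g (x + z) - g x)\<bar> \<le> A * (B * norm z)" by (intro p1 B)
      moreover have "\<bar>g x * (f (x + z) - f x)\<bar> \<le> B * (A * norm z)" by (intro p2 A)
      moreover have "A * (B * norm z) \<ge> 0" using A B by simp
      ultimately show ?thesis by (simp add: mult_ac)
    qed
    show "\<bar>f (x + z) * g (x + z) - f x * g x - (f x *\<^sub>R g' x + g x *\<^sub>R f' x) \<bullet> z\<bar> \<le> 3 * A * B * (norm z)\<^sup>2" for x z
    proof -
      have "f (x + z) * g (x + z) - f x * g x - (f x *\<^sub>R g' x + g x *\<^sub>R f' x) \<bullet> z
        = f x * (g (x + z) - g x - g' x \<bullet> z) + g x * (f (x + z) - f x - f' x \<bullet> z) + (f (x + z) - f x) * (g (x + z) - g x)"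
        by (simp add: algebra_simps)
      moreover have "\<bar>f x * (g (x + z) - g x - g' x \<bullet> z)\<bar> \<le> A * (B * (norm z)\<^sup>2)" by (intro p1 B)
      moreover have "\<bar>g x * (f (x + z) - f x - f' x \<bullet> z)\<bar> \<le> B * (A * (norm z)\<^sup>2)" by (intro p2 A)
      moreover have "\<bar>(f (x + z) - f x) * (g (x + z) - g x)\<bar> \<le> (A * norm z) * (B * norm z)"
        unfolding abs_mult using A B by (intro mult_mono) auto
      ultimately show ?thesis by (simp add: power2_eq_square mult_ac)
    qed
  qed
qed

lemma tame_scaleR:
  assumes "tame B \<phi> g"
  shows "tame (\<bar>c\<bar> * B) (\<lambda>x. c * \<phi> x) (\<lambda>x. c *\<^sub>R g x)"
proof -
  have *: "\<bar>c * a\<bar> \<le> \<bar>c\<bar> * B * k" if "\<bar>a\<bar> \<le> B * k" for a k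
    using mult_left_mono[OF that, of "\<bar>c\<bar>"] by (simp add: abs_mult mult_ac)
  have t: "0 \<le> B" "\<And>x. \<bar>\<phi> x\<bar> \<le> B" "\<And>x. norm (g x) \<le> B"
     "\<And>x z. \<bar>\<phi> (x + z) - \<phi> x\<bar> \<le> B * norm z"
     "\<And>x z. \<bar>\<phi> (x + z) - \<phi> x - g x \<bullet> z\<bar> \<le> B * (norm z)\<^sup>2"
    using assms unfolding tame_def by auto
  show ?thesis
    unfolding tame_def
  proof (intro conjI allI)
    show "\<bar>c * \<phi> x\<bar> \<le> \<bar>c\<bar> * B" for x using *[of "\<phi> x" 1] t by simp
    show "norm (c *\<^sub>R g x) \<le> \<bar>c\<bar> * B" for x using t by (simp add: mult_left_mono)
    show "\<bar>c * \<phi> (x + z) - c * \<phi> x\<bar> \<le> \<bar>c\<bar> * B * norm z" for x z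
      using *[OF t(4)] by (simp add: right_diff_distrib)
    show "\<bar>c * \<phi> (x + z) - c * \<phi> x - c *\<^sub>R g x \<bullet> z\<bar> \<le> \<bar>c\<bar> * B * (norm z)\<^sup>2" for x z
      using *[OF t(5)] by (simp add: right_diff_distrib)
  qed (use t in auto)
qed

lemma tame_translate: "tame B \<phi> g \<Longrightarrow> tame B (\<lambda>x. \<phi> (x - c)) (\<lambda>x. g (x - c))"
proof -
  have *: "x + z - c = (x - c) + z" for x z by simp
  assume "tame B \<phi> g"
  then show ?thesis unfolding tame_def * by blast
qed

lemma tame_reflect:
  assumes "tame B \<phi> g"
  shows "tame B (\<lambda>x. \<phi> (c - x)) (\<lambda>x. - g (c - x))"
proof -
  have *: "c - (x + z) = (c - x) + (- z)" for x z by simp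
  show ?thesis
    unfolding tame_def *
  proof (intro conjI allI)
    show "\<bar>\<phi> (c - x + - z) - \<phi> (c - x)\<bar> \<le> B * norm z" for x z
      using assms unfolding tame_def by (metis norm_minus_cancel)
    have "\<bar>\<phi> (c - x + - z) - \<phi> (c - x) - g (c - x) \<bullet> (- z)\<bar> \<le> B * (norm (- z))\<^sup>2" for x z
      using assms unfolding tame_def by blast
    then show "\<bar>\<phi> (c - x + - z) - \<phi> (c - x) - (- g (c - x)) \<bullet> z\<bar> \<le> B * (norm z)\<^sup>2" for x z
      by simp
  qed (use assms in \<open>auto simp: tame_def\<close>)
qed

text \<open>The function \<open>exp (- 1 / t)\<close>, extended by 0 to \<open>t \<le> 0\<close>, has \<open>n\<close>-th derivative
  \<open>P (1 / t) * exp (- 1 / t)\<close> with a polynomial \<open>P\<close> that obeys the following recursion.\<close>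

primrec bump_poly :: "nat \<Rightarrow> real poly" where
  "bump_poly 0 = 1"
| "bump_poly (Suc n) = [:0, 0, 1:] * (bump_poly n - pderiv (bump_poly n))"

definition flat_exp :: "nat \<Rightarrow> real \<Rightarrow> real" where
  "flat_exp n t = (if t > 0 then poly (bump_poly n) (1 / t) * exp (- (1 / t)) else 0)"

lemma poly_exp_tendsto_0: "((\<lambda>x::real. poly q x * exp (- x)) \<longlongrightarrow> 0) at_top"
proof -
  have "((\<lambda>x::real. \<Sum>i\<le>degree q. coeff q i * (x ^ i / exp x)) \<longlongrightarrow> (\<Sum>i\<le>degree q. coeff q i * 0)) at_top"
    by (intro tendsto_intros tendsto_power_div_exp_0)
  then show ?thesis by (simp add: poly_altdef sum_distrib_right exp_minus divide_inverse mult.assoc)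
qed

lemma flat_exp_deriv: "(flat_exp n has_real_derivative flat_exp (Suc n) t) (at t)"
proof -
  consider "t > 0" | "t < 0" | "t = 0" by linarith
  then show ?thesis
  proof cases
    case 1
    have "((\<lambda>t. poly (bump_poly n) (1 / t) * exp (- (1 / t))) has_real_derivative flat_exp (Suc n) t) (at t)"
      using 1 by (auto intro!: derivative_eq_intros DERIV_chain2[where g="\<lambda>t. 1 / t" and f="poly q" for q, OF poly_DERIV]
          simp: flat_exp_def field_simps power2_eq_square)
    then show ?thesis
      by (rule has_field_derivative_transform_within_open[of _ _ _ "{0<..}"])
         (use 1 in \<open>auto simp: flat_exp_def\<close>)
  next
    case 2
    have "((\<lambda>t. 0) has_real_derivative flat_exp (Suc n) t) (at t)"
      using 2 by (simp add: flat_exp_def)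
    then show ?thesis
      by (rule has_field_derivative_transform_within_open[of _ _ _ "{..<0}"])
         (use 2 in \<open>auto simp: flat_exp_def\<close>)
  next
    case 3
    have "((\<lambda>h. poly (pCons 0 (bump_poly n)) (inverse h) * exp (- inverse h)) \<longlongrightarrow> 0) (at_right 0)"
      by (rule filterlim_compose[OF poly_exp_tendsto_0 filterlim_inverse_at_top_right])
    then have R: "((\<lambda>h. flat_exp n h / h) \<longlongrightarrow> 0) (at_right 0)"
      by (rule Lim_transform_eventually)
         (auto simp: flat_exp_def eventually_at_filter divide_inverse)
    have L: "((\<lambda>h. flat_exp n h / h) \<longlongrightarrow> 0) (at_left 0)"
      by (rule Lim_transform_eventually[OF tendsto_const])
         (auto simp: flat_exp_def eventually_at_filter)
    from R L have "((\<lambda>h. flat_exp n h / h) \<longlongrightarrow> 0) (at 0)"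
      by (simp add: filterlim_split_at)
    then show ?thesis using 3 by (simp add: DERIV_def flat_exp_def)
  qed
qed

text \<open>A product over the coordinates, supported in a cube.\<close>

lemma bump_exists:
  assumes "e > 0"
  obtains \<phi> :: "real^'n \<Rightarrow> real" where "test_function \<phi>" "\<And>x. 0 \<le> \<phi> x" "\<phi> 0 = 1" "\<And>x. norm x > e \<Longrightarrow> \<phi> x = 0"
proof -
  define N where "N = real CARD('n)"
  have N: "N > 0" unfolding N_def by simp
  define w :: "real^'n \<Rightarrow> real" where "w = (\<lambda>x. \<Prod>i\<in>UNIV. flat_exp 0 ((1 *\<^sub>R x + 1) $ i) * flat_exp 0 (((-1) *\<^sub>R x + 1) $ i))"
  define c where "c = w 0"
  have c: "c > 0" by (simp add: c_def w_def flat_exp_def prod_pos)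
  define \<phi> where "\<phi> = (\<lambda>x. (1 / c) * w ((N / e) *\<^sub>R x + 0))"
  have Ckw: "Ck k w" for k
    unfolding w_def
    by (intro Ck_prod Ck_mult Ck_affine[where f="\<lambda>x. flat_exp 0 (x $ i)" for i] Ck_coordinate flat_exp_deriv finite)
  \<comment> \<open>some coordinate has modulus at least 1, since the norm is at most the sum of the \<open>N\<close> moduli\<close>
  have w0: "w x = 0" if "norm x > N" for x
  proof -
    have "\<exists>i. \<bar>x $ i\<bar> \<ge> 1"
    proof (rule ccontr)
      assume "\<not> ?thesis"
      then have "(\<Sum>i\<in>UNIV. \<bar>x $ i\<bar>) \<le> (\<Sum>i\<in>(UNIV::'n set). 1)" by (intro sum_mono) (auto simp: not_le less_imp_le)
      then show False using norm_le_l1_cart[of x] that by (simp add: N_def)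
    qed
    then obtain i where i: "\<bar>x $ i\<bar> \<ge> 1" by auto
    show ?thesis unfolding w_def
      by (rule prod_zero) (use i in \<open>auto simp: flat_exp_def intro!: exI[of _ i]\<close>)
  qed
  have supp: "\<phi> x = 0" if "norm x > e" for x
    using that N assms w0[of "(N / e) *\<^sub>R x"] by (simp add: \<phi>_def field_simps)
  show ?thesis
  proof (rule that)
    show "test_function \<phi>"
      by (rule test_functionI[OF _ supp]) (auto simp only: \<phi>_def intro!: Ck_mult Ck_const Ck_affine Ckw)
    show "0 \<le> \<phi> x" for x
      using c by (auto simp: \<phi>_def w_def flat_exp_def intro!: prod_nonneg divide_nonneg_nonneg)
    show "\<phi> 0 = 1" using c by (simp add: \<phi>_def c_def)
  qed (rule supp)
qed

lemma integrable_bounded_support: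
  fixes f :: "'a::euclidean_space \<Rightarrow> 'b::{banach, second_countable_topology}"
  assumes "continuous_on UNIV f" "\<And>x. norm x > R \<Longrightarrow> f x = 0"
  shows "integrable lborel f"
proof -
  have "integrable lborel (\<lambda>x. indicator (cball 0 R) x *\<^sub>R f x)"
    using assms(1) by (intro borel_integrable_compact) (auto intro: continuous_on_subset)
  moreover have "(\<lambda>x. indicator (cball 0 R) x *\<^sub>R f x) = f"
    using assms(2) by (force simp: indicator_def not_le)
  ultimately show ?thesis by simp
qed

lemma test_function_integrable: "test_function \<phi> \<Longrightarrow> integrable lborel \<phi>"
  by (metis integrable_bounded_support test_function_continuous test_function_support)

lemma grad_integrable: "test_function \<phi> \<Longrightarrow> integrable lborel (grad \<phi>)"
  by (metis integrable_bounded_support grad_continuous test_function_support grad_zero_outside)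

lemma test_function_mult:
  assumes "test_function \<phi>" "\<And>k. Ck k \<psi>"
  shows "test_function (\<lambda>x. \<phi> x * \<psi> x)"
proof -
  obtain R where R: "R > 0" "\<And>x. norm x > R \<Longrightarrow> \<phi> x = 0" using test_function_support[OF assms(1)] by blast
  show ?thesis
    by (rule test_functionI[of _ R]) (use assms R in \<open>auto intro!: Ck_mult simp: test_function_def\<close>)
qed

lemma mollifier_exists:
  assumes "e > 0"
  obtains \<rho> :: "real^'n \<Rightarrow> real" where "test_function \<rho>" "\<And>x. 0 \<le> \<rho> x" "(LBINT x. \<rho> x) = 1"
    "\<And>x. norm x > e \<Longrightarrow> \<rho> x = 0"
proof -
  obtain \<phi> :: "real^'n \<Rightarrow> real" where \<phi>: "test_function \<phi>" "\<And>x. 0 \<le> \<phi> x" "\<phi> 0 = 1" "\<And>x. norm x > e \<Longrightarrow> \<phi> x = 0"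
    using bump_exists[OF assms] by blast
  define c where "c = (LBINT x. \<phi> x)"
  have "c \<noteq> 0"
  proof
    assume "c = 0"
    then have "AE x in lborel. \<phi> x = 0"
      unfolding c_def using \<phi> by (subst (asm) integral_nonneg_eq_0_iff_AE) (auto intro: test_function_integrable)
    then have "AE x in lebesgue. x \<in> {x. \<phi> x = 0}" by (auto intro: AE_completion)
    moreover have "closed {x. \<phi> x = 0}"
      by (intro closed_Collect_eq test_function_continuous[OF \<phi>(1)] continuous_on_const)
    ultimately show False using mem_closed_if_AE_lebesgue[of "{x. \<phi> x = 0}" 0] \<phi>(3) by auto
  qed
  moreover have "c \<ge> 0" unfolding c_def using \<phi> by (intro integral_nonneg_AE) auto
  ultimately have c: "c > 0" by simp
  show ?thesis
  proof (rule that[of "\<lambda>x. \<phi> x * (1 / c)"])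
    show "test_function (\<lambda>x. \<phi> x * (1 / c))" by (rule test_function_mult[OF \<phi>(1) Ck_const])
  qed (use \<phi> c in \<open>auto simp: c_def[symmetric]\<close>)
qed

section \<open>Lipschitz functions on the line are differentiable almost everywhere\<close>

text \<open>At almost every \<open>x\<close> the averages of \<open>h\<close> over the intervals \<open>[x, x + t]\<close> tend to \<open>h x\<close>, which is the
  right derivative of \<open>G\<close>; the left derivative comes from the reflected function.\<close>

lemma indefinite_integral_differentiable_AE:
  fixes G h :: "real \<Rightarrow> real"
  assumes int: "\<And>a b. a \<le> b \<Longrightarrow> (h has_integral (G b - G a)) {a..b}"
  shows "AE x in lebesgue. (G has_real_derivative h x) (at x)"
proof -
  have "h integrable_on cbox a b" for a b
    using int[of a b] by (cases "a \<le> b") auto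
  then obtain N where N: "negligible N" "\<And>x e. \<lbrakk>x \<notin> N; 0 < e\<rbrakk> \<Longrightarrow>
      \<exists>d>0. \<forall>t. 0 < t \<and> t < d \<longrightarrow> norm (integral (cbox x (x + t *\<^sub>R One)) h /\<^sub>R t ^ DIM(real) - h x) < e"
    using integrable_ccontinuous_explicit by blast
  have int': "((\<lambda>x. h (- x)) has_integral (G (-a) - G (-b))) {a..b}" if "a \<le> b" for a b
    using has_integral_reflect_lemma_real[OF int[of "-b" "-a"]] that by simp
  then have "(\<lambda>x. h (- x)) integrable_on cbox a b" for a b
    by (cases "a \<le> b") auto
  then obtain M where M: "negligible M" "\<And>x e. \<lbrakk>x \<notin> M; 0 < e\<rbrakk> \<Longrightarrow>
      \<exists>d>0. \<forall>t. 0 < t \<and> t < d \<longrightarrow> norm (integral (cbox x (x + t *\<^sub>R One)) (\<lambda>x. h (- x)) /\<^sub>R t ^ DIM(real) - h (-x)) < e"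
    using integrable_ccontinuous_explicit[of "\<lambda>x. h (- x)"] by blast
  have D: "(G has_real_derivative h x) (at x)" if xN: "x \<notin> N" and xM: "- x \<notin> M" for x
  proof -
    have "((\<lambda>t. (G (x + t) - G x) / t) \<longlongrightarrow> h x) (at_right 0)"
    proof (rule tendstoI)
      fix e :: real assume "e > 0"
      then obtain d where d: "d > 0" "\<And>t. 0 < t \<Longrightarrow> t < d \<Longrightarrow> \<bar>integral {x..x + t} h / t - h x\<bar> < e"
        using N(2)[OF xN, of e] by (auto simp: divide_inverse mult.commute)
      have "\<forall>t. 0 < t \<and> t < d \<longrightarrow> dist ((G (x + t) - G x) / t) (h x) < e"
        using d int[THEN integral_unique, of x] by (auto simp: dist_real_def)
      then show "\<forall>\<^sub>F t in at_right 0. dist ((G (x + t) - G x) / t) (h x) < e"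
        unfolding eventually_at_right_field using d(1) by auto
    qed
    moreover have "((\<lambda>t. (G (x + t) - G x) / t) \<longlongrightarrow> h x) (at_left 0)"
    proof (rule tendstoI)
      fix e :: real assume "e > 0"
      then obtain d where d: "d > 0" "\<And>t. 0 < t \<Longrightarrow> t < d \<Longrightarrow> \<bar>integral {-x..-x + t} (\<lambda>x. h (- x)) / t - h x\<bar> < e"
        using M(2)[OF xM, of e] by (auto simp: divide_inverse mult.commute)
      have "dist ((G (x + t) - G x) / t) (h x) < e" if "-d < t" "t < 0" for t
      proof -
        have "integral {-x..-x + (-t)} (\<lambda>x. h (- x)) = G x - G (x + t)"
          using int'[THEN integral_unique, of "-x" "-x + (-t)"] that by (simp add: add.commute)
        with d(2)[of "-t"] that have "\<bar>(G x - G (x + t)) / (-t) - h x\<bar> < e" by simp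
        moreover have "(G x - G (x + t)) / (-t) = (G (x + t) - G x) / t" using that by (simp add: field_simps)
        ultimately show ?thesis by (simp add: dist_real_def)
      qed
      then show "\<forall>\<^sub>F t in at_left 0. dist ((G (x + t) - G x) / t) (h x) < e"
        unfolding eventually_at_left_field using d(1) by (auto intro!: exI[of _ "-d"])
    qed
    ultimately show ?thesis by (simp add: DERIV_def filterlim_split_at)
  qed
  have "negligible (uminus ` M)"
    using M(1) by (intro negligible_differentiable_image_negligible) auto
  then have "negligible (N \<union> uminus ` M)" using N(1) by simp
  then have "AE x in lebesgue. x \<notin> N \<union> uminus ` M"
    unfolding negligible_iff_null_sets by (rule AE_not_in)
  then show ?thesis
  proof eventually_elim
    case (elim x)
    then have "x \<notin> N" "- x \<notin> M" by (auto simp: image_iff)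
    then show ?case by (rule D)
  qed
qed

lemma emeasure_interval_measure_Ioo:
  assumes "a \<le> b" "\<And>x y. x \<le> y \<Longrightarrow> G x \<le> G y" "continuous_on UNIV G"
  shows "emeasure (interval_measure G) {a<..<b} = ennreal (G b - G a)"
proof (cases "a < b")
  case True
  have Ioc: "emeasure (interval_measure G) {a<..b} = ennreal (G b - G a)"
    using assms by (intro emeasure_interval_measure_Ioc) (auto intro: continuous_within_subset simp: continuous_on_eq_continuous_within)
  have 0: "emeasure (interval_measure G) {b} = 0"
    using emeasure_interval_measure_Icc[of b b G] assms by simp
  have "{a<..b} = {a<..<b} \<union> {b}" using True by auto
  then have "emeasure (interval_measure G) {a<..b} = emeasure (interval_measure G) {a<..<b} + emeasure (interval_measure G) {b}"
    by (simp only:) (rule plus_emeasure[symmetric], auto)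
  then show ?thesis using Ioc 0 by simp
qed (use assms in auto)

text \<open>Both \<open>G\<close> and \<open>x - G x\<close> are nondecreasing, and their Stieltjes measures add up to Lebesgue measure.
  Thus the measure of \<open>G\<close> is absolutely continuous, and the Radon-Nikodym theorem provides \<open>h\<close>.\<close>

lemma Lipschitz_indefinite_integral:
  fixes G :: "real \<Rightarrow> real"
  assumes "\<And>x y. x \<le> y \<Longrightarrow> G x \<le> G y" "\<And>x y. x \<le> y \<Longrightarrow> G y - G x \<le> y - x"
  obtains h where "\<And>a b. a \<le> b \<Longrightarrow> (h has_integral (G b - G a)) {a..b}"
proof -
  have cont: "continuous_on UNIV G"
  proof (rule lipschitz_on_continuous_on)
    show "1-lipschitz_on UNIV G"
    proof (rule lipschitz_onI)
      fix x y :: real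
      show "dist (G x) (G y) \<le> 1 * dist x y"
        using assms[of x y] assms[of y x] by (cases "x \<le> y") (auto simp: dist_real_def)
    qed simp
  qed
  define H where "H x = x - G x" for x
  have H: "x \<le> y \<Longrightarrow> H x \<le> H y" for x y using assms(2)[of x y] by (simp add: H_def)
  have contH: "continuous_on UNIV H" unfolding H_def by (intro continuous_intros cont)
  let ?G = "interval_measure G" and ?H = "interval_measure H"
  define M where "M = measure_of UNIV (sets borel) (\<lambda>A. emeasure ?G A + emeasure ?H A)"
  have M: "emeasure M A = emeasure ?G A + emeasure ?H A" if "A \<in> sets borel" for A
    unfolding M_def
  proof (rule emeasure_measure_of_sigma[OF _ _ _ that])
    show "sigma_algebra UNIV (sets (borel :: real measure))" by (metis sets.sigma_algebra_axioms space_borel)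
    show "countably_additive (sets borel) (\<lambda>A. emeasure ?G A + emeasure ?H A)"
      by (rule countably_additiveI) (simp add: suminf_add[symmetric] suminf_emeasure image_subset_iff)
  qed (simp add: positive_def)
  have setsM: "sets M = sets borel" unfolding M_def by (metis sets.sets_measure_of_eq space_borel)
  have "lborel = M"
  proof (rule lborel_eqI[OF _ setsM])
    fix l u :: real assume "\<And>b. b \<in> Basis \<Longrightarrow> l \<bullet> b \<le> u \<bullet> b"
    then have lu: "l \<le> u" by simp
    have "emeasure M (box l u) = ennreal (G u - G l) + ennreal (H u - H l)"
      using M[of "box l u"] emeasure_interval_measure_Ioo[OF lu assms(1) cont] emeasure_interval_measure_Ioo[OF lu H contH]
      by (simp add: box_real)
    also have "\<dots> = ennreal (u - l)"
      using assms(1)[OF lu] H[OF lu] by (subst ennreal_plus[symmetric]) (auto simp: H_def)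
    finally show "emeasure M (box l u) = ennreal (\<Prod>b\<in>Basis. (u - l) \<bullet> b)" by simp
  qed
  with M have lb: "emeasure lborel A = emeasure ?G A + emeasure ?H A" if "A \<in> sets borel" for A
    using that by simp
  have "absolutely_continuous lborel ?G"
    unfolding absolutely_continuous_def by (auto simp: null_sets_def lb)
  then obtain f where f: "f \<in> borel_measurable lborel" "density lborel f = ?G"
    using sigma_finite_measure.Radon_Nikodym[OF sigma_finite_lborel, of ?G] by auto
  have "((\<lambda>x. enn2real (f x)) has_integral (G b - G a)) {a..b}" if "a \<le> b" for a b
  proof -
    have nn: "(\<integral>\<^sup>+x. f x * indicator {a..b} x \<partial>lborel) = ennreal (G b - G a)"
      using emeasure_interval_measure_Icc[OF that assms(1) cont] emeasure_density[OF f(1), of "{a..b}"]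
      unfolding f(2) by simp
    then have "AE x in lborel. f x * indicator {a..b} x \<noteq> \<infinity>"
      using f by (intro nn_integral_PInf_AE) auto
    then have "(\<integral>\<^sup>+x. ennreal (indicator {a..b} x *\<^sub>R enn2real (f x)) \<partial>lborel) = (\<integral>\<^sup>+x. f x * indicator {a..b} x \<partial>lborel)"
      by (intro nn_integral_cong_AE) (auto simp: indicator_def less_top)
    then have "has_bochner_integral lborel (\<lambda>x. indicator {a..b} x *\<^sub>R enn2real (f x)) (G b - G a)"
      using nn f(1) assms(1)[OF that] by (intro has_bochner_integral_nn_integral) auto
    then have "set_integrable lborel {a..b} (\<lambda>x. enn2real (f x))" "(LINT x:{a..b}|lborel. enn2real (f x)) = G b - G a"
      unfolding set_integrable_def set_lebesgue_integral_def by (auto simp: has_bochner_integral_iff)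
    then show ?thesis using set_borel_integral_eq_integral by (metis has_integral_integral)
  qed
  then show ?thesis using that by blast
qed

lemma Lipschitz_differentiable_AE:
  fixes F :: "real \<Rightarrow> real"
  assumes "L-lipschitz_on UNIV F"
  shows "AE x in lebesgue. \<exists>D. (F has_real_derivative D) (at x)"
proof -
  define K where "K = L + 1"
  have K: "K > 0" using lipschitz_on_nonneg[OF assms] by (simp add: K_def)
  have lip: "\<bar>F y - F x\<bar> \<le> K * (y - x)" if "x \<le> y" for x y
    using lipschitz_onD[OF assms, of y x] that by (simp add: dist_real_def K_def algebra_simps)
  \<comment> \<open>scaled so that \<open>G\<close> is nondecreasing with slope at most 1\<close>
  define G where "G x = x / 2 + F x / (2 * K)" for x
  define q where "q x y = (F y - F x) / (2 * K)" for x y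
  have 1: "\<bar>q x y\<bar> \<le> (y - x) / 2" if "x \<le> y" for x y
    using lip[OF that] K by (simp add: q_def abs_divide field_simps)
  have G: "G x \<le> G y" "G y - G x \<le> y - x" if "x \<le> y" for x y
  proof -
    have eq: "G y - G x = (y - x) / 2 + q x y" by (simp add: G_def q_def diff_divide_distrib)
    have q: "- q x y \<le> (y - x) / 2" "q x y \<le> (y - x) / 2" using 1[OF that] by (simp_all only: abs_le_iff)
    show "G x \<le> G y" using eq q(1) by linarith
    have "G y - G x \<le> (y - x) / 2 + (y - x) / 2" unfolding eq using q(2) by (rule add_left_mono)
    then show "G y - G x \<le> y - x" by (simp only: field_sum_of_halves)
  qed
  obtain h where h: "\<And>a b. a \<le> b \<Longrightarrow> (h has_integral (G b - G a)) {a..b}"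
    using Lipschitz_indefinite_integral[of G] G by blast
  have "AE x in lebesgue. (G has_real_derivative h x) (at x)"
    by (rule indefinite_integral_differentiable_AE) (rule h)
  then
  show ?thesis
  proof eventually_elim
    case (elim x)
    have "((\<lambda>x. 2 * K * (G x - x / 2)) has_real_derivative 2 * K * (h x - 1 / 2)) (at x)"
      by (rule DERIV_cmult[OF DERIV_diff[OF elim]]) (auto intro!: derivative_eq_intros)
    moreover have "(\<lambda>x. 2 * K * (G x - x / 2)) = F" using K by (auto simp: G_def)
    ultimately show ?case by auto
  qed
qed

lemma locally_lipschitz_on_Icc:
  fixes F :: "real \<Rightarrow> 'b::metric_space"
  assumes "locally_lipschitz F"
  obtains L where "L-lipschitz_on {a..b} F"
proof -
  have ll: "local_lipschitz {0::real} {a..b} (\<lambda>_. F)"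
    using assms unfolding locally_lipschitz_def by (rule local_lipschitz_subset) auto
  obtain L where "\<And>t. t \<in> {0::real} \<Longrightarrow> L-lipschitz_on {a..b} F"
    by (rule local_lipschitz_compact_implies_lipschitz[OF ll]) auto
  then show ?thesis using that by blast
qed

lemma locally_lipschitzI:
  fixes F :: "real \<Rightarrow> 'b::metric_space"
  assumes "\<And>a b. \<exists>L. L-lipschitz_on {a..b} F"
  shows "locally_lipschitz F"
  unfolding locally_lipschitz_def
proof (rule local_lipschitzI)
  fix t x :: real
  obtain L where "L-lipschitz_on {x-1..x+1} F" using assms by blast
  then show "\<exists>u>0. \<exists>L. \<forall>t\<in>cball t u \<inter> UNIV. L-lipschitz_on (cball x u \<inter> UNIV) F"
    by (intro exI[of _ 1]) (auto simp: cball_eq_atLeastAtMost)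
qed

lemma locally_lipschitz_differentiable_AE:
  fixes F :: "real \<Rightarrow> real"
  assumes "locally_lipschitz F"
  shows "AE x in lebesgue. \<exists>D. (F has_real_derivative D) (at x)"
proof -
  have "AE x in lebesgue. \<bar>x\<bar> < real n \<longrightarrow> (\<exists>D. (F has_real_derivative D) (at x))" for n :: nat
  proof -
    obtain L where L: "L-lipschitz_on {-real n..real n} F" using locally_lipschitz_on_Icc[OF assms] by blast
    define c where "c x = max (- real n) (min (real n) x)" for x :: real
    have "L-lipschitz_on UNIV (\<lambda>x. F (c x))"
    proof (rule lipschitz_onI)
      fix x y :: real
      have "dist (F (c x)) (F (c y)) \<le> L * dist (c x) (c y)"
        using L by (rule lipschitz_onD) (auto simp: c_def)
      also have "\<dots> \<le> L * dist x y"
        using lipschitz_on_nonneg[OF L] by (intro mult_left_mono) (auto simp: c_def dist_real_def)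
      finally show "dist (F (c x)) (F (c y)) \<le> L * dist x y" .
    qed (use lipschitz_on_nonneg[OF L] in auto)
    from Lipschitz_differentiable_AE[OF this] show ?thesis
    proof eventually_elim
      case (elim x)
      then obtain D where D: "((\<lambda>x. F (c x)) has_real_derivative D) (at x)" by blast
      show ?case
      proof
        assume x: "\<bar>x\<bar> < real n"
        have "(F has_real_derivative D) (at x)"
          by (rule has_field_derivative_transform_within_open[OF D, of "{-real n<..<real n}"]) (use x in \<open>auto simp: c_def\<close>)
        then show "\<exists>D. (F has_real_derivative D) (at x)" by blast
      qed
    qed
  qed
  then have "AE x in lebesgue. \<forall>n. \<bar>x\<bar> < real n \<longrightarrow> (\<exists>D. (F has_real_derivative D) (at x))"
    unfolding AE_all_countable by blast
  then show ?thesis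
  proof eventually_elim
    case (elim x)
    obtain n :: nat where "\<bar>x\<bar> < real n" using reals_Archimedean2 by blast
    with elim show ?case by blast
  qed
qed

section \<open>Smooth approximations of the half entropies and their fluxes\<close>

text \<open>A convex \<open>C\<^sup>2\<close> function with \<open>t - 2 \<le> ramp t \<le> max t 0\<close> that vanishes for \<open>t \<le> 0\<close>. Its rescalings
  \<open>ramp (m * t) / m\<close> tend to the positive part.\<close>

definition ramp :: "real \<Rightarrow> real" where "ramp t = (if t > 0 then t - 2 + (t + 2) * exp (- t) else 0)"
definition ramp' :: "real \<Rightarrow> real" where "ramp' t = (if t > 0 then 1 - (1 + t) * exp (- t) else 0)"
definition ramp'' :: "real \<Rightarrow> real" where "ramp'' t = (if t > 0 then t * exp (- t) else 0)"

lemma DERIV_extend_by_0: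
  fixes G G' :: "real \<Rightarrow> real"
  assumes G: "\<And>t. (G has_real_derivative G' t) (at t)" and 0: "G 0 = 0" "G' 0 = 0"
  shows "((\<lambda>t. if t > 0 then G t else 0) has_real_derivative (if t > 0 then G' t else 0)) (at t)"
proof -
  consider "t > 0" | "t < 0" | "t = 0" by linarith
  then show ?thesis
  proof cases
    case 1
    have "(G has_real_derivative (if t > 0 then G' t else 0)) (at t)" using G[of t] 1 by simp
    then show ?thesis
      by (rule has_field_derivative_transform_within_open[of _ _ _ "{0<..}"]) (use 1 in auto)
  next
    case 2
    have "((\<lambda>t. 0) has_real_derivative (if t > 0 then G' t else 0)) (at t)" using 2 by simp
    then show ?thesis
      by (rule has_field_derivative_transform_within_open[of _ _ _ "{..<0}"]) (use 2 in auto)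
  next
    case 3
    have "((\<lambda>h. G h / h) \<longlongrightarrow> 0) (at 0)" using G[of 0] 0 by (simp add: DERIV_def)
    then have "((\<lambda>h. G h / h) \<longlongrightarrow> 0) (at_right 0)" by (rule tendsto_within_subset) auto
    then have R: "((\<lambda>h. (if h > 0 then G h else 0) / h) \<longlongrightarrow> 0) (at_right 0)"
      by (rule Lim_transform_eventually) (auto simp: eventually_at_filter)
    have L: "((\<lambda>h. (if h > 0 then G h else 0) / h) \<longlongrightarrow> 0) (at_left 0)"
      by (rule Lim_transform_eventually[OF tendsto_const]) (auto simp: eventually_at_filter)
    from R L have "((\<lambda>h. (if h > 0 then G h else 0) / h) \<longlongrightarrow> 0) (at 0)"
      by (simp add: filterlim_split_at)
    then show ?thesis using 3 by (simp add: DERIV_def cong: if_cong)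
  qed
qed

lemma ramp_deriv: "(ramp has_real_derivative ramp' t) (at t)"
  unfolding ramp_def[abs_def] ramp'_def
  by (rule DERIV_extend_by_0) (auto intro!: derivative_eq_intros simp: algebra_simps)

lemma ramp'_deriv: "(ramp' has_real_derivative ramp'' t) (at t)"
  unfolding ramp'_def[abs_def] ramp''_def
  by (rule DERIV_extend_by_0) (auto intro!: derivative_eq_intros simp: algebra_simps)

lemma ramp''_nonneg: "0 \<le> ramp'' t" by (simp add: ramp''_def)

lemma ramp''_continuous: "continuous_on UNIV ramp''"
proof -
  have eq: "ramp'' = (\<lambda>t. max t 0 * exp (- max t 0))" by (auto simp: ramp''_def fun_eq_iff max_def)
  show ?thesis unfolding eq by (intro continuous_intros)
qed

lemma ramp'_mono: "x \<le> y \<Longrightarrow> ramp' x \<le> ramp' y"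
  using DERIV_nonneg_imp_nondecreasing[of x y ramp'] ramp'_deriv ramp''_nonneg by blast

lemma ramp'_bounds: "0 \<le> ramp' t" "ramp' t \<le> 1"
proof -
  show "0 \<le> ramp' t"
  proof (cases "t > 0")
    case True
    then show ?thesis using ramp'_mono[of 0 t] by (simp add: ramp'_def[of 0])
  qed (simp add: ramp'_def)
  show "ramp' t \<le> 1" by (simp add: ramp'_def)
qed

lemma ramp_bounds: "0 \<le> ramp t" "ramp t \<le> max t 0"
proof -
  have "0 \<le> ramp t \<and> ramp t \<le> t" if "t > 0"
  proof -
    have "ramp 0 \<le> ramp t"
      using that ramp_deriv ramp'_bounds(1) by (intro DERIV_nonneg_imp_nondecreasing[of 0 t ramp]) auto
    moreover have "ramp t - t \<le> ramp 0 - 0"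
      using that ramp'_bounds(2)
      by (intro DERIV_nonpos_imp_nonincreasing[of 0 t "\<lambda>t. ramp t - t"]) (auto intro!: exI derivative_eq_intros ramp_deriv)
    ultimately show ?thesis by (simp add: ramp_def[of 0])
  qed
  then show "0 \<le> ramp t" "ramp t \<le> max t 0" by (cases "t > 0"; auto simp: ramp_def)+
qed

text \<open>The value 0 at 0 is the limit of \<open>ramp' (m * 0)\<close>; it makes the inequality
  \<open>heaviside a * (c - a) \<le> max c 0 - max a 0\<close> of the doubling argument hold for all \<open>a\<close> and \<open>c\<close>.\<close>

definition heaviside :: "real \<Rightarrow> real" where "heaviside t = (if t > 0 then 1 else 0)"

lemma heaviside_measurable [measurable]: "heaviside \<in> borel_measurable borel"
  unfolding heaviside_def[abs_def] by measurable

lemma ramp'_tendsto: "(\<lambda>n. ramp' (real (Suc n) * t)) \<longlonglongrightarrow> heaviside t"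
proof (cases "t > 0")
  case True
  have "((\<lambda>x::real. 1 - (exp (- x) + x ^ 1 / exp x)) \<longlongrightarrow> 1 - (0 + 0)) at_top"
    by (intro tendsto_intros tendsto_power_div_exp_0 filterlim_compose[OF exp_at_bot] filterlim_uminus_at_bot_at_top)
  moreover have "filterlim (\<lambda>n. real (Suc n) * t) at_top sequentially"
    unfolding mult.commute[of _ t]
    by (rule filterlim_tendsto_pos_mult_at_top[OF tendsto_const True
          filterlim_compose[OF filterlim_real_sequentially filterlim_Suc]])
  ultimately have "(\<lambda>n. 1 - (exp (- (real (Suc n) * t)) + (real (Suc n) * t) ^ 1 / exp (real (Suc n) * t))) \<longlonglongrightarrow> 1 - (0 + 0)"
    by (rule filterlim_compose)
  then show ?thesis using True
    by (simp add: ramp'_def heaviside_def exp_minus field_simps del: of_nat_Suc)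
next
  case False
  have "\<not> 0 < real (Suc n) * t" for n using False by (simp add: zero_less_mult_iff)
  then show ?thesis using False by (simp add: ramp'_def heaviside_def del: of_nat_Suc)
qed

lemma ramp_lower: "t - 2 \<le> ramp t"
  by (auto simp: ramp_def)

lemma ramp_tendsto: "(\<lambda>n. ramp (real (Suc n) * t) / real (Suc n)) \<longlonglongrightarrow> max t 0"
proof (cases "t > 0")
  case True
  show ?thesis
  proof (rule tendsto_sandwich)
    have "(\<lambda>n. t - 2 * inverse (real (Suc n))) \<longlonglongrightarrow> t - 2 * 0"
      by (intro tendsto_intros LIMSEQ_inverse_real_of_nat)
    then show "(\<lambda>n. t - 2 * inverse (real (Suc n))) \<longlonglongrightarrow> max t 0" using True by simp
    show "(\<lambda>n. max t 0) \<longlonglongrightarrow> max t 0" by (rule tendsto_const)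
    show "\<forall>\<^sub>F n in sequentially. t - 2 * inverse (real (Suc n)) \<le> ramp (real (Suc n) * t) / real (Suc n)"
    proof (rule always_eventually, rule allI)
      fix n
      have "(real (Suc n) * t - 2) / real (Suc n) \<le> ramp (real (Suc n) * t) / real (Suc n)"
        by (intro divide_right_mono ramp_lower) simp
      then show "t - 2 * inverse (real (Suc n)) \<le> ramp (real (Suc n) * t) / real (Suc n)"
        by (simp add: diff_divide_distrib divide_inverse[of 2] del: of_nat_Suc)
    qed
    show "\<forall>\<^sub>F n in sequentially. ramp (real (Suc n) * t) / real (Suc n) \<le> max t 0"
    proof (rule always_eventually, rule allI)
      fix n
      have "ramp (real (Suc n) * t) / real (Suc n) \<le> max (real (Suc n) * t) 0 / real (Suc n)"
        by (intro divide_right_mono ramp_bounds) simp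
      then show "ramp (real (Suc n) * t) / real (Suc n) \<le> max t 0"
        using True by (simp add: max_def del: of_nat_Suc split: if_splits)
    qed
  qed
next
  case False
  have "\<not> 0 < real (Suc n) * t" for n using False by (simp add: zero_less_mult_iff)
  then show ?thesis using False by (simp add: ramp_def del: of_nat_Suc)
qed

text \<open>For \<open>m\<close> tending to infinity these approximate \<open>(r - k)\<^sup>+\<close> if \<open>\<sigma> = 1\<close> and \<open>(k - r)\<^sup>+\<close> if \<open>\<sigma> = -1\<close>.\<close>

definition smooth_entropy :: "real \<Rightarrow> real \<Rightarrow> real \<Rightarrow> real \<Rightarrow> real" where
  "smooth_entropy m \<sigma> k r = ramp (m * (\<sigma> * (r - k))) / m"

lemma smooth_entropy_deriv: "m > 0 \<Longrightarrow> (smooth_entropy m \<sigma> k has_real_derivative \<sigma> * ramp' (m * (\<sigma> * (r - k)))) (at r)"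
  unfolding smooth_entropy_def[abs_def]
  by (rule derivative_eq_intros DERIV_chain2[OF ramp_deriv] refl | simp)+

lemma smooth_entropy_deriv2:
  "((\<lambda>r. \<sigma> * ramp' (m * (\<sigma> * (r - k)))) has_real_derivative m * \<sigma>\<^sup>2 * ramp'' (m * (\<sigma> * (r - k)))) (at r)"
  by (rule derivative_eq_intros DERIV_chain2[OF ramp'_deriv] refl | simp add: power2_eq_square)+

lemma deriv_smooth_entropy: "m > 0 \<Longrightarrow> deriv (smooth_entropy m \<sigma> k) r = \<sigma> * ramp' (m * (\<sigma> * (r - k)))"
  by (rule DERIV_imp_deriv[OF smooth_entropy_deriv])

lemma smooth_entropy_C2: "m > 0 \<Longrightarrow> C2_real (smooth_entropy m \<sigma> k)"
  unfolding C2_real_def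
  by (rule exI[of _ "\<lambda>r. \<sigma> * ramp' (m * (\<sigma> * (r - k)))"], rule exI[of _ "\<lambda>r. m * \<sigma>\<^sup>2 * ramp'' (m * (\<sigma> * (r - k)))"])
     (auto intro!: smooth_entropy_deriv smooth_entropy_deriv2 continuous_intros continuous_on_compose2[OF ramp''_continuous])

lemma smooth_entropy_convex: "m > 0 \<Longrightarrow> convex_on UNIV (smooth_entropy m \<sigma> k)"
proof (rule convex_on_realI)
  assume m: "m > 0"
  show "(smooth_entropy m \<sigma> k has_real_derivative \<sigma> * ramp' (m * (\<sigma> * (r - k)))) (at r)" for r by (rule smooth_entropy_deriv[OF m])
  show "\<sigma> * ramp' (m * (\<sigma> * (x - k))) \<le> \<sigma> * ramp' (m * (\<sigma> * (y - k)))" if "x \<le> y" for x y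
  proof (rule DERIV_nonneg_imp_nondecreasing[OF that])
    fix r
    show "\<exists>d. ((\<lambda>r. \<sigma> * ramp' (m * (\<sigma> * (r - k)))) has_real_derivative d) (at r) \<and> 0 \<le> d"
      using smooth_entropy_deriv2[of \<sigma> m k r] m ramp''_nonneg by (intro exI conjI) (assumption, simp)
  qed
qed auto

lemma lipschitz_on_vec_nth:
  fixes F :: "real \<Rightarrow> real^'n"
  assumes "L-lipschitz_on S F"
  shows "L-lipschitz_on S (\<lambda>t. F t $ i)"
proof (rule lipschitz_onI)
  fix x y assume "x \<in> S" "y \<in> S"
  from lipschitz_onD[OF assms this] show "dist (F x $ i) (F y $ i) \<le> L * dist x y"
    using dist_vec_nth_le[of "F x" i "F y"] by linarith
qed (rule lipschitz_on_nonneg[OF assms])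

lemma C1_lipschitz_Icc:
  fixes Q :: "real \<Rightarrow> 'a::euclidean_space"
  assumes "\<And>r. (Q has_vector_derivative q r) (at r)" "continuous_on UNIV q"
  shows "\<exists>L. L-lipschitz_on {a..b} Q"
proof -
  have "compact (q ` {a..b})" by (intro compact_continuous_image continuous_on_subset[OF assms(2)]) auto
  then obtain B where B: "B > 0" "\<And>r. r \<in> {a..b} \<Longrightarrow> norm (q r) \<le> B"
    by (metis bounded_pos compact_imp_bounded image_eqI)
  have "B-lipschitz_on {a..b} Q"
  proof (rule bounded_derivative_imp_lipschitz)
    show "(Q has_derivative (\<lambda>h. h *\<^sub>R q r)) (at r within {a..b})" if "r \<in> {a..b}" for r
      using assms(1)[of r] by (simp add: has_vector_derivative_def has_derivative_at_withinI)
    show "onorm (\<lambda>h. h *\<^sub>R q r) \<le> B" if "r \<in> {a..b}" for r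
      using B(2)[OF that] by (intro onorm_le) (simp add: mult.commute[of B] mult_left_mono)
  qed (use B in auto)
  then show ?thesis by blast
qed

text \<open>This is the integral of \<open>\<tau>\<close> times the second derivative of \<open>\<tau> \<mapsto> ramp (m * \<tau>) / m\<close> over \<open>[0, t]\<close>. It
  measures the distance between the flux of the smooth entropy and that of the half entropy.\<close>

definition gap :: "real \<Rightarrow> real \<Rightarrow> real" where "gap m t = t * ramp' (m * t) - ramp (m * t) / m"

lemma gap_deriv: "m > 0 \<Longrightarrow> (gap m has_real_derivative m * t * ramp'' (m * t)) (at t)"
  unfolding gap_def[abs_def]
  by (rule derivative_eq_intros DERIV_chain2[OF ramp_deriv] DERIV_chain2[OF ramp'_deriv] refl | simp)+

lemma gap_bounds: "m > 0 \<Longrightarrow> gap m t \<le> \<bar>t\<bar>"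
proof -
  assume m: "m > 0"
  have "t * ramp' (m * t) \<le> \<bar>t\<bar> * 1"
    using ramp'_bounds[of "m * t"] by (intro mult_mono) auto
  moreover have "0 \<le> ramp (m * t) / m" using m ramp_bounds by simp
  ultimately show ?thesis by (simp add: gap_def)
qed

lemma gap_tendsto: "(\<lambda>n. gap (real (Suc n)) t) \<longlonglongrightarrow> 0"
proof -
  have "(\<lambda>n. gap (real (Suc n)) t) \<longlonglongrightarrow> t * heaviside t - max t 0"
    unfolding gap_def by (intro tendsto_intros ramp'_tendsto ramp_tendsto)
  then show ?thesis by (simp add: heaviside_def max_def split: if_splits)
qed

text \<open>Since \<open>F\<close> is only Lipschitz, the flux with \<open>\<Phi>' = \<eta>' * F'\<close> is written in the integrated form
  \<open>\<eta>' * (F - F k) - Q\<close>, where \<open>Q\<close> is an antiderivative of \<open>\<eta>'' * (F - F k)\<close> with \<open>Q k = 0\<close>. As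
  \<open>F - F k\<close> grows at most linearly away from \<open>k\<close>, the term \<open>Q\<close> is controlled by \<open>gap\<close>.\<close>

lemma entropy_flux_exists:
  fixes F :: "real \<Rightarrow> real^'n"
  assumes F: "locally_lipschitz F" and m: "m > 0" and \<sigma>: "\<sigma> = 1 \<or> \<sigma> = -1"
  obtains \<Phi> where "entropy_flux F (smooth_entropy m \<sigma> k) \<Phi>"
    "\<And>M L r. L-lipschitz_on {-M..M} F \<Longrightarrow> \<bar>k\<bar> \<le> M \<Longrightarrow> \<bar>r\<bar> \<le> M \<Longrightarrow>
       norm (\<Phi> r - (\<sigma> * ramp' (m * (\<sigma> * (r - k)))) *\<^sub>R (F r - F k)) \<le> L * gap m (\<sigma> * (r - k))"
proof -
  define e1 e2 where "e1 r = \<sigma> * ramp' (m * (\<sigma> * (r - k)))" and "e2 r = m * ramp'' (m * (\<sigma> * (r - k)))" for r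
  have e1: "(e1 has_real_derivative e2 r) (at r)" for r
    using smooth_entropy_deriv2[of \<sigma> m k r] \<sigma> unfolding e1_def[abs_def] e2_def by auto
  have contF: "continuous_on UNIV F"
    using F unfolding locally_lipschitz_def by (rule local_lipschitz_continuous_on) auto
  have conte2: "continuous_on UNIV e2" unfolding e2_def
    by (auto intro!: continuous_intros continuous_on_compose2[OF ramp''_continuous])
  define q where "q r = e2 r *\<^sub>R (F r - F k)" for r
  have contq: "continuous_on UNIV q" unfolding q_def by (intro continuous_intros contF conte2)
  have "\<exists>Q. \<forall>x::real. -\<infinity> < ereal x \<longrightarrow> ereal x < \<infinity> \<longrightarrow> (Q has_vector_derivative q x) (at x)"
    using contq by (intro einterval_antiderivative) (auto simp: continuous_on_eq_continuous_at)
  then obtain Q0 where Q0: "\<And>x. (Q0 has_vector_derivative q x) (at x)" by auto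
  define Q where "Q r = Q0 r - Q0 k" for r
  have Q: "(Q has_vector_derivative q x) (at x)" for x
    unfolding Q_def[abs_def] using has_vector_derivative_diff[OF Q0 has_vector_derivative_const] by simp
  define \<Phi> where "\<Phi> r = e1 r *\<^sub>R (F r - F k) - Q r" for r
  show ?thesis
  proof (rule that[of \<Phi>])
    show "entropy_flux F (smooth_entropy m \<sigma> k) \<Phi>"
      unfolding entropy_flux_def
    proof (intro conjI allI)
      show "locally_lipschitz \<Phi>"
      proof (rule locally_lipschitzI)
        fix a b
        obtain L1 where L1: "L1-lipschitz_on {a..b} F" using locally_lipschitz_on_Icc[OF F] by blast
        obtain L2 where L2: "L2-lipschitz_on {a..b} Q" using C1_lipschitz_Icc[OF Q contq] by blast
        obtain L3 where L3: "L3-lipschitz_on {a..b} e1"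
          using C1_lipschitz_Icc[of e1 e2 a b] e1 conte2 by (auto simp: has_real_derivative_iff_has_vector_derivative)
        have "compact ((\<lambda>r. F r - F k) ` {a..b})"
          by (rule compact_continuous_image)
             (intro continuous_on_diff continuous_on_const continuous_on_subset[OF contF] subset_UNIV, simp)
        then have "bounded ((\<lambda>r. F r - F k) ` {a..b})" by (rule compact_imp_bounded)
        then obtain B where B: "B > 0" "\<And>r. r \<in> {a..b} \<Longrightarrow> norm (F r - F k) \<le> B"
          unfolding bounded_pos by blast
        have B1: "\<bar>e1 r\<bar> \<le> 1" for r using \<sigma> ramp'_bounds[of "m * (\<sigma> * (r - k))"] by (auto simp: e1_def)
        have "(L3 * B + L1)-lipschitz_on {a..b} (\<lambda>r. e1 r *\<^sub>R (F r - F k))"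
        proof (rule lipschitz_onI)
          fix x y assume xy: "x \<in> {a..b}" "y \<in> {a..b}"
          have "e1 x *\<^sub>R (F x - F k) - e1 y *\<^sub>R (F y - F k) = (e1 x - e1 y) *\<^sub>R (F x - F k) + e1 y *\<^sub>R (F x - F y)"
            by (simp add: algebra_simps)
          then have "dist (e1 x *\<^sub>R (F x - F k)) (e1 y *\<^sub>R (F y - F k)) \<le> \<bar>e1 x - e1 y\<bar> * norm (F x - F k) + \<bar>e1 y\<bar> * norm (F x - F y)"
            using norm_triangle_ineq[of "(e1 x - e1 y) *\<^sub>R (F x - F k)" "e1 y *\<^sub>R (F x - F y)"] by (simp add: dist_norm)
          also have "\<dots> \<le> (L3 * dist x y) * B + 1 * (L1 * dist x y)"
            using lipschitz_onD[OF L3 xy] lipschitz_onD[OF L1 xy] B xy B1 lipschitz_on_nonneg[OF L3]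
            by (intro add_mono mult_mono) (auto simp: dist_norm)
          finally show "dist (e1 x *\<^sub>R (F x - F k)) (e1 y *\<^sub>R (F y - F k)) \<le> (L3 * B + L1) * dist x y"
            by (simp add: algebra_simps)
        qed (use B lipschitz_on_nonneg[OF L3] lipschitz_on_nonneg[OF L1] in auto)
        from lipschitz_on_diff[OF this L2] show "\<exists>L. L-lipschitz_on {a..b} \<Phi>"
          unfolding \<Phi>_def[abs_def] by blast
      qed
      fix i
      have "locally_lipschitz (\<lambda>t. F t $ i)"
      proof (rule locally_lipschitzI)
        fix a b
        obtain L1 where "L1-lipschitz_on {a..b} F" using locally_lipschitz_on_Icc[OF F] by blast
        then show "\<exists>L. L-lipschitz_on {a..b} (\<lambda>t. F t $ i)" using lipschitz_on_vec_nth by blast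
      qed
      from locally_lipschitz_differentiable_AE[OF this]
      show "AE r in lebesgue. \<exists>D. ((\<lambda>t. F t $ i) has_real_derivative D) (at r) \<and>
          ((\<lambda>t. \<Phi> t $ i) has_real_derivative deriv (smooth_entropy m \<sigma> k) r * D) (at r)"
      proof eventually_elim
        case (elim r)
        then obtain D where D: "((\<lambda>t. F t $ i) has_real_derivative D) (at r)" by blast
        have Qi: "((\<lambda>t. Q t $ i) has_real_derivative q r $ i) (at r)"
          using bounded_linear.has_vector_derivative[OF bounded_linear_vec_nth Q]
          by (simp add: has_real_derivative_iff_has_vector_derivative)
        have "((\<lambda>t. e1 t * (F t $ i - F k $ i) - Q t $ i) has_real_derivative
           (e2 r * (F r $ i - F k $ i) + (D - 0) * e1 r) - q r $ i) (at r)"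
          by (rule DERIV_diff[OF DERIV_mult[OF e1 DERIV_diff[OF D DERIV_const]] Qi])
        then have "((\<lambda>t. \<Phi> t $ i) has_real_derivative deriv (smooth_entropy m \<sigma> k) r * D) (at r)"
          by (simp add: \<Phi>_def q_def deriv_smooth_entropy[OF m] e1_def[symmetric] mult.commute)
        with D show ?case by blast
      qed
    qed
  next
    fix M L r assume L: "L-lipschitz_on {-M..M} F" and k: "\<bar>k\<bar> \<le> M" and r: "\<bar>r\<bar> \<le> M"
    have L0: "0 \<le> L" by (rule lipschitz_on_nonneg[OF L])
    define d where "d = \<bar>r - k\<bar>"
    have "\<exists>\<tau>::real. (\<tau> = 1 \<or> \<tau> = -1) \<and> \<tau> * d = r - k"
      unfolding d_def by (rule exI[of _ "if k \<le> r then 1 else -1"]) simp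
    then obtain \<tau> :: real where d: "\<tau> = 1 \<or> \<tau> = -1" "\<tau> * d = r - k" by blast
    have dnn: "0 \<le> d" by (simp add: d_def)
    \<comment> \<open>\<open>t\<close> parametrizes the segment from \<open>k\<close> to \<open>r\<close>, of length \<open>d\<close>\<close>
    have in_range: "k + \<tau> * t \<in> {-M..M}" if "0 < t" "t < d" for t
    proof (cases "k \<le> r")
      case True
      then have "\<tau> * d \<ge> 0" "d = r - k" using d(2) by (auto simp: d_def)
      show ?thesis using d(1)
      proof
        assume "\<tau> = 1"
        then show ?thesis using that k r \<open>d = r - k\<close> by (auto simp: abs_le_iff)
      next
        assume "\<tau> = -1"
        then show ?thesis using that \<open>\<tau> * d \<ge> 0\<close> by simp
      qed
    next
      case False
      then have "\<tau> * d \<le> 0" "d = k - r" using d(2) by (auto simp: d_def)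
      show ?thesis using d(1)
      proof
        assume "\<tau> = -1"
        then show ?thesis using that k r \<open>d = k - r\<close> by (auto simp: abs_le_iff)
      next
        assume "\<tau> = 1"
        then show ?thesis using that \<open>\<tau> * d \<le> 0\<close> by simp
      qed
    qed
    have "norm (Q (k + \<tau> * d) - Q (k + \<tau> * 0)) \<le> (L * gap m (\<sigma> * \<tau> * d)) - L * gap m (\<sigma> * \<tau> * 0)"
    proof (cases "d = 0")
      case False
      then have d0: "0 < d" using dnn by simp
      have DQ: "((\<lambda>t. Q (k + \<tau> * t)) has_vector_derivative \<tau> *\<^sub>R q (k + \<tau> * t)) (at t)" for t
      proof -
        have "((\<lambda>t. k + \<tau> * t) has_real_derivative \<tau>) (at t)" by (auto intro!: derivative_eq_intros)
        from vector_diff_chain_at[OF this[unfolded has_real_derivative_iff_has_vector_derivative] Q]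
        show ?thesis by (simp add: o_def)
      qed
      have DG: "((\<lambda>t. L * gap m (\<sigma> * \<tau> * t)) has_real_derivative L * (m * t * ramp'' (m * (\<sigma> * \<tau> * t)))) (at t)" for t
        by (rule derivative_eq_intros DERIV_chain2[OF gap_deriv[OF m]] refl)+ (use \<sigma> d in auto)
      show ?thesis
      proof (rule differentiable_bound_general[OF d0])
        show "continuous_on {0..d} (\<lambda>t. Q (k + \<tau> * t))"
          using DQ by (intro continuous_at_imp_continuous_on ballI) (blast intro: has_vector_derivative_continuous)
        show "continuous_on {0..d} (\<lambda>t. L * gap m (\<sigma> * \<tau> * t))"
          using DG by (intro continuous_at_imp_continuous_on ballI) (blast intro: DERIV_isCont)
        fix t assume t: "0 < t" "t < d"
        show "((\<lambda>t. Q (k + \<tau> * t)) has_vector_derivative \<tau> *\<^sub>R q (k + \<tau> * t)) (at t)" by (rule DQ)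
        show "((\<lambda>t. L * gap m (\<sigma> * \<tau> * t)) has_vector_derivative L * (m * t * ramp'' (m * (\<sigma> * \<tau> * t)))) (at t)"
          using DG by (simp add: has_real_derivative_iff_has_vector_derivative)
        have "k \<in> {-M..M}" using k by (simp add: abs_le_iff)
        then have "norm (F (k + \<tau> * t) - F k) \<le> L * \<bar>\<tau> * t\<bar>"
          using lipschitz_onD[OF L in_range[OF t], of k] by (simp add: dist_norm)
        also have "\<bar>\<tau> * t\<bar> = t" using d(1) t by auto
        finally have "norm (F (k + \<tau> * t) - F k) \<le> L * t" .
        then have "norm (\<tau> *\<^sub>R q (k + \<tau> * t)) \<le> (m * ramp'' (m * (\<sigma> * \<tau> * t))) * (L * t)"
          using m ramp''_nonneg[of "m * (\<sigma> * \<tau> * t)"] d(1) by (auto simp: q_def e2_def abs_mult mult.assoc intro!: mult_left_mono)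
        then show "norm (\<tau> *\<^sub>R q (k + \<tau> * t)) \<le> L * (m * t * ramp'' (m * (\<sigma> * \<tau> * t)))" by (simp add: mult_ac)
      qed
    qed simp
    moreover have "\<sigma> * \<tau> * d = \<sigma> * (r - k)" by (simp only: d(2) mult.assoc)
    moreover have "k + \<tau> * d = r" by (simp only: d(2))
    ultimately have "norm (Q r) \<le> L * gap m (\<sigma> * (r - k))"
      by (simp add: Q_def gap_def[of m 0] ramp_def[of 0])
    then show "norm (\<Phi> r - (\<sigma> * ramp' (m * (\<sigma> * (r - k)))) *\<^sub>R (F r - F k)) \<le> L * gap m (\<sigma> * (r - k))"
      by (simp add: \<Phi>_def e1_def)
  qed
qed

section \<open>The singular kernel\<close>

text \<open>If \<open>f\<close> is not integrable, its Bochner integral is 0 and the bound holds as well.\<close>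

lemma integral_abs_le:
  fixes f g :: "_ \<Rightarrow> real"
  assumes "integrable M g" "\<And>x. \<bar>f x\<bar> \<le> g x"
  shows "\<bar>LINT x|M. f x\<bar> \<le> (LINT x|M. g x)"
proof (cases "integrable M f")
  case True
  then show ?thesis
    using assms order_trans[OF integral_abs_bound[of M f] integral_mono[of M "\<lambda>x. \<bar>f x\<bar>" g]] by simp
next
  case False
  moreover have "0 \<le> (LINT x|M. g x)"
    by (intro integral_nonneg_AE) (auto intro: order_trans[OF abs_ge_zero assms(2)])
  ultimately show ?thesis by (simp add: not_integrable_integral_eq)
qed

lemma
  fixes f :: "'a::euclidean_space \<Rightarrow> 'b::{banach, second_countable_topology}"
  shows integral_translate: "f \<in> borel_measurable borel \<Longrightarrow> (LBINT x. f (x + h)) = (LBINT x. f x)"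
    and integrable_translate: "integrable lborel f \<Longrightarrow> integrable lborel (\<lambda>x. f (x + h))"
proof -
  have d: "lborel = distr lborel borel (\<lambda>x. x + h)"
    unfolding add.commute[of _ h] by (rule lborel_distr_plus[symmetric])
  show "(LBINT x. f (x + h)) = (LBINT x. f x)" if "f \<in> borel_measurable borel"
    using that by (subst (2) d, subst integral_distr) auto
  show "integrable lborel (\<lambda>x. f (x + h))" if "integrable lborel f"
    using that by (subst (asm) d, subst (asm) integrable_distr_eq) auto
qed

lemma
  fixes f :: "'a::euclidean_space \<Rightarrow> 'b::{banach, second_countable_topology}"
  shows integral_reflect: "f \<in> borel_measurable borel \<Longrightarrow> (LBINT x. f (h - x)) = (LBINT x. f x)"
    and integrable_reflect: "integrable lborel f \<Longrightarrow> integrable lborel (\<lambda>x. f (h - x))"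
proof -
  have d: "lborel = distr lborel borel (\<lambda>x. h - x)"
    using lborel_affine[of "-1" h] by (simp add: density_1 one_ennreal_def[symmetric])
  show "(LBINT x. f (h - x)) = (LBINT x. f x)" if "f \<in> borel_measurable borel"
    using that by (subst (2) d, subst integral_distr) auto
  show "integrable lborel (\<lambda>x. f (h - x))" if "integrable lborel f"
    using that by (subst (asm) d, subst (asm) integrable_distr_eq) auto
qed

text \<open>For \<open>p = N + s\<close> this weight dominates all the kernels below: the integrands of the near part are
  of second order at 0, those of the far part are bounded.\<close>

definition levy :: "real \<Rightarrow> 'a::euclidean_space \<Rightarrow> real" where
  "levy p z = min 1 ((norm z)\<^sup>2) / norm z powr p"

lemma levy_nonneg [simp]: "0 \<le> levy p z" by (simp add: levy_def)

lemma levy_0 [simp]: "levy p 0 = 0" by (simp add: levy_def)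

lemma levy_measurable [measurable]: "levy p \<in> borel_measurable borel"
  unfolding levy_def by measurable

lemma dyadic_above:
  fixes t :: real
  assumes "1 \<le> t"
  obtains n :: nat where "2 ^ n \<le> t" "t < 2 ^ Suc n"
proof -
  obtain m :: nat where m: "t < 2 ^ m" using real_arch_pow[of 2 t] by auto
  define k where "k = (LEAST n::nat. t < 2 ^ n)"
  have k: "t < 2 ^ k" unfolding k_def by (rule LeastI[of _ m]) (rule m)
  then obtain n where n: "k = Suc n" using assms by (cases k) auto
  have "\<not> t < 2 ^ n" using not_less_Least[of n "\<lambda>n. t < 2 ^ n"] n by (simp add: k_def)
  then show ?thesis using that k n by (simp add: not_less)
qed

lemma term_le_suminf: "f n \<le> (\<Sum>n. f n)" for f :: "nat \<Rightarrow> ennreal"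
  using sum_le_suminf[of f "{n}"] by simp

text \<open>Dyadic decomposition: on the shell \<open>2\<^sup>n \<le> \<bar>z\<bar> < 2\<^sup>n\<^sup>+\<^sup>1\<close> the weight is at most \<open>2 powr (- p * n)\<close> while the
  volume is of order \<open>2 powr (d * n)\<close>; near 0 the factor \<open>\<bar>z\<bar>\<^sup>2\<close> improves the exponent by 2. Both sums are
  geometric because \<open>d < p < d + 2\<close>.\<close>

lemma levy_integrable:
  assumes p: "real DIM('a::euclidean_space) < p" "p < real DIM('a) + 2"
  shows "integrable lborel (levy p :: 'a \<Rightarrow> real)"
proof -
  define d where "d = real DIM('a)"
  define V where "V = unit_ball_vol d"
  have V: "V \<ge> 0" by (simp add: V_def unit_ball_vol_nonneg d_def)
  define a1 a2 :: "nat \<Rightarrow> real" where "a1 n = 2 powr (- p * n)" and "a2 n = 2 powr (p * (n + 1) - 2 * n)" for n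
  define r1 r2 :: "nat \<Rightarrow> real" where "r1 n = 2 powr (n + 1)" and "r2 n = 2 powr (- n)" for n
  have vol: "emeasure lborel (cball (0::'a) (2 powr e)) = ennreal (V * 2 powr (e * d))" for e :: real
    by (simp add: emeasure_cball V_def d_def powr_power mult.commute)
  have "levy p z \<le> (\<Sum>n. ennreal (a1 n) * indicator (cball 0 (r1 n)) z) + (\<Sum>n. ennreal (a2 n) * indicator (cball 0 (r2 n)) z)"
    (is "_ \<le> ?S1 + ?S2") for z :: 'a
  proof (cases "z = 0")
    case False
    show ?thesis
    proof (cases "norm z \<ge> 1")
      case True
      obtain n :: nat where n: "2 ^ n \<le> norm z" "norm z < 2 ^ Suc n" using dyadic_above[OF True] by blast
      have "levy p z = norm z powr (- p)"
        using True by (simp add: levy_def powr_minus divide_inverse)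
      also have "\<dots> \<le> (2 ^ n) powr (- p)"
        using n p by (intro powr_mono2') auto
      also have "\<dots> = a1 n"
        by (simp add: a1_def powr_realpow[symmetric] powr_powr mult.commute)
      finally have "ennreal (levy p z) \<le> ennreal (a1 n) * indicator (cball 0 (r1 n)) z"
        using n by (simp add: r1_def ennreal_leI powr_realpow powr_add mult.commute)
      also have "\<dots> \<le> ?S1" by (rule term_le_suminf)
      finally show ?thesis by (rule order_trans) simp
    next
      case lt: False
      then have "1 \<le> 1 / norm z" using False by simp
      then obtain n :: nat where n: "2 ^ n \<le> 1 / norm z" "1 / norm z < 2 ^ Suc n" using dyadic_above by blast
      have n1: "norm z \<le> 2 powr (- n)"
        using n(1) False by (simp add: powr_minus powr_realpow field_simps)
      have n2: "2 powr (- (n + 1)) \<le> norm z"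
      proof -
        have "2 powr (- 1 - real n) = 1 / 2 ^ Suc n"
          unfolding powr_diff by (simp add: powr_realpow powr_minus field_simps)
        moreover have "1 / 2 ^ Suc n < norm z" using n(2) False by (simp add: field_simps)
        ultimately show ?thesis by simp
      qed
      have "levy p z = (norm z)\<^sup>2 * norm z powr (- p)"
        using lt by (simp add: levy_def powr_minus divide_inverse abs_square_le_1 min_absorb2)
      also have "\<dots> \<le> (2 powr (- n))\<^sup>2 * (2 powr (- (n + 1))) powr (- p)"
        using n1 n2 p by (intro mult_mono power_mono powr_mono2') auto
      also have "\<dots> = a2 n"
        by (simp add: a2_def powr_powr powr_power powr_add[symmetric] algebra_simps)
      finally have "ennreal (levy p z) \<le> ennreal (a2 n) * indicator (cball 0 (r2 n)) z"
        using n1 by (simp add: r2_def ennreal_leI)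
      also have "\<dots> \<le> ?S2" by (rule term_le_suminf)
      finally show ?thesis by (rule order_trans) simp
    qed
  qed simp
  then have "(\<integral>\<^sup>+z. levy p (z::'a) \<partial>lborel) \<le> (\<integral>\<^sup>+z. ((\<Sum>n. ennreal (a1 n) * indicator (cball 0 (r1 n)) (z::'a)) + (\<Sum>n. ennreal (a2 n) * indicator (cball 0 (r2 n)) z)) \<partial>lborel)"
    by (intro nn_integral_mono) auto
  also have "\<dots> = (\<Sum>n. ennreal (a1 n) * emeasure lborel (cball (0::'a) (r1 n))) + (\<Sum>n. ennreal (a2 n) * emeasure lborel (cball (0::'a) (r2 n)))"
  proof -
    have [measurable]: "cball (0::'a) e \<in> sets borel" for e by simp
    have m: "(\<lambda>z. \<Sum>n. ennreal (a n) * indicator (cball 0 (r n)) (z::'a)) \<in> borel_measurable lborel"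
      for a r :: "nat \<Rightarrow> real" by measurable
    have "(\<integral>\<^sup>+z. (\<Sum>n. ennreal (a n) * indicator (cball 0 (r n)) (z::'a)) \<partial>lborel)
        = (\<Sum>n. ennreal (a n) * emeasure lborel (cball (0::'a) (r n)))" for a r :: "nat \<Rightarrow> real"
      by (subst nn_integral_suminf) (measurable, simp add: nn_integral_cmult_indicator)
    then show ?thesis by (subst nn_integral_add[OF m m]) (simp only:)
  qed
  also have "\<dots> = (\<Sum>n. ennreal ((V * 2 powr d) * (2 powr (d - p)) ^ n)) + (\<Sum>n. ennreal (V * 2 powr p * (2 powr (p - 2 - d)) ^ n))"
  proof (intro arg_cong2[where f="(+)"] arg_cong[where f=suminf] ext)
    fix n
    show "ennreal (a1 n) * emeasure lborel (cball (0::'a) (r1 n)) = ennreal (V * 2 powr d * (2 powr (d - p)) ^ n)"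
      unfolding r1_def a1_def using V
      by (subst vol) (simp add: ennreal_mult'[symmetric] powr_power powr_add[symmetric] algebra_simps)
    show "ennreal (a2 n) * emeasure lborel (cball (0::'a) (r2 n)) = ennreal (V * 2 powr p * (2 powr (p - 2 - d)) ^ n)"
      unfolding r2_def a2_def using V
      by (subst vol) (simp add: ennreal_mult'[symmetric] powr_power powr_add[symmetric] algebra_simps)
  qed
  also have "\<dots> < \<infinity>"
  proof -
    have "(\<Sum>n. ennreal (c * (2 powr e) ^ n)) < \<infinity>" if "c \<ge> 0" "e < 0" for c e :: real
    proof -
      have "2 powr e < (1::real)" using that by (simp add: powr_less_one)
      then have "summable (\<lambda>n. c * (2 powr e) ^ n)" by (intro summable_mult summable_geometric) auto
      then show ?thesis using that by (subst suminf_ennreal2) auto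
    qed
    then show ?thesis using V p by (auto simp: d_def ennreal_add_less_top)
  qed
  finally show ?thesis
    by (intro integrableI_bounded) auto
qed

definition near_mass :: "real \<Rightarrow> 'a::euclidean_space itself \<Rightarrow> real \<Rightarrow> real" where
  "near_mass p _ r = (LBINT z::'a. indicator (cball 0 r) z * levy p z)"

text \<open>By dominated convergence, as the balls shrink to a point where the weight vanishes.\<close>

lemma near_mass_small:
  assumes p: "integrable lborel (levy p :: 'a::euclidean_space \<Rightarrow> real)" and "e > 0"
  obtains r where "0 < r" "r \<le> 1" "near_mass p TYPE('a) r < e"
proof -
  have "(\<lambda>n. LBINT z::'a. indicator (cball 0 (1 / Suc n)) z * levy p z) \<longlonglongrightarrow> (LBINT z::'a. 0)"
  proof (rule integral_dominated_convergence[OF _ _ p])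
    show "AE z::'a in lborel. (\<lambda>n. indicator (cball 0 (1 / Suc n)) z * levy p z) \<longlonglongrightarrow> 0"
    proof (rule AE_I2)
      fix z :: 'a
      show "(\<lambda>n. indicator (cball 0 (1 / Suc n)) z * levy p z) \<longlonglongrightarrow> 0"
      proof (cases "z = 0")
        case False
        then obtain N :: nat where N: "1 / Suc N < norm z"
          by (metis nat_approx_posE zero_less_norm_iff)
        have "\<forall>n\<ge>N. 1 / Suc n < norm z"
          by (intro allI impI le_less_trans[OF _ N]) (simp add: frac_le)
        then have "eventually (\<lambda>n. indicator (cball 0 (1 / Suc n)) z * levy p z = 0) sequentially"
          unfolding eventually_sequentially by (intro exI[of _ N]) (auto simp: indicator_def not_le)
        then show ?thesis by (rule tendsto_eventually)
      qed simp
    qed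
  qed (auto simp: indicator_def)
  then have "(\<lambda>n. near_mass p TYPE('a) (1 / Suc n)) \<longlonglongrightarrow> 0" by (simp add: near_mass_def)
  from order_tendstoD(2)[OF this \<open>e > 0\<close>] obtain n where "near_mass p TYPE('a) (1 / Suc n) < e"
    unfolding eventually_sequentially by blast
  then show ?thesis by (intro that[of "1 / Suc n"]) auto
qed

definition far_kernel :: "real \<Rightarrow> real \<Rightarrow> 'a::euclidean_space \<Rightarrow> real" where
  "far_kernel p r z = (if r \<le> norm z then 1 / norm z powr p else 0)"

lemma far_kernel_measurable [measurable]: "far_kernel p r \<in> borel_measurable borel"
  unfolding far_kernel_def by measurable

lemma far_kernel_nonneg [simp]: "0 \<le> far_kernel p r z" by (simp add: far_kernel_def)

lemma far_kernel_minus [simp]: "far_kernel p r (- z) = far_kernel p r z" by (simp add: far_kernel_def)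

lemma far_kernel_integrable:
  assumes p: "integrable lborel (levy p :: 'a::euclidean_space \<Rightarrow> real)" and "r > 0"
  shows "integrable lborel (far_kernel p r :: 'a \<Rightarrow> real)"
proof (rule Bochner_Integration.integrable_bound)
  show "integrable lborel (\<lambda>z::'a. levy p z * (1 / min 1 (r\<^sup>2)))" using p by simp
  have "far_kernel p r z \<le> levy p z * (1 / min 1 (r\<^sup>2))" for z :: 'a
  proof (cases "r \<le> norm z")
    case True
    then have "min 1 (r\<^sup>2) \<le> min 1 ((norm z)\<^sup>2)"
      using \<open>r > 0\<close> by (intro min.mono power_mono) auto
    moreover have m: "0 < min 1 (r\<^sup>2)" using \<open>r > 0\<close> by simp
    ultimately have "1 \<le> min 1 ((norm z)\<^sup>2) / min 1 (r\<^sup>2)" by (simp add: le_divide_eq)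
    then have "1 / norm z powr p \<le> (min 1 ((norm z)\<^sup>2) / min 1 (r\<^sup>2)) / norm z powr p"
      by (rule divide_right_mono) simp
    with True show ?thesis by (simp add: far_kernel_def levy_def field_simps)
  qed (simp add: far_kernel_def)
  moreover have "0 \<le> levy p z * (1 / min 1 (r\<^sup>2))" for z :: 'a by simp
  ultimately show "AE z::'a in lborel. norm (far_kernel p r z) \<le> norm (levy p z * (1 / min 1 (r\<^sup>2)))"
    by (metis (mono_tags, lifting) AE_I2 abs_of_nonneg far_kernel_nonneg real_norm_def)
qed simp

text \<open>An upper bound for the effect of the far part on \<open>\<phi> (x / k)\<close>: second differences of this
  function are at most a multiple of \<open>B\<close>, and at most a multiple of \<open>B * \<bar>z\<bar>\<^sup>2 / k\<^sup>2\<close>.\<close>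

definition second_diff_mass :: "real \<Rightarrow> 'a::euclidean_space itself \<Rightarrow> real \<Rightarrow> real \<Rightarrow> real" where
  "second_diff_mass p _ B k = (LBINT z::'a. B * (min 1 ((norm z)\<^sup>2 / k\<^sup>2)) * 2 / norm z powr p)"

lemma second_diff_mass_tendsto:
  assumes p: "integrable lborel (levy p :: 'a::euclidean_space \<Rightarrow> real)" "B \<ge> 0"
  shows "(\<lambda>n. second_diff_mass p TYPE('a) B (real (Suc n))) \<longlonglongrightarrow> 0"
    "k \<ge> 1 \<Longrightarrow> integrable lborel (\<lambda>z::'a. B * (min 1 ((norm z)\<^sup>2 / k\<^sup>2)) * 2 / norm z powr p)"
proof -
  have le: "norm (B * (min 1 ((norm z)\<^sup>2 / k\<^sup>2)) * 2 / norm z powr p) \<le> (2 * B) * levy p z" if "k \<ge> 1" for z :: 'a and k :: real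
  proof -
    have k1: "k\<^sup>2 \<ge> 1" using that by simp
    have "(norm z)\<^sup>2 / k\<^sup>2 \<le> (norm z)\<^sup>2 / 1"
      using k1 by (intro divide_left_mono) auto
    then have "min 1 ((norm z)\<^sup>2 / k\<^sup>2) \<le> min 1 ((norm z)\<^sup>2)" by auto
    then have "(2 * B / norm z powr p) * min 1 ((norm z)\<^sup>2 / k\<^sup>2) \<le> (2 * B / norm z powr p) * min 1 ((norm z)\<^sup>2)"
      using p(2) by (intro mult_left_mono) auto
    moreover have "0 \<le> B * (min 1 ((norm z)\<^sup>2 / k\<^sup>2)) * 2 / norm z powr p" using p(2) by simp
    ultimately show ?thesis unfolding real_norm_def by (subst abs_of_nonneg) (auto simp: levy_def mult_ac)
  qed
  have i: "integrable lborel (\<lambda>z::'a. (2 * B) * levy p z)" using p by simp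
  show "integrable lborel (\<lambda>z::'a. B * (min 1 ((norm z)\<^sup>2 / k\<^sup>2)) * 2 / norm z powr p)" if "k \<ge> 1"
    by (rule Bochner_Integration.integrable_bound[OF i])
       (simp, intro AE_I2 order_trans[OF le[OF that]], use p(2) in \<open>simp add: abs_mult\<close>)
  have "(\<lambda>n. LBINT z::'a. B * (min 1 ((norm z)\<^sup>2 / (real (Suc n))\<^sup>2)) * 2 / norm z powr p) \<longlonglongrightarrow> (LBINT z::'a. 0)"
  proof (rule integral_dominated_convergence[OF _ _ i])
    show "AE z::'a in lborel. (\<lambda>n. B * (min 1 ((norm z)\<^sup>2 / (real (Suc n))\<^sup>2)) * 2 / norm z powr p) \<longlonglongrightarrow> 0"
    proof (rule AE_I2)
      fix z :: 'a
      have "(\<lambda>n. (norm z * inverse (real (Suc n)))\<^sup>2) \<longlonglongrightarrow> (norm z * 0)\<^sup>2"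
        by (intro tendsto_intros LIMSEQ_inverse_real_of_nat)
      then have "(\<lambda>n. (norm z)\<^sup>2 / (real (Suc n))\<^sup>2) \<longlonglongrightarrow> 0"
        by (simp add: divide_inverse power_mult_distrib power_inverse)
      from tendsto_min[OF tendsto_const[of 1] this]
      have "(\<lambda>n. min 1 ((norm z)\<^sup>2 / (real (Suc n))\<^sup>2)) \<longlonglongrightarrow> 0" by simp
      then have "(\<lambda>n. min 1 ((norm z)\<^sup>2 / (real (Suc n))\<^sup>2) * (B * 2 / norm z powr p)) \<longlonglongrightarrow> 0 * (B * 2 / norm z powr p)"
        by (intro tendsto_mult tendsto_const)
      then show "(\<lambda>n. B * (min 1 ((norm z)\<^sup>2 / (real (Suc n))\<^sup>2)) * 2 / norm z powr p) \<longlonglongrightarrow> 0"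
        by (simp add: mult_ac)
    qed
    show "AE z::'a in lborel. norm (B * (min 1 ((norm z)\<^sup>2 / (real (Suc n))\<^sup>2)) * 2 / norm z powr p) \<le> (2 * B) * levy p z" for n
      by (intro AE_I2 le) simp
  qed auto
  then show "(\<lambda>n. second_diff_mass p TYPE('a) B (real (Suc n))) \<longlonglongrightarrow> 0" by (simp add: second_diff_mass_def)
qed

text \<open>The bound must be uniform in \<open>r\<close>, and first differences are not integrable against the kernel near 0
  if \<open>s = 1\<close>. As the kernel is even, averaging the integrals for \<open>z\<close> and \<open>- z\<close> turns first differences into
  second differences.\<close>

lemma far_diff_bound:
  fixes \<phi> :: "real^'n \<Rightarrow> real" and x :: "real^'n"
  assumes p: "integrable lborel (levy p :: real^'n \<Rightarrow> real)" and "r > 0" and "k \<ge> 1" and t: "tame B \<phi> g"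
    and [measurable]: "\<phi> \<in> borel_measurable borel"
  shows "\<bar>LBINT z. far_kernel p r z * (\<phi> ((x - z) /\<^sub>R k) - \<phi> (x /\<^sub>R k))\<bar> \<le> second_diff_mass p TYPE(real^'n) B k"
proof -
  have B: "0 \<le> B" "\<And>x. \<bar>\<phi> x\<bar> \<le> B" "\<And>x z. \<bar>\<phi> (x + z) - \<phi> x - g x \<bullet> z\<bar> \<le> B * (norm z)\<^sup>2"
    using t unfolding tame_def by auto
  define h where "h z = far_kernel p r z * (\<phi> ((x - z) /\<^sub>R k) - \<phi> (x /\<^sub>R k))" for z
  have m [measurable]: "h \<in> borel_measurable borel" unfolding h_def by measurable
  have ih: "integrable lborel h"
  proof (rule Bochner_Integration.integrable_bound)
    show "integrable lborel (\<lambda>z::real^'n. far_kernel p r z * (2 * B))"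
      using far_kernel_integrable[OF p \<open>r > 0\<close>] by simp
    show "AE z in lborel. norm (h z) \<le> norm (far_kernel p r z * (2 * B))"
    proof (rule AE_I2)
      fix z
      have "\<bar>\<phi> ((x - z) /\<^sub>R k) - \<phi> (x /\<^sub>R k)\<bar> \<le> 2 * B"
        using B(2)[of "(x - z) /\<^sub>R k"] B(2)[of "x /\<^sub>R k"] by linarith
      then show "norm (h z) \<le> norm (far_kernel p r z * (2 * B))"
        using B by (auto simp: h_def abs_mult intro!: mult_left_mono)
    qed
  qed simp
  have "(LBINT z. h z) = (LBINT z. h (0 - z))" by (rule integral_reflect[symmetric]) simp
  moreover have ih': "integrable lborel (\<lambda>z. h (0 - z))" by (rule integrable_reflect[OF ih])
  ultimately have "2 * (LBINT z. h z) = (LBINT z. h z + h (0 - z))"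
    using ih by (simp add: Bochner_Integration.integral_add)
  moreover have "\<bar>LBINT z. h z + h (0 - z)\<bar> \<le> (LBINT z::real^'n. 2 * (B * (min 1 ((norm z)\<^sup>2 / k\<^sup>2)) * 2 / norm z powr p))"
  proof (rule integral_abs_le)
    show "integrable lborel (\<lambda>z::real^'n. 2 * (B * (min 1 ((norm z)\<^sup>2 / k\<^sup>2)) * 2 / norm z powr p))"
      using second_diff_mass_tendsto(2)[OF p B(1) \<open>k \<ge> 1\<close>] by (rule integrable_mult_right)
    fix z :: "real^'n"
    define y w where "y = x /\<^sub>R k" and "w = z /\<^sub>R k"
    have w: "(norm w)\<^sup>2 = (norm z)\<^sup>2 / k\<^sup>2"
      using \<open>k \<ge> 1\<close> by (simp add: w_def power_mult_distrib divide_inverse power_inverse mult.commute)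
    have "\<bar>\<phi> (y + w) + \<phi> (y + (-w)) - 2 * \<phi> y\<bar> \<le> 4 * B * min 1 ((norm w)\<^sup>2)"
    proof -
      have "\<bar>\<phi> (y + w) + \<phi> (y + (-w)) - 2 * \<phi> y\<bar> \<le> 2 * B * (norm w)\<^sup>2"
        using B(3)[of y w] B(3)[of y "-w"] by (simp add: abs_le_iff)
      moreover have "\<bar>\<phi> (y + w) + \<phi> (y + (-w)) - 2 * \<phi> y\<bar> \<le> 4 * B"
        using B(2)[of "y + w"] B(2)[of "y + (-w)"] B(2)[of y] by linarith
      moreover have "0 \<le> B * (norm w)\<^sup>2" using B by simp
      ultimately show ?thesis by (auto simp: min_def)
    qed
    moreover have "h z + h (0 - z) = far_kernel p r z * (\<phi> (y + w) + \<phi> (y + (-w)) - 2 * \<phi> y)"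
      by (simp add: h_def y_def w_def scaleR_diff_right scaleR_add_right algebra_simps)
    moreover have "far_kernel p r z \<le> 1 / norm z powr p" by (simp add: far_kernel_def)
    ultimately have "\<bar>h z + h (0 - z)\<bar> \<le> (1 / norm z powr p) * (4 * B * min 1 ((norm w)\<^sup>2))"
      unfolding abs_mult using B by (simp only: abs_mult) (intro mult_mono, auto)
    then show "\<bar>h z + h (0 - z)\<bar> \<le> 2 * (B * (min 1 ((norm z)\<^sup>2 / k\<^sup>2)) * 2 / norm z powr p)"
      by (simp add: w)
  qed
  moreover have "(LBINT z::real^'n. 2 * (B * (min 1 ((norm z)\<^sup>2 / k\<^sup>2)) * 2 / norm z powr p))
     = 2 * second_diff_mass p TYPE(real^'n) B k"
    unfolding second_diff_mass_def by (rule integral_mult_right_zero)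
  ultimately have "\<bar>2 * (LBINT z. h z)\<bar> \<le> 2 * second_diff_mass p TYPE(real^'n) B k" by metis
  then show ?thesis unfolding h_def[symmetric] by (simp add: abs_mult)
qed

section \<open>Continuity of translations in the mean\<close>

text \<open>By approximation from indicator functions. For a set \<open>A\<close> of finite measure, pick a compact \<open>K\<close> and an open \<open>U\<close>
  with \<open>K \<subseteq> A \<subseteq> U\<close> and \<open>U - K\<close> small; translations shorter than the distance from \<open>K\<close> to the
  complement of \<open>U\<close> change the indicator of \<open>A\<close> only at \<open>x\<close> with \<open>x\<close> or \<open>x + h\<close> in \<open>U - K\<close>.\<close>

lemma L1_translation_continuous:
  fixes f :: "'a::euclidean_space \<Rightarrow> real"
  assumes "integrable lborel f" "e > 0"
  shows "\<exists>d>0. \<forall>h. norm h < d \<longrightarrow> (LBINT x. \<bar>f (x + h) - f x\<bar>) < e"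
  using assms
proof (induction arbitrary: e rule: integrable_induct)
  case (base A c)
  define e' where "e' = e / (4 * (\<bar>c\<bar> + 1))"
  have e': "e' > 0" using base by (simp add: e'_def)
  have A [measurable]: "A \<in> sets borel" using base by simp
  obtain U where U: "open U" "A \<subseteq> U" "emeasure lborel (U - A) < ennreal e'"
    using outer_regular_lborel[OF A e'] by blast
  let ?M = "density lborel (indicator A)"
  have eM: "emeasure ?M B = emeasure lborel (A \<inter> B)" if [measurable]: "B \<in> sets borel" for B
    by (simp add: emeasure_density indicator_inter_arith[symmetric])
  have "emeasure ?M A = (SUP K \<in> {K. K \<subseteq> A \<and> compact K}. emeasure ?M K)"
    by (rule inner_regular) (use base eM[of UNIV] in auto)
  moreover have "emeasure ?M A \<noteq> \<infinity>" using base eM[OF A] by simp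
  ultimately have "\<exists>K\<in>{K. K \<subseteq> A \<and> compact K}. emeasure ?M A < emeasure ?M K + ennreal e'"
    using e' by (intro SUP_approx_ennreal) auto
  then obtain K where K: "K \<subseteq> A" "compact K" "emeasure lborel A < emeasure lborel K + ennreal e'"
    by (auto simp: eM[OF A] eM[OF borel_compact] Int_absorb1)
  have [measurable]: "K \<in> sets borel" "U \<in> sets borel" using K U by (auto intro: borel_compact)
  have finK: "emeasure lborel K < \<infinity>" using K emeasure_compact_finite by blast
  have "emeasure lborel (A - K) = emeasure lborel A - emeasure lborel K"
    using K finK by (intro emeasure_Diff) auto
  also have "\<dots> < ennreal e'"
  proof -
    have "emeasure lborel K \<le> emeasure lborel A" using K(1) A by (intro emeasure_mono) auto
    then show ?thesis using K(3) finK by (subst minus_less_iff_ennreal) (auto simp: add.commute)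
  qed
  finally have AK: "emeasure lborel (A - K) < ennreal e'" .
  have "emeasure lborel (U - K) \<le> emeasure lborel ((U - A) \<union> (A - K))"
    by (intro emeasure_mono) auto
  also have "\<dots> \<le> emeasure lborel (U - A) + emeasure lborel (A - K)"
    by (intro emeasure_subadditive) auto
  also have "\<dots> < ennreal e' + ennreal e'" by (intro add_strict_mono U AK)
  also have "\<dots> = ennreal (2 * e')" using e' by (simp add: ennreal_plus[symmetric] del: ennreal_plus)
  finally have UK: "emeasure lborel (U - K) < ennreal (2 * e')" .
  have fin: "emeasure lborel (U - K) < \<infinity>" using order.strict_trans[OF UK ennreal_less_top] by simp
  have mUK: "measure lborel (U - K) < 2 * e'" using UK e' fin
    unfolding measure_def by (metis enn2real_less_iff UK fin mult_pos_pos zero_less_numeral infinity_ennreal_def)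
  obtain d where d: "d > 0" "(\<Union>x\<in>K. ball x d) \<subseteq> U"
    using compact_subset_open_imp_ball_epsilon_subset[OF K(2) U(1)] K(1) U(2) by blast
  have i: "integrable lborel (\<lambda>x. indicator (U - K) x :: real)" using fin by (intro integrable_real_indicator) auto
  show ?case
  proof (intro exI conjI allI impI)
    fix h :: 'a assume h: "norm h < d"
    have pt: "\<bar>indicator A (x + h) *\<^sub>R c - indicator A x *\<^sub>R c\<bar> \<le> \<bar>c\<bar> * (indicator (U - K) x + indicator (U - K) (x + h))" for x
    proof -
      have near: "w \<in> U" if "y \<in> K" "norm (y - w) < d" for y w :: 'a
      proof -
        have "w \<in> ball y d" using that by (simp add: dist_norm)
        with that d(2) show ?thesis by blast
      qed
      have 1: "x + h \<notin> K" if "x \<notin> U" using near[of "x + h" x] that h by auto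
      have 2: "x \<notin> K" if "x + h \<notin> U" using near[of x "x + h"] that h by auto
      have "\<bar>indicator A (x + h) - indicator A x :: real\<bar> \<le> indicator (U - K) x + indicator (U - K) (x + h)"
        using 1 2 K(1) U(2) by (auto simp: indicator_def)
      then have "\<bar>c\<bar> * \<bar>indicator A (x + h) - indicator A x :: real\<bar> \<le> \<bar>c\<bar> * (indicator (U - K) x + indicator (U - K) (x + h))"
        by (rule mult_left_mono) simp
      then show ?thesis by (simp add: abs_mult[symmetric] algebra_simps)
    qed
    have "(LBINT x. \<bar>indicator A (x + h) *\<^sub>R c - indicator A x *\<^sub>R c\<bar>)
       \<le> (LBINT x. \<bar>c\<bar> * (indicator (U - K) x + indicator (U - K) (x + h)))"
    proof (rule order_trans[OF abs_ge_self integral_abs_le])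
      show "integrable lborel (\<lambda>x. \<bar>c\<bar> * (indicator (U - K) x + indicator (U - K) (x + h)))"
        using i integrable_translate[OF i, of h] by (intro integrable_mult_right Bochner_Integration.integrable_add)
    qed (simp only: abs_idempotent pt)
    also have "\<dots> = \<bar>c\<bar> * (measure lborel (U - K) + measure lborel (U - K))"
      using i integrable_translate[OF i, of h] integral_translate[of "indicator (U - K) :: _ \<Rightarrow> real" h] by simp
    also have "\<dots> \<le> \<bar>c\<bar> * (4 * e')" using mUK by (intro mult_left_mono) auto
    also have "\<dots> < e" using base(3) by (simp add: e'_def field_simps)
    finally show "(LBINT x. \<bar>indicator A (x + h) *\<^sub>R c - indicator A x *\<^sub>R c\<bar>) < e" .
  qed fact
next
  case (add f g)
  obtain d1 where d1: "d1 > 0" "\<And>h. norm h < d1 \<Longrightarrow> (LBINT x. \<bar>f (x + h) - f x\<bar>) < e / 2"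
    using add(3)[of "e/2"] add(5) by auto
  obtain d2 where d2: "d2 > 0" "\<And>h. norm h < d2 \<Longrightarrow> (LBINT x. \<bar>g (x + h) - g x\<bar>) < e / 2"
    using add(4)[of "e/2"] add(5) by auto
  show ?case
  proof (intro exI[of _ "min d1 d2"] conjI allI impI)
    fix h :: 'a assume h: "norm h < min d1 d2"
    have i: "integrable lborel (\<lambda>x. \<bar>f (x + h) - f x\<bar>)" "integrable lborel (\<lambda>x. \<bar>g (x + h) - g x\<bar>)"
      using add(1,2) integrable_translate[OF add(1), of h] integrable_translate[OF add(2), of h]
      by (auto intro!: integrable_abs Bochner_Integration.integrable_diff)
    have "(LBINT x. \<bar>f (x + h) + g (x + h) - (f x + g x)\<bar>) \<le> (LBINT x. \<bar>f (x + h) - f x\<bar> + \<bar>g (x + h) - g x\<bar>)"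
    proof (rule integral_mono)
      show "integrable lborel (\<lambda>x. \<bar>f (x + h) + g (x + h) - (f x + g x)\<bar>)"
        using add(1,2) integrable_translate[OF add(1), of h] integrable_translate[OF add(2), of h]
        by (intro integrable_abs Bochner_Integration.integrable_diff Bochner_Integration.integrable_add)
    qed (use i in auto)
    also have "\<dots> < e" using d1(2)[of h] d2(2)[of h] h i by simp
    finally show "(LBINT x. \<bar>f (x + h) + g (x + h) - (f x + g x)\<bar>) < e" .
  qed (use d1 d2 in auto)
next
  case (lim f s)
  have "(\<lambda>i. LBINT x. \<bar>s i x - f x\<bar>) \<longlonglongrightarrow> (LBINT x::'a. 0)"
  proof (rule integral_dominated_convergence[where w="\<lambda>x. 3 * \<bar>f x\<bar>"])
    show "AE x in lborel. (\<lambda>i. \<bar>s i x - f x\<bar>) \<longlonglongrightarrow> 0"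
      using lim(2) by (auto intro!: AE_I2 tendsto_rabs_zero LIM_zero)
    show "AE x in lborel. norm \<bar>s i x - f x\<bar> \<le> 3 * \<bar>f x\<bar>" for i
    proof (rule AE_I2)
      fix x
      show "norm \<bar>s i x - f x\<bar> \<le> 3 * \<bar>f x\<bar>" using lim(3)[of x i] by simp
    qed
  qed (use lim in auto)
  then have "(\<lambda>i. LBINT x. \<bar>s i x - f x\<bar>) \<longlonglongrightarrow> 0" by simp
  from order_tendstoD(2)[OF this, of "e/3"] lim(6)
  obtain n where n: "(LBINT x. \<bar>s n x - f x\<bar>) < e / 3"
    by (auto simp: eventually_sequentially)
  obtain d where d: "d > 0" "\<And>h. norm h < d \<Longrightarrow> (LBINT x. \<bar>s n (x + h) - s n x\<bar>) < e / 3"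
    using lim(5)[of "e/3" n] lim(6) by auto
  show ?case
  proof (intro exI[of _ d] conjI allI impI)
    fix h :: 'a assume h: "norm h < d"
    have i: "integrable lborel (\<lambda>x. \<bar>s n x - f x\<bar>)" "integrable lborel (\<lambda>x. \<bar>s n (x + h) - f (x + h)\<bar>)"
      "integrable lborel (\<lambda>x. \<bar>s n (x + h) - s n x\<bar>)" "integrable lborel (\<lambda>x. \<bar>f (x + h) - f x\<bar>)"
      using lim(1)[of n] lim(4) integrable_translate[OF lim(1), of n h] integrable_translate[OF lim(4), of h]
      by (auto intro!: integrable_abs Bochner_Integration.integrable_diff)
    have t: "(LBINT x. \<bar>s n (x + h) - f (x + h)\<bar>) = (LBINT x. \<bar>s n x - f x\<bar>)"
      using lim(1)[of n] lim(4) by (intro integral_translate[of "\<lambda>x. \<bar>s n x - f x\<bar>"]) auto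
    have "(LBINT x. \<bar>f (x + h) - f x\<bar>) \<le> (LBINT x. \<bar>s n (x + h) - f (x + h)\<bar> + (\<bar>s n (x + h) - s n x\<bar> + \<bar>s n x - f x\<bar>))"
      using i by (intro integral_mono) auto
    also have "\<dots> = (LBINT x. \<bar>s n x - f x\<bar>) + ((LBINT x. \<bar>s n (x + h) - s n x\<bar>) + (LBINT x. \<bar>s n x - f x\<bar>))"
      using i t by simp
    also have "\<dots> < e" using n d(2)[OF h] by simp
    finally show "(LBINT x. \<bar>f (x + h) - f x\<bar>) < e" .
  qed fact
qed

section \<open>The Kruzhkov inequalities\<close>

text \<open>Fubini's theorem and measurability in two variables require Borel functions: if \<open>u\<close> is only Lebesgue
  measurable, then \<open>(x, z) \<mapsto> u (x + z)\<close> need not be measurable for the product sigma-algebra.\<close>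

lemma lebesgue_integral_eq_lborel:
  fixes X Y :: "'a::euclidean_space \<Rightarrow> 'b::euclidean_space"
  assumes Y: "Y \<in> borel_measurable borel" and ae: "AE x in lebesgue. X x = Y x"
  shows "(LINT x|lebesgue. X x) = (LBINT x. Y x)"
proof -
  have Y': "Y \<in> borel_measurable lebesgue" using Y by (simp add: measurable_completion)
  have "AE x in lebesgue. Y x = X x" using ae by eventually_elim simp
  with Y' have "X \<in> borel_measurable lebesgue" by (rule borel_measurable_AE)
  then have "(LINT x|lebesgue. X x) = (LINT x|lebesgue. Y x)"
    using Y' ae by (rule integral_cong_AE)
  also have "\<dots> = (LBINT x. Y x)" using Y by (simp add: integral_completion)
  finally show ?thesis .
qed

lemma AE_lebesgue_translate:
  fixes x :: "'a::euclidean_space"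
  assumes "AE y in lebesgue. P y"
  shows "AE z in lebesgue. P (x + z)"
proof -
  have "negligible {y. \<not> P y}"
    using assms by (auto simp: completion.AE_iff_null_sets negligible_iff_null_sets)
  then have "negligible ((+) (- x) ` {y. \<not> P y})" by (rule negligible_translation)
  moreover have "(+) (- x) ` {y. \<not> P y} = {z. \<not> P (x + z)}"
    by (force simp: image_iff intro: bexI[of _ "x + z" for z])
  ultimately show ?thesis
    by (auto simp: completion.AE_iff_null_sets negligible_iff_null_sets)
qed

text \<open>The two parts of the nonlocal operator, for \<open>p = N + s\<close> and without its constant. The far part acts on the solution,
  the near part, in which a first order term is subtracted, on test functions.\<close>

definition far_operator :: "real \<Rightarrow> real \<Rightarrow> ('a::euclidean_space \<Rightarrow> real) \<Rightarrow> 'a \<Rightarrow> real" where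
  "far_operator p r u x = (LBINT z. far_kernel p r z * (u (x + z) - u x))"

definition near_operator :: "real \<Rightarrow> real \<Rightarrow> (real^'n \<Rightarrow> real) \<Rightarrow> real^'n \<Rightarrow> real" where
  "near_operator p r \<phi> x = (LBINT z. indicator (cball 0 r) z * ((\<phi> (x + z) - \<phi> x - grad \<phi> x \<bullet> z) / norm z powr p))"

lemma far_operator_measurable [measurable]:
  assumes [measurable]: "u \<in> borel_measurable borel"
  shows "far_operator p r u \<in> borel_measurable borel"
  unfolding far_operator_def[abs_def] by measurable

lemma far_operator_integrable:
  fixes u :: "'a::euclidean_space \<Rightarrow> real"
  assumes p: "integrable lborel (levy p :: 'a \<Rightarrow> real)" and "r > 0"
    and [measurable]: "u \<in> borel_measurable borel" and u: "\<And>x. \<bar>u x\<bar> \<le> M"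
  shows "integrable lborel (\<lambda>z. far_kernel p r z * (u (x + z) - u x))"
proof (rule Bochner_Integration.integrable_bound)
  show "integrable lborel (\<lambda>z::'a. far_kernel p r z * (2 * M))" using far_kernel_integrable[OF p \<open>r > 0\<close>] by simp
  have M: "0 \<le> M" using u[of x] by linarith
  have "\<bar>u (x + z) - u x\<bar> \<le> 2 * M" for z using u[of "x + z"] u[of x] by linarith
  then show "AE z in lborel. norm (far_kernel p r z * (u (x + z) - u x)) \<le> norm (far_kernel p r z * (2 * M))"
    using M by (intro AE_I2) (auto simp: abs_mult intro!: mult_left_mono)
qed measurable

lemma far_operator_bound:
  fixes u :: "'a::euclidean_space \<Rightarrow> real"
  assumes p: "integrable lborel (levy p :: 'a \<Rightarrow> real)" and "r > 0" and u: "\<And>x. \<bar>u x\<bar> \<le> M"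
  shows "\<bar>far_operator p r u x\<bar> \<le> (LBINT z::'a. far_kernel p r z * (2 * M))"
  unfolding far_operator_def
proof (rule integral_abs_le)
  show "integrable lborel (\<lambda>z::'a. far_kernel p r z * (2 * M))" using far_kernel_integrable[OF p \<open>r > 0\<close>] by simp
  fix z
  have "\<bar>u (x + z) - u x\<bar> \<le> 2 * M" using u[of "x + z"] u[of x] by linarith
  then show "\<bar>far_kernel p r z * (u (x + z) - u x)\<bar> \<le> far_kernel p r z * (2 * M)" by (auto simp: abs_mult intro!: mult_left_mono)
qed

lemma grad_measurable: "test_function \<phi> \<Longrightarrow> grad \<phi> \<in> borel_measurable borel"
  by (rule borel_measurable_continuous_onI[OF grad_continuous])

lemma test_function_measurable: "test_function \<phi> \<Longrightarrow> \<phi> \<in> borel_measurable borel"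
  by (rule borel_measurable_continuous_onI[OF test_function_continuous])

lemma near_operator_measurable:
  assumes "test_function \<phi>"
  shows "near_operator p r \<phi> \<in> borel_measurable borel"
proof -
  note [measurable] = grad_measurable[OF assms] test_function_measurable[OF assms]
  have [measurable]: "cball 0 r \<in> sets borel" by simp
  show ?thesis unfolding near_operator_def[abs_def] by measurable
qed

text \<open>For \<open>x\<close> outside of \<open>cball c (R + 1)\<close> the function vanishes near \<open>x\<close> and at all \<open>x + z\<close> with \<open>norm z \<le> r\<close>, since \<open>r \<le> 1\<close>.\<close>

lemma near_operator_bound:
  fixes \<phi> :: "real^'n \<Rightarrow> real"
  assumes p: "integrable lborel (levy p :: real^'n \<Rightarrow> real)" and r: "0 < r" "r \<le> 1"
    and t: "tame B \<phi> (grad \<phi>)" and \<phi>: "test_function \<phi>" "\<And>x. norm (x - c) > R \<Longrightarrow> \<phi> x = 0"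
  shows "\<bar>near_operator p r \<phi> x\<bar> \<le> B * near_mass p TYPE(real^'n) r * indicator (cball c (R + 1)) x"
proof -
  have i: "integrable lborel (\<lambda>z::real^'n. B * (indicator (cball 0 r) z * levy p z))"
    using p by (intro integrable_mult_right integrable_real_mult_indicator[where f="levy p", simplified mult.commute]) auto
  have "\<bar>near_operator p r \<phi> x\<bar> \<le> (LBINT z. B * (indicator (cball 0 r) z * levy p (z::real^'n)))"
    unfolding near_operator_def
  proof (rule integral_abs_le[OF i])
    fix z :: "real^'n"
    show "\<bar>indicator (cball 0 r) z * ((\<phi> (x + z) - \<phi> x - grad \<phi> x \<bullet> z) / norm z powr p)\<bar> \<le> B * (indicator (cball 0 r) z * levy p z)"
    proof (cases "norm z \<le> r")
      case True
      then have "(norm z)\<^sup>2 \<le> 1" using r by (simp add: abs_square_le_1)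
      then have "levy p z = (norm z)\<^sup>2 / norm z powr p" by (simp add: levy_def min_absorb2)
      moreover have "\<bar>\<phi> (x + z) - \<phi> x - grad \<phi> x \<bullet> z\<bar> / norm z powr p \<le> B * (norm z)\<^sup>2 / norm z powr p"
        using t unfolding tame_def by (intro divide_right_mono) auto
      ultimately show ?thesis using True by (simp add: abs_mult)
    qed (simp add: indicator_def)
  qed
  also have "\<dots> = B * near_mass p TYPE(real^'n) r" unfolding near_mass_def by simp
  finally have b: "\<bar>near_operator p r \<phi> x\<bar> \<le> B * near_mass p TYPE(real^'n) r" .
  show ?thesis
  proof (cases "x \<in> cball c (R + 1)")
    case False
    then have x: "norm (x - c) > R + 1" by (simp add: dist_norm norm_minus_commute)
    have g: "grad \<phi> x = 0"
    proof (rule grad_eq)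
      have "open {x. norm (x - c) > R}" by (intro open_Collect_less continuous_intros)
      then show "(\<phi> has_derivative (\<lambda>z. 0 \<bullet> z)) (at x)"
        by (rule has_derivative_transform_within_open[of "\<lambda>x. 0", rotated]) (use x r \<phi>(2) in auto)
    qed
    have "near_operator p r \<phi> x = (LBINT z::real^'n. 0)"
      unfolding near_operator_def
    proof (rule Bochner_Integration.integral_cong[OF refl])
      fix z :: "real^'n"
      show "indicator (cball 0 r) z * ((\<phi> (x + z) - \<phi> x - grad \<phi> x \<bullet> z) / norm z powr p) = 0"
      proof (cases "norm z \<le> r")
        case True
        have "norm (x - c) \<le> norm (x + z - c) + norm z"
          using norm_triangle_ineq4[of "x + z - c" z] by (simp add: algebra_simps)
        then have "norm (x + z - c) > R" using True x r by linarith
        then have "\<phi> (x + z) = 0" "\<phi> x = 0" using \<phi>(2) x by auto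
        then show ?thesis using g by simp
      qed (simp add: indicator_def)
    qed
    then show ?thesis using False by simp
  qed (use b in simp)
qed

lemma near_mass_nonneg: "0 \<le> near_mass p TYPE('a::euclidean_space) r"
  unfolding near_mass_def by (intro integral_nonneg_AE) auto

lemma near_operator_integrable:
  fixes \<phi> :: "real^'n \<Rightarrow> real"
  assumes p: "integrable lborel (levy p :: real^'n \<Rightarrow> real)" and r: "0 < r" "r \<le> 1" and \<phi>: "test_function \<phi>"
  shows "integrable lborel (near_operator p r \<phi>)"
proof -
  obtain B where B: "tame B \<phi> (grad \<phi>)" using tame_test_function[OF \<phi>] by blast
  obtain R where R: "R > 0" "\<And>x. norm x > R \<Longrightarrow> \<phi> x = 0" using test_function_support[OF \<phi>] by blast
  have le: "\<bar>near_operator p r \<phi> x\<bar> \<le> B * near_mass p TYPE(real^'n) r * indicator (cball 0 (R + 1)) x" for x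
    using R by (intro near_operator_bound[OF p r B \<phi>]) auto
  show ?thesis
  proof (rule Bochner_Integration.integrable_bound)
    show "integrable lborel (\<lambda>x::real^'n. B * near_mass p TYPE(real^'n) r * indicator (cball 0 (R + 1)) x)"
      using emeasure_lborel_cball_finite[of 0 "R + 1"] by (intro integrable_mult_right integrable_real_indicator) auto
    show "AE x in lborel. norm (near_operator p r \<phi> x) \<le> norm (B * near_mass p TYPE(real^'n) r * indicator (cball 0 (R + 1)) x)"
      by (intro AE_I2) (simp add: order_trans[OF le abs_ge_self])
  qed (use near_operator_measurable[OF \<phi>] in simp)
qed

lemma entropy_inequality_borel:
  fixes u v f g :: "real^'n \<Rightarrow> real"
  assumes sol: "entropy_solution b F s f u"
    and uv: "AE x in lebesgue. u x = v x" and fg: "AE x in lebesgue. f x = g x"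
    and [measurable]: "v \<in> borel_measurable borel" "g \<in> borel_measurable borel" "b \<in> borel_measurable borel"
    and v: "\<And>x. \<bar>v x\<bar> \<le> M"
    and r: "0 < r" and \<phi>: "test_function \<phi>" "\<And>x. 0 \<le> \<phi> x"
    and \<eta>: "convex_on UNIV \<eta>" "C2_real \<eta>" and \<Phi>: "entropy_flux F \<eta> \<Phi>"
  defines "p \<equiv> real CARD('n) + s"
  shows "0 \<le> (LBINT x. (g x - b (v x)) * deriv \<eta> (v x) * \<phi> x + \<Phi> (v x) \<bullet> grad \<phi> x)
     + C_const CARD('n) s * (LBINT x. deriv \<eta> (v x) * \<phi> x * far_operator p r v x)
     + C_const CARD('n) s * (LBINT x. \<eta> (v x) * near_operator p r \<phi> x)"
proof -
  obtain \<eta>' \<eta>'' where d: "\<And>r. (\<eta> has_real_derivative \<eta>' r) (at r)" "\<And>r. (\<eta>' has_real_derivative \<eta>'' r) (at r)"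
    using \<eta>(2) unfolding C2_real_def by blast
  have deta: "deriv \<eta> = \<eta>'" using d(1) by (auto intro: DERIV_imp_deriv)
  have "continuous_on UNIV \<eta>" "continuous_on UNIV \<eta>'"
    using d by (auto intro!: continuous_at_imp_continuous_on intro: DERIV_isCont)
  then have [measurable]: "\<eta> \<in> borel_measurable borel" "deriv \<eta> \<in> borel_measurable borel"
    unfolding deta by (auto intro: borel_measurable_continuous_onI)
  have "continuous_on UNIV \<Phi>"
    using \<Phi> unfolding entropy_flux_def locally_lipschitz_def by (auto intro: local_lipschitz_continuous_on)
  then have [measurable]: "\<Phi> \<in> borel_measurable borel" by (rule borel_measurable_continuous_onI)
  note [measurable] = grad_measurable[OF \<phi>(1)] test_function_measurable[OF \<phi>(1)] near_operator_measurable[OF \<phi>(1)]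
  have 1: "(LINT x|lebesgue. (f x - b (u x)) * deriv \<eta> (u x) * \<phi> x + \<Phi> (u x) \<bullet> grad \<phi> x)
    = (LBINT x. (g x - b (v x)) * deriv \<eta> (v x) * \<phi> x + \<Phi> (v x) \<bullet> grad \<phi> x)"
    by (rule lebesgue_integral_eq_lborel, measurable) (use uv fg in eventually_elim, simp)
  have 2: "(LINT x|lebesgue. (LINT z:{z. r \<le> norm z}|lebesgue. deriv \<eta> (u x) * ((u (x + z) - u x) / norm z powr p) * \<phi> x))
    = (LBINT x. deriv \<eta> (v x) * \<phi> x * far_operator p r v x)"
  proof (rule lebesgue_integral_eq_lborel, measurable)
    show "AE x in lebesgue. (LINT z:{z. r \<le> norm z}|lebesgue. deriv \<eta> (u x) * ((u (x + z) - u x) / norm z powr p) * \<phi> x)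
       = deriv \<eta> (v x) * \<phi> x * far_operator p r v x"
      using uv
    proof eventually_elim
      case (elim x)
      have "(LINT z:{z. r \<le> norm z}|lebesgue. deriv \<eta> (u x) * ((u (x + z) - u x) / norm z powr p) * \<phi> x)
        = (LBINT z. (deriv \<eta> (v x) * \<phi> x) * (far_kernel p r z * (v (x + z) - v x)))"
        unfolding set_lebesgue_integral_def
      proof (rule lebesgue_integral_eq_lborel, measurable)
        show "AE z in lebesgue. indicat_real {z. r \<le> norm z} z *\<^sub>R (deriv \<eta> (u x) * ((u (x + z) - u x) / norm z powr p) * \<phi> x)
          = (deriv \<eta> (v x) * \<phi> x) * (far_kernel p r z * (v (x + z) - v x))"
          using AE_lebesgue_translate[OF uv, of x]
          by eventually_elim (simp add: elim far_kernel_def indicator_def)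
      qed
      also have "\<dots> = deriv \<eta> (v x) * \<phi> x * far_operator p r v x" unfolding far_operator_def by (rule integral_mult_right_zero)
      finally show ?case .
    qed
  qed
  have 3: "(LINT x|lebesgue. (LINT z:{z. norm z \<le> r}|lebesgue. \<eta> (u x) * ((\<phi> (x + z) - \<phi> x - grad \<phi> x \<bullet> z) / norm z powr p)))
    = (LBINT x. \<eta> (v x) * near_operator p r \<phi> x)"
  proof (rule lebesgue_integral_eq_lborel, measurable)
    show "AE x in lebesgue. (LINT z:{z. norm z \<le> r}|lebesgue. \<eta> (u x) * ((\<phi> (x + z) - \<phi> x - grad \<phi> x \<bullet> z) / norm z powr p))
      = \<eta> (v x) * near_operator p r \<phi> x"
      using uv
    proof eventually_elim
      case (elim x)
      have "(LINT z:{z. norm z \<le> r}|lebesgue. \<eta> (u x) * ((\<phi> (x + z) - \<phi> x - grad \<phi> x \<bullet> z) / norm z powr p))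
        = (LBINT z. \<eta> (v x) * (indicator (cball 0 r) z * ((\<phi> (x + z) - \<phi> x - grad \<phi> x \<bullet> z) / norm z powr p)))"
        unfolding set_lebesgue_integral_def
      proof (rule lebesgue_integral_eq_lborel)
        have [measurable]: "cball (0::real^'n) r \<in> sets borel" by simp
        show "(\<lambda>z. \<eta> (v x) * (indicator (cball 0 r) z * ((\<phi> (x + z) - \<phi> x - grad \<phi> x \<bullet> z) / norm z powr p))) \<in> borel_measurable borel"
          by measurable
      qed (simp add: elim indicator_def)
      also have "\<dots> = \<eta> (v x) * near_operator p r \<phi> x" unfolding near_operator_def by (rule integral_mult_right_zero)
      finally show ?case .
    qed
  qed
  show ?thesis
    unfolding 1[symmetric] 2[symmetric] 3[symmetric] unfolding p_def
    using sol r \<phi> \<eta> \<Phi> unfolding entropy_solution_def by blast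
qed

text \<open>The entropy inequality for \<open>(v - k)\<^sup>+\<close> if \<open>\<sigma> = 1\<close> and for \<open>(k - v)\<^sup>+\<close> if \<open>\<sigma> = -1\<close>, that is, the notions of entropy
  subsolution and supersolution. Both fluxes are normalized to vanish at \<open>k\<close>, so that they agree when the
  roles of \<open>v\<close> and \<open>k\<close> are exchanged together with the sign.\<close>

definition kruzhkov_inequality ::
  "real \<Rightarrow> real \<Rightarrow> (real \<Rightarrow> real) \<Rightarrow> (real \<Rightarrow> real^'n) \<Rightarrow> real \<Rightarrow> (real^'n \<Rightarrow> real) \<Rightarrow> (real^'n \<Rightarrow> real) \<Rightarrow> bool" where
  "kruzhkov_inequality p C b F \<sigma> g v \<longleftrightarrow> (\<forall>r \<phi> k. 0 < r \<longrightarrow> r \<le> 1 \<longrightarrow> test_function \<phi> \<longrightarrow> (\<forall>x. 0 \<le> \<phi> x) \<longrightarrow>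
     0 \<le> (LBINT x. (g x - b (v x)) * (\<sigma> * heaviside (\<sigma> * (v x - k))) * \<phi> x
             + ((\<sigma> * heaviside (\<sigma> * (v x - k))) *\<^sub>R (F (v x) - F k)) \<bullet> grad \<phi> x)
       + C * (LBINT x. (\<sigma> * heaviside (\<sigma> * (v x - k))) * \<phi> x * far_operator p r v x)
       + C * (LBINT x. max (\<sigma> * (v x - k)) 0 * near_operator p r \<phi> x))"

text \<open>Dominated convergence in each of the three integrals along the smooth entropies of index \<open>m n = n + 1\<close>.
  The values of the fluxes stay bounded since \<open>v\<close> is.\<close>

lemma entropy_solution_kruzhkov:
  fixes u v f g :: "real^'n \<Rightarrow> real"
  assumes sol: "entropy_solution b F s f u" and F: "locally_lipschitz F"
    and uv: "AE x in lebesgue. u x = v x" and fg: "AE x in lebesgue. f x = g x"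
    and [measurable]: "v \<in> borel_measurable borel" "g \<in> borel_measurable borel" "b \<in> borel_measurable borel"
    and v: "\<And>x. \<bar>v x\<bar> \<le> M" and gb: "\<And>x. \<bar>g x - b (v x)\<bar> \<le> A"
    and p: "integrable lborel (levy (real CARD('n) + s) :: real^'n \<Rightarrow> real)"
    and \<sigma>: "\<sigma> = 1 \<or> \<sigma> = -1"
  shows "kruzhkov_inequality (real CARD('n) + s) (C_const CARD('n) s) b F \<sigma> g v"
  unfolding kruzhkov_inequality_def
proof (intro allI impI)
  fix r k :: real and \<phi> :: "real^'n \<Rightarrow> real"
  assume r: "0 < r" "r \<le> 1" and \<phi>0: "test_function \<phi>" "\<forall>x. 0 \<le> \<phi> x"
  from \<phi>0 have \<phi>: "test_function \<phi>" "\<And>x. 0 \<le> \<phi> x" by auto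
  define p where "p = real CARD('n) + s"
  note p = p[folded p_def]
  note [measurable] = grad_measurable[OF \<phi>(1)] test_function_measurable[OF \<phi>(1)] near_operator_measurable[OF \<phi>(1)]
  define m where "m n = real (Suc n)" for n
  have m: "m n > 0" for n by (simp add: m_def)
  have "\<exists>\<Phi>. entropy_flux F (smooth_entropy (m n) \<sigma> k) \<Phi> \<and> (\<forall>M L r. L-lipschitz_on {-M..M} F \<longrightarrow> \<bar>k\<bar> \<le> M \<longrightarrow> \<bar>r\<bar> \<le> M \<longrightarrow>
       norm (\<Phi> r - (\<sigma> * ramp' (m n * (\<sigma> * (r - k)))) *\<^sub>R (F r - F k)) \<le> L * gap (m n) (\<sigma> * (r - k)))" for n
    using entropy_flux_exists[OF F m \<sigma>, of n k] by metis
  then obtain \<Phi> where \<Phi>: "\<And>n. entropy_flux F (smooth_entropy (m n) \<sigma> k) (\<Phi> n)"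
    and \<Phi>': "\<And>n M L r. L-lipschitz_on {-M..M} F \<Longrightarrow> \<bar>k\<bar> \<le> M \<Longrightarrow> \<bar>r\<bar> \<le> M \<Longrightarrow>
       norm (\<Phi> n r - (\<sigma> * ramp' (m n * (\<sigma> * (r - k)))) *\<^sub>R (F r - F k)) \<le> L * gap (m n) (\<sigma> * (r - k))"
    by metis
  define M' where "M' = max M \<bar>k\<bar>"
  have M': "\<bar>k\<bar> \<le> M'" "\<And>x. \<bar>v x\<bar> \<le> M'" using v by (auto simp: M'_def intro: order_trans[OF v])
  obtain L where L: "L-lipschitz_on {-M'..M'} F" using locally_lipschitz_on_Icc[OF F] by blast
  have L0: "0 \<le> L" by (rule lipschitz_on_nonneg[OF L])
  have vk: "\<bar>v x - k\<bar> \<le> 2 * M'" for x using M'(1) M'(2)[of x] by linarith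
  have \<sigma>1: "\<bar>\<sigma> * t\<bar> = \<bar>t\<bar>" for t using \<sigma> by auto
  have FFk: "norm (F (v x) - F k) \<le> L * (2 * M')" for x
  proof -
    have "v x \<in> {-M'..M'}" "k \<in> {-M'..M'}" using M'(1) M'(2)[of x] by (auto simp: abs_le_iff)
    from lipschitz_onD[OF L this] have "norm (F (v x) - F k) \<le> L * \<bar>v x - k\<bar>" by (simp add: dist_norm)
    also have "\<dots> \<le> L * (2 * M')" by (rule mult_left_mono[OF vk L0])
    finally show ?thesis .
  qed
  have contF: "continuous_on UNIV F"
    using F unfolding locally_lipschitz_def by (rule local_lipschitz_continuous_on) auto
  have [measurable]: "F \<in> borel_measurable borel" by (rule borel_measurable_continuous_onI[OF contF])
  have [measurable]: "\<Phi> n \<in> borel_measurable borel" for n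
    using \<Phi>[of n] unfolding entropy_flux_def locally_lipschitz_def
    by (intro borel_measurable_continuous_onI) (auto intro: local_lipschitz_continuous_on)
  have [measurable]: "ramp \<in> borel_measurable borel" "ramp' \<in> borel_measurable borel"
    using ramp_deriv ramp'_deriv
    by (auto intro!: borel_measurable_continuous_onI continuous_at_imp_continuous_on intro: DERIV_isCont)
  define e where "e n x = \<sigma> * ramp' (m n * (\<sigma> * (v x - k)))" for n x
  define h where "h x = \<sigma> * heaviside (\<sigma> * (v x - k))" for x
  have [measurable]: "e n \<in> borel_measurable borel" for n unfolding e_def[abs_def] by measurable
  have [measurable]: "h \<in> borel_measurable borel" unfolding h_def[abs_def] by measurable
  have e1: "\<bar>e n x\<bar> \<le> 1" for n x unfolding e_def \<sigma>1 using ramp'_bounds by simp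
  have e: "(\<lambda>n. e n x) \<longlonglongrightarrow> h x" for x
    unfolding e_def h_def m_def by (intro tendsto_mult tendsto_const ramp'_tendsto)
  have \<Phi>lim: "(\<lambda>n. \<Phi> n (v x)) \<longlonglongrightarrow> h x *\<^sub>R (F (v x) - F k)" for x
  proof -
    have "(\<lambda>n. \<Phi> n (v x) - e n x *\<^sub>R (F (v x) - F k)) \<longlonglongrightarrow> 0"
    proof (rule Lim_null_comparison)
      show "\<forall>\<^sub>F n in sequentially. norm (\<Phi> n (v x) - e n x *\<^sub>R (F (v x) - F k)) \<le> L * gap (m n) (\<sigma> * (v x - k))"
        unfolding e_def using \<Phi>'[OF L M'] by simp
      show "(\<lambda>n. L * gap (m n) (\<sigma> * (v x - k))) \<longlonglongrightarrow> 0"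
        unfolding m_def by (rule tendsto_mult_right_zero[OF gap_tendsto])
    qed
    from tendsto_add[OF this tendsto_scaleR[OF e[of x] tendsto_const[of "F (v x) - F k"]]]
    show ?thesis by simp
  qed
  have \<Phi>b: "norm (\<Phi> n (v x)) \<le> L * (2 * M') + L * (2 * M')" for n x
  proof -
    have "norm (\<Phi> n (v x)) \<le> norm (\<Phi> n (v x) - e n x *\<^sub>R (F (v x) - F k)) + norm (e n x *\<^sub>R (F (v x) - F k))"
      using norm_triangle_ineq[of "\<Phi> n (v x) - e n x *\<^sub>R (F (v x) - F k)" "e n x *\<^sub>R (F (v x) - F k)"] by simp
    moreover have "norm (\<Phi> n (v x) - e n x *\<^sub>R (F (v x) - F k)) \<le> L * (2 * M')"
    proof -
      have "gap (m n) (\<sigma> * (v x - k)) \<le> 2 * M'"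
        using gap_bounds[OF m, of n "\<sigma> * (v x - k)"] vk[of x] unfolding \<sigma>1 by linarith
      from mult_left_mono[OF this L0] show ?thesis using \<Phi>'[OF L M'(1) M'(2)[of x], of n] unfolding e_def by linarith
    qed
    moreover have "norm (e n x *\<^sub>R (F (v x) - F k)) \<le> 1 * (L * (2 * M'))"
      unfolding norm_scaleR using e1[of n x] FFk[of x] by (intro mult_mono) auto
    ultimately show ?thesis by simp
  qed
  define X1 where "X1 n = (LBINT x. (g x - b (v x)) * e n x * \<phi> x + \<Phi> n (v x) \<bullet> grad \<phi> x)" for n
  define X2 where "X2 n = (LBINT x. e n x * \<phi> x * far_operator p r v x)" for n
  define X3 where "X3 n = (LBINT x. smooth_entropy (m n) \<sigma> k (v x) * near_operator p r \<phi> x)" for n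
  have pos: "0 \<le> X1 n + C_const CARD('n) s * X2 n + C_const CARD('n) s * X3 n" for n
    using entropy_inequality_borel[OF sol uv fg _ _ _ v r(1) \<phi> smooth_entropy_convex[OF m[of n]] smooth_entropy_C2[OF m[of n]] \<Phi>[of n]]
    by (simp add: X1_def X2_def X3_def e_def deriv_smooth_entropy[OF m] p_def)
  have "X1 \<longlonglongrightarrow> (LBINT x. (g x - b (v x)) * h x * \<phi> x + (h x *\<^sub>R (F (v x) - F k)) \<bullet> grad \<phi> x)"
    unfolding X1_def
  proof (rule integral_dominated_convergence[where w="\<lambda>x. A * \<phi> x + (L * (2 * M') + L * (2 * M')) * norm (grad \<phi> x)"])
    show "integrable lborel (\<lambda>x. A * \<phi> x + (L * (2 * M') + L * (2 * M')) * norm (grad \<phi> x))"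
      using test_function_integrable[OF \<phi>(1)] grad_integrable[OF \<phi>(1)]
      by (intro Bochner_Integration.integrable_add integrable_mult_right integrable_norm)
    show "AE x in lborel. (\<lambda>n. (g x - b (v x)) * e n x * \<phi> x + \<Phi> n (v x) \<bullet> grad \<phi> x)
        \<longlonglongrightarrow> (g x - b (v x)) * h x * \<phi> x + (h x *\<^sub>R (F (v x) - F k)) \<bullet> grad \<phi> x"
      by (intro AE_I2 tendsto_intros e \<Phi>lim)
    show "AE x in lborel. norm ((g x - b (v x)) * e n x * \<phi> x + \<Phi> n (v x) \<bullet> grad \<phi> x)
        \<le> A * \<phi> x + (L * (2 * M') + L * (2 * M')) * norm (grad \<phi> x)" for n
    proof (rule AE_I2)
      fix x
      have A: "0 \<le> A" using gb[of x] by linarith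
      have "\<bar>(g x - b (v x)) * e n x * \<phi> x\<bar> \<le> (A * 1) * \<phi> x"
        unfolding abs_mult using gb[of x] e1[of n x] \<phi>(2)[of x] A by (intro mult_mono) auto
      moreover have "\<bar>\<Phi> n (v x) \<bullet> grad \<phi> x\<bar> \<le> (L * (2 * M') + L * (2 * M')) * norm (grad \<phi> x)"
        by (rule order_trans[OF Cauchy_Schwarz_ineq2 mult_right_mono[OF \<Phi>b norm_ge_zero]])
      ultimately show "norm ((g x - b (v x)) * e n x * \<phi> x + \<Phi> n (v x) \<bullet> grad \<phi> x)
        \<le> A * \<phi> x + (L * (2 * M') + L * (2 * M')) * norm (grad \<phi> x)"
        unfolding real_norm_def by linarith
    qed
  qed measurable
  moreover have "X2 \<longlonglongrightarrow> (LBINT x. h x * \<phi> x * far_operator p r v x)"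
    unfolding X2_def
  proof (rule integral_dominated_convergence[where w="\<lambda>x. (LBINT z::real^'n. far_kernel p r z * (2 * M)) * \<phi> x"])
    show "integrable lborel (\<lambda>x. (LBINT z::real^'n. far_kernel p r z * (2 * M)) * \<phi> x)"
      by (rule integrable_mult_right[OF test_function_integrable[OF \<phi>(1)]])
    show "AE x in lborel. (\<lambda>n. e n x * \<phi> x * far_operator p r v x) \<longlonglongrightarrow> h x * \<phi> x * far_operator p r v x"
      by (intro AE_I2 tendsto_intros e)
    show "AE x in lborel. norm (e n x * \<phi> x * far_operator p r v x) \<le> (LBINT z::real^'n. far_kernel p r z * (2 * M)) * \<phi> x" for n
    proof (rule AE_I2)
      fix x
      have "\<bar>e n x * \<phi> x * far_operator p r v x\<bar> \<le> (1 * \<phi> x) * (LBINT z::real^'n. far_kernel p r z * (2 * M))"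
        unfolding abs_mult using e1[of n x] \<phi>(2)[of x] far_operator_bound[where u=v and x=x and M=M, OF p r(1) v] by (intro mult_mono) auto
      then show "norm (e n x * \<phi> x * far_operator p r v x) \<le> (LBINT z::real^'n. far_kernel p r z * (2 * M)) * \<phi> x"
        by (simp add: mult.commute)
    qed
  qed measurable
  moreover have "X3 \<longlonglongrightarrow> (LBINT x. max (\<sigma> * (v x - k)) 0 * near_operator p r \<phi> x)"
    unfolding X3_def smooth_entropy_def
  proof (rule integral_dominated_convergence[where w="\<lambda>x. (2 * M') * \<bar>near_operator p r \<phi> x\<bar>"])
    show "integrable lborel (\<lambda>x. (2 * M') * \<bar>near_operator p r \<phi> x\<bar>)"
      by (intro integrable_mult_right integrable_abs near_operator_integrable[OF p r \<phi>(1)])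
    show "AE x in lborel. (\<lambda>n. ramp (m n * (\<sigma> * (v x - k))) / m n * near_operator p r \<phi> x) \<longlonglongrightarrow> max (\<sigma> * (v x - k)) 0 * near_operator p r \<phi> x"
      unfolding m_def by (intro AE_I2 tendsto_mult tendsto_const ramp_tendsto)
    show "AE x in lborel. norm (ramp (m n * (\<sigma> * (v x - k))) / m n * near_operator p r \<phi> x) \<le> (2 * M') * \<bar>near_operator p r \<phi> x\<bar>" for n
    proof (rule AE_I2)
      fix x
      have "max (m n * (\<sigma> * (v x - k))) 0 \<le> m n * \<bar>\<sigma> * (v x - k)\<bar>" using m[of n] by (auto intro!: mult_left_mono)
      then have "ramp (m n * (\<sigma> * (v x - k))) \<le> m n * (2 * M')"
        using ramp_bounds(2)[of "m n * (\<sigma> * (v x - k))"] mult_left_mono[OF vk[of x] less_imp_le[OF m[of n]]] unfolding \<sigma>1 by linarith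
      then have "\<bar>ramp (m n * (\<sigma> * (v x - k))) / m n\<bar> \<le> 2 * M'"
        using m[of n] ramp_bounds(1)[of "m n * (\<sigma> * (v x - k))"] by (simp add: divide_le_eq mult.commute)
      then show "norm (ramp (m n * (\<sigma> * (v x - k))) / m n * near_operator p r \<phi> x) \<le> (2 * M') * \<bar>near_operator p r \<phi> x\<bar>"
        unfolding real_norm_def abs_mult by (rule mult_right_mono) simp
    qed
  qed measurable
  ultimately have "(\<lambda>n. X1 n + C_const CARD('n) s * X2 n + C_const CARD('n) s * X3 n) \<longlonglongrightarrow>
     (LBINT x. (g x - b (v x)) * h x * \<phi> x + (h x *\<^sub>R (F (v x) - F k)) \<bullet> grad \<phi> x)
     + C_const CARD('n) s * (LBINT x. h x * \<phi> x * far_operator p r v x)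
     + C_const CARD('n) s * (LBINT x. max (\<sigma> * (v x - k)) 0 * near_operator p r \<phi> x)"
    by (intro tendsto_intros)
  then show "0 \<le> (LBINT x. (g x - b (v x)) * (\<sigma> * heaviside (\<sigma> * (v x - k))) * \<phi> x
             + ((\<sigma> * heaviside (\<sigma> * (v x - k))) *\<^sub>R (F (v x) - F k)) \<bullet> grad \<phi> x)
       + C_const CARD('n) s * (LBINT x. (\<sigma> * heaviside (\<sigma> * (v x - k))) * \<phi> x * far_operator (real CARD('n) + s) r v x)
       + C_const CARD('n) s * (LBINT x. max (\<sigma> * (v x - k)) 0 * near_operator (real CARD('n) + s) r \<phi> x)"
    unfolding h_def[symmetric] p_def[symmetric] by (rule LIMSEQ_le_const) (use pos in blast)
qed

section \<open>Tools for doubling the variables\<close>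

abbreviation lborel2 ("\<PP>") where "\<PP> \<equiv> lborel \<Otimes>\<^sub>M lborel"

lemma integrable_dominated:
  fixes h w :: "_ \<Rightarrow> real"
  assumes "integrable \<PP> w" "h \<in> borel_measurable \<PP>" "\<And>x y. \<bar>h (x, y)\<bar> \<le> w (x, y)"
  shows "integrable \<PP> h"
  using assms(2) by (rule Bochner_Integration.integrable_bound[OF assms(1)])
    (auto intro!: AE_I2 order_trans[OF assms(3) abs_ge_self])

lemma
  fixes h \<rho> :: "'a::euclidean_space \<Rightarrow> real"
  assumes h: "integrable lborel h" and \<rho>: "integrable lborel \<rho>"
  shows integrable_conv_fst: "integrable \<PP> (\<lambda>(x, y). h x * \<rho> (x - y))"
    and integral_conv_fst: "(LINT (x, y)|\<PP>. h x * \<rho> (x - y)) = (LBINT x. h x) * (LBINT x. \<rho> x)"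
proof -
  have [measurable]: "h \<in> borel_measurable borel" "\<rho> \<in> borel_measurable borel" using h \<rho> by auto
  have int: "integrable lborel (\<lambda>y. h x * \<rho> (x - y))" for x
    by (intro integrable_mult_right integrable_reflect \<rho>)
  have eq: "(LBINT y. h x * \<rho> (x - y)) = h x * (LBINT x. \<rho> x)" for x
    by (subst integral_mult_right_zero) (simp add: integral_reflect)
  have neq: "(LBINT y. norm (h x * \<rho> (x - y))) = \<bar>h x\<bar> * (LBINT x. \<bar>\<rho> x\<bar>)" for x
    unfolding real_norm_def abs_mult
    by (subst integral_mult_right_zero) (subst integral_reflect[of "\<lambda>t. \<bar>\<rho> t\<bar>"], auto)
  show i: "integrable \<PP> (\<lambda>(x, y). h x * \<rho> (x - y))"
  proof (rule lborel_pair.Fubini_integrable)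
    show "integrable lborel (\<lambda>x. LBINT y. norm (case (x, y) of (x, y) \<Rightarrow> h x * \<rho> (x - y)))"
      unfolding prod.case neq using h by auto
    show "AE x in lborel. integrable lborel (\<lambda>y. case (x, y) of (x, y) \<Rightarrow> h x * \<rho> (x - y))"
      using int by auto
  qed measurable
  show "(LINT (x, y)|\<PP>. h x * \<rho> (x - y)) = (LBINT x. h x) * (LBINT x. \<rho> x)"
    using lborel_pair.integral_fst[OF i] unfolding eq by simp
qed

lemma
  fixes h \<rho> :: "'a::euclidean_space \<Rightarrow> real"
  assumes h: "integrable lborel h" and \<rho>: "integrable lborel \<rho>"
  shows integrable_conv_snd: "integrable \<PP> (\<lambda>(x, y). h y * \<rho> (x - y))"
    and integral_conv_snd: "(LINT (x, y)|\<PP>. h y * \<rho> (x - y)) = (LBINT x. h x) * (LBINT x. \<rho> x)"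
proof -
  have \<rho>': "integrable lborel (\<lambda>t. \<rho> (0 - t))" by (rule integrable_reflect[OF \<rho>])
  note i = integrable_conv_fst[OF h \<rho>']
  show "integrable \<PP> (\<lambda>(x, y). h y * \<rho> (x - y))"
    using lborel_pair.integrable_product_swap[OF i] by (simp add: case_prod_beta)
  have "(LINT (x, y)|\<PP>. h y * \<rho> (x - y)) = (LINT (x, y)|\<PP>. h x * \<rho> (0 - (x - y)))"
    using lborel_pair.integral_product_swap[OF borel_measurable_integrable[OF i]] by (simp add: case_prod_beta)
  also have "\<dots> = (LBINT x. h x) * (LBINT x. \<rho> x)"
    using integral_conv_fst[OF h \<rho>'] integral_reflect[of \<rho> 0] \<rho> by simp
  finally show "(LINT (x, y)|\<PP>. h y * \<rho> (x - y)) = (LBINT x. h x) * (LBINT x. \<rho> x)" .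
qed

text \<open>The test function of the doubling argument, as a function of each of its variables. In the sum of
  the two gradients the terms with the gradient of \<open>\<rho>\<close> cancel.\<close>

lemma double_test_fst:
  fixes \<phi> \<rho> :: "real^'n \<Rightarrow> real" and y :: "real^'n"
  assumes \<phi>: "test_function \<phi>" and \<rho>: "test_function \<rho>"
  shows "test_function (\<lambda>x. \<phi> x * \<rho> (x - y))"
    "grad (\<lambda>x. \<phi> x * \<rho> (x - y)) = (\<lambda>x. \<phi> x *\<^sub>R grad \<rho> (x - y) + \<rho> (x - y) *\<^sub>R grad \<phi> x)"
proof -
  have "Ck k (\<lambda>x. \<rho> (1 *\<^sub>R x + (- y)))" for k
    using \<rho> by (intro Ck_affine) (auto simp: test_function_def)
  then show "test_function (\<lambda>x. \<phi> x * \<rho> (x - y))" by (intro test_function_mult[OF \<phi>]) simp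
  show "grad (\<lambda>x. \<phi> x * \<rho> (x - y)) = (\<lambda>x. \<phi> x *\<^sub>R grad \<rho> (x - y) + \<rho> (x - y) *\<^sub>R grad \<phi> x)"
  proof
    fix x
    have d: "((\<lambda>x. \<rho> (x - y)) has_derivative (\<lambda>z. grad \<rho> (x - y) \<bullet> z)) (at x)"
      by (rule has_derivative_compose[OF _ test_function_has_derivative[OF \<rho>]]) (auto intro!: derivative_eq_intros)
    show "grad (\<lambda>x. \<phi> x * \<rho> (x - y)) x = \<phi> x *\<^sub>R grad \<rho> (x - y) + \<rho> (x - y) *\<^sub>R grad \<phi> x"
      by (rule grad_eq, rule has_derivative_eq_rhs[OF has_derivative_mult[OF test_function_has_derivative[OF \<phi>] d]])
         (auto simp: inner_add_left fun_eq_iff)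
  qed
qed

lemma double_test_snd:
  fixes \<rho> :: "real^'n \<Rightarrow> real" and x :: "real^'n" and c :: real
  assumes \<rho>: "test_function \<rho>"
  shows "test_function (\<lambda>y. c * \<rho> (x - y))"
    "grad (\<lambda>y. c * \<rho> (x - y)) = (\<lambda>y. - (c *\<^sub>R grad \<rho> (x - y)))"
proof -
  obtain R where R: "R > 0" "\<And>x. norm x > R \<Longrightarrow> \<rho> x = 0" using test_function_support[OF \<rho>] by blast
  have "Ck k (\<lambda>y. c * \<rho> ((-1) *\<^sub>R y + x))" for k
    using \<rho> by (intro Ck_mult Ck_const Ck_affine) (auto simp: test_function_def)
  then have Ck: "Ck k (\<lambda>y. c * \<rho> (x - y))" for k by simp
  show "test_function (\<lambda>y. c * \<rho> (x - y))"
  proof (rule test_functionI[OF Ck])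
    fix y :: "real^'n" assume "norm y > R + norm x"
    then have "norm (x - y) > R" using norm_triangle_ineq3[of x y] by linarith
    then show "c * \<rho> (x - y) = 0" using R by simp
  qed
  show "grad (\<lambda>y. c * \<rho> (x - y)) = (\<lambda>y. - (c *\<^sub>R grad \<rho> (x - y)))"
  proof
    fix y :: "real^'n"
    have d: "((\<lambda>y. \<rho> (x - y)) has_derivative (\<lambda>z. grad \<rho> (x - y) \<bullet> (- z))) (at y)"
      by (rule has_derivative_compose[OF _ test_function_has_derivative[OF \<rho>]]) (auto intro!: derivative_eq_intros)
    show "grad (\<lambda>y. c * \<rho> (x - y)) y = - (c *\<^sub>R grad \<rho> (x - y))"
      by (rule grad_eq, rule has_derivative_eq_rhs[OF has_derivative_mult_right[OF d]]) (auto simp: fun_eq_iff)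
  qed
qed

lemma near_operator_weighted_bound:
  fixes \<phi> q :: "real^'n \<Rightarrow> real"
  assumes p: "integrable lborel (levy p :: real^'n \<Rightarrow> real)" and r: "0 < r" "r \<le> 1"
    and t: "tame B \<phi> (grad \<phi>)" and \<phi>: "test_function \<phi>" "\<And>x. norm (x - c) > R \<Longrightarrow> \<phi> x = 0" "R \<ge> 0"
    and q: "\<And>x. \<bar>q x\<bar> \<le> Q"
  shows "(LBINT x. q x * near_operator p r \<phi> x) \<le> Q * (B * near_mass p TYPE(real^'n) r) * measure lborel (cball (0::real^'n) (R + 1))"
proof -
  have Q: "0 \<le> Q" using q[of 0] by linarith
  have fin: "emeasure lborel (cball c (R + 1)) < \<infinity>" by (rule emeasure_lborel_cball_finite)
  have "\<bar>LBINT x. q x * near_operator p r \<phi> x\<bar> \<le> (LBINT x. Q * (B * near_mass p TYPE(real^'n) r * indicator (cball c (R + 1)) x))"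
  proof (rule integral_abs_le)
    show "integrable lborel (\<lambda>x. Q * (B * near_mass p TYPE(real^'n) r * indicator (cball c (R + 1)) x))"
      using fin by (intro integrable_mult_right integrable_real_indicator) auto
    show "\<bar>q x * near_operator p r \<phi> x\<bar> \<le> Q * (B * near_mass p TYPE(real^'n) r * indicator (cball c (R + 1)) x)" for x
      unfolding abs_mult using q[of x] near_operator_bound[where R=R and c=c and x=x, OF p r t \<phi>(1,2)] Q by (intro mult_mono) auto
  qed
  also have "\<dots> = Q * (B * near_mass p TYPE(real^'n) r) * measure lborel (cball c (R + 1))"
    by simp
  also have "measure lborel (cball c (R + 1)) = measure lborel (cball (0::real^'n) (R + 1))"
    using \<phi>(3) content_cball[of "R + 1" c] content_cball[of "R + 1" "0::real^'n"] by simp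
  finally show ?thesis by linarith
qed

lemma integrable_pair_bound:
  fixes f :: "'a::euclidean_space \<Rightarrow> 'b::euclidean_space \<Rightarrow> real"
  assumes [measurable]: "case_prod f \<in> borel_measurable (borel \<Otimes>\<^sub>M borel)"
    and i: "\<And>z. integrable lborel (f z)" and le: "\<And>z. (LBINT w. \<bar>f z w\<bar>) \<le> k z" and k: "integrable lborel k"
  shows "integrable \<PP> (case_prod f)"
proof (rule lborel_pair.Fubini_integrable)
  show "integrable lborel (\<lambda>z. LBINT w. norm (case (z, w) of (x, xa) \<Rightarrow> f x xa))"
  proof (rule Bochner_Integration.integrable_bound[OF k])
    show "AE z in lborel. norm (LBINT w. norm (case (z, w) of (x, xa) \<Rightarrow> f x xa)) \<le> norm (k z)"
    proof (rule AE_I2)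
      fix z
      have "0 \<le> (LBINT w. \<bar>f z w\<bar>)" by (intro integral_nonneg_AE) auto
      with le[of z] show "norm (LBINT w. norm (case (z, w) of (x, xa) \<Rightarrow> f x xa)) \<le> norm (k z)" by simp
    qed
  qed measurable
qed (use i in auto)

text \<open>Discrete integration by parts: by translation invariance the shift by \<open>D z\<close> moves from one factor to
  the other as the shift by \<open>- D z\<close>.\<close>

lemma diff_adjoint:
  fixes K :: "'b::euclidean_space \<Rightarrow> real" and W \<Psi> :: "'a::euclidean_space \<Rightarrow> real" and D :: "'b \<Rightarrow> 'a"
  assumes K: "integrable lborel K" and \<Psi>: "integrable lborel \<Psi>"
    and [measurable]: "W \<in> borel_measurable borel" "D \<in> borel_measurable borel" and W: "\<And>w. \<bar>W w\<bar> \<le> Q"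
  shows "(LBINT w. \<Psi> w * (LBINT z. K z * (W (w + D z) - W w)))
       = (LBINT w. W w * (LBINT z. K z * (\<Psi> (w - D z) - \<Psi> w)))"
proof -
  have [measurable]: "K \<in> borel_measurable borel" "\<Psi> \<in> borel_measurable borel" using K \<Psi> by auto
  have Q: "0 \<le> Q" using W[of 0] by linarith
  define A where "A z w = K z * \<Psi> w * W (w + D z)" for z w
  define B where "B z w = K z * \<Psi> (w - D z) * W w" for z w
  define E where "E z w = K z * \<Psi> w * W w" for z w
  have \<Psi>t: "integrable lborel (\<lambda>w. \<Psi> (w - D z))" for z
    using integrable_translate[OF \<Psi>, of "- D z"] by simp
  have \<Psi>n: "(LBINT w. \<bar>\<Psi> (w - D z)\<bar>) = (LBINT w. \<bar>\<Psi> w\<bar>)" for z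
    using integral_translate[of "\<lambda>w. \<bar>\<Psi> w\<bar>" "- D z"] by simp
  have *: "integrable lborel (\<lambda>w. c * h w * q w)" "(LBINT w. \<bar>c * h w * q w\<bar>) \<le> \<bar>c\<bar> * ((LBINT w. \<bar>h w\<bar>) * Q)"
    if h: "integrable lborel h" and [measurable]: "q \<in> borel_measurable borel" and q: "\<And>w. \<bar>q w\<bar> \<le> Q"
    for c and h q :: "'a \<Rightarrow> real"
  proof -
    have [measurable]: "h \<in> borel_measurable borel" using h by auto
    have le: "\<bar>c * h w * q w\<bar> \<le> \<bar>c\<bar> * (\<bar>h w\<bar> * Q)" for w
      unfolding abs_mult mult.assoc using q[of w] by (intro mult_left_mono) auto
    have ih: "integrable lborel (\<lambda>w. \<bar>c\<bar> * (\<bar>h w\<bar> * Q))" using h by auto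
    show i: "integrable lborel (\<lambda>w. c * h w * q w)"
      by (rule Bochner_Integration.integrable_bound[OF ih]) (measurable, auto intro!: AE_I2 order_trans[OF le abs_ge_self])
    have "(LBINT w. \<bar>c * h w * q w\<bar>) \<le> (LBINT w. \<bar>c\<bar> * (\<bar>h w\<bar> * Q))"
      by (rule integral_mono[OF integrable_abs[OF i] ih le])
    then show "(LBINT w. \<bar>c * h w * q w\<bar>) \<le> \<bar>c\<bar> * ((LBINT w. \<bar>h w\<bar>) * Q)" by simp
  qed
  have k: "integrable lborel (\<lambda>z. \<bar>K z\<bar> * ((LBINT w. \<bar>\<Psi> w\<bar>) * Q))" using K by auto
  have iA: "integrable \<PP> (case_prod A)"
    by (rule integrable_pair_bound[OF _ _ _ k]) (auto simp: A_def[abs_def] intro!: *[OF \<Psi>] W)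
  have iE: "integrable \<PP> (case_prod E)"
    by (rule integrable_pair_bound[OF _ _ _ k]) (auto simp: E_def[abs_def] intro!: *[OF \<Psi>] W)
  have iB: "integrable \<PP> (case_prod B)"
    by (rule integrable_pair_bound[OF _ _ _ k]) (auto simp: B_def[abs_def] intro!: *(1)[OF \<Psi>t] *(2)[OF \<Psi>t, unfolded \<Psi>n] W)
  have AB: "(LBINT w. A z w) = (LBINT w. B z w)" for z
    using integral_translate[of "B z" "D z"] by (simp add: A_def B_def[abs_def])
  have eqAB: "integral\<^sup>L \<PP> (case_prod A) = integral\<^sup>L \<PP> (case_prod B)"
    by (simp only: lborel_pair.integral_fst[OF iA, symmetric] lborel_pair.integral_fst[OF iB, symmetric] AB)
  have dAE: "integrable \<PP> (\<lambda>(z, w). A z w - E z w)"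
    using Bochner_Integration.integrable_diff[OF iA iE] by (simp add: case_prod_beta')
  have dBE: "integrable \<PP> (\<lambda>(z, w). B z w - E z w)"
    using Bochner_Integration.integrable_diff[OF iB iE] by (simp add: case_prod_beta')
  have "(LBINT w. \<Psi> w * (LBINT z. K z * (W (w + D z) - W w))) = (LBINT w. (LBINT z. A z w - E z w))"
    by (simp add: A_def E_def integral_mult_right_zero[symmetric] algebra_simps del: integral_mult_right_zero)
  also have "\<dots> = integral\<^sup>L \<PP> (\<lambda>(z, w). A z w - E z w)"
    by (rule lborel_pair.integral_snd[OF dAE])
  also have "\<dots> = integral\<^sup>L \<PP> (\<lambda>(z, w). B z w - E z w)"
    using eqAB Bochner_Integration.integral_diff[OF iA iE] Bochner_Integration.integral_diff[OF iB iE]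
    by (simp add: case_prod_beta')
  also have "\<dots> = (LBINT w. (LBINT z. B z w - E z w))"
    by (rule lborel_pair.integral_snd[OF dBE, symmetric])
  also have "\<dots> = (LBINT w. W w * (LBINT z. K z * (\<Psi> (w - D z) - \<Psi> w)))"
    by (simp add: B_def E_def integral_mult_right_zero[symmetric] algebra_simps del: integral_mult_right_zero)
  finally show ?thesis .
qed

lemma integrable_pos_part_weighted:
  fixes h k \<rho> \<phi> :: "real^'n \<Rightarrow> real"
  assumes hk: "integrable lborel h" "integrable lborel k" and \<rho>: "integrable lborel \<rho>" "\<And>x. 0 \<le> \<rho> x"
    and [measurable]: "\<phi> \<in> borel_measurable borel" and \<phi>: "\<And>x. \<bar>\<phi> x\<bar> \<le> B"
  shows "integrable \<PP> (\<lambda>(x, y). max (h x - k y) 0 * (\<phi> x * \<rho> (x - y)))"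
proof (rule integrable_dominated)
  have [measurable]: "h \<in> borel_measurable borel" "k \<in> borel_measurable borel" "\<rho> \<in> borel_measurable borel"
    using hk \<rho> by auto
  show "integrable \<PP> (\<lambda>w. (case w of (x, y) \<Rightarrow> (B * \<bar>h x\<bar>) * \<rho> (x - y)) + (case w of (x, y) \<Rightarrow> (B * \<bar>k y\<bar>) * \<rho> (x - y)))"
    using hk \<rho>(1) by (intro Bochner_Integration.integrable_add integrable_conv_fst integrable_conv_snd integrable_mult_right integrable_abs)
  show "(\<lambda>(x, y). max (h x - k y) 0 * (\<phi> x * \<rho> (x - y))) \<in> borel_measurable \<PP>" by measurable
  show "\<bar>case (x, y) of (x, y) \<Rightarrow> max (h x - k y) 0 * (\<phi> x * \<rho> (x - y))\<bar>
      \<le> (case (x, y) of (x, y) \<Rightarrow> (B * \<bar>h x\<bar>) * \<rho> (x - y)) + (case (x, y) of (x, y) \<Rightarrow> (B * \<bar>k y\<bar>) * \<rho> (x - y))" for x y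
  proof -
    have "\<bar>\<phi> x\<bar> * max (h x - k y) 0 \<le> B * (\<bar>h x\<bar> + \<bar>k y\<bar>)" using \<phi>[of x] by (intro mult_mono) auto
    from mult_right_mono[OF this \<rho>(2)[of "x - y"]] show ?thesis using \<rho>(2)[of "x - y"]
      by (simp add: abs_mult algebra_simps)
  qed
qed

lemma integrable_pos_part:
  fixes h k \<rho> :: "real^'n \<Rightarrow> real"
  assumes "integrable lborel h" "integrable lborel k" "integrable lborel \<rho>" "\<And>x. 0 \<le> \<rho> x"
  shows "integrable \<PP> (\<lambda>(x, y). max (h x - k y) 0 * \<rho> (x - y))"
  using integrable_pos_part_weighted[OF assms, of "\<lambda>_. 1" 1] by simp

section \<open>Doubling the variables\<close>

text \<open>Borel measurable, bounded representatives of a subsolution \<open>u\<close> and a supersolution \<open>v\<close> with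
  right-hand sides \<open>f\<close> and \<open>g\<close>.\<close>

locale kruzhkov_pair =
  fixes b :: "real \<Rightarrow> real" and F :: "real \<Rightarrow> real^'n" and p M A L C :: real and u v f g :: "real^'n \<Rightarrow> real"
  assumes meas [measurable]: "u \<in> borel_measurable borel" "v \<in> borel_measurable borel"
      "f \<in> borel_measurable borel" "g \<in> borel_measurable borel"
      "b \<in> borel_measurable borel" "F \<in> borel_measurable borel"
    and u_bound: "\<bar>u x\<bar> \<le> M" and v_bound: "\<bar>v x\<bar> \<le> M"
    and f_bound: "\<bar>f x - b (u x)\<bar> \<le> A" and g_bound: "\<bar>g x - b (v x)\<bar> \<le> A"
    and b_mono: "mono b" and F_lipschitz: "L-lipschitz_on {-M..M} F"
    and levy: "integrable lborel (levy p :: real^'n \<Rightarrow> real)" and C_nonneg: "0 \<le> C"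
    and u_int: "integrable lborel u" and v_int: "integrable lborel v"
    and sub: "kruzhkov_inequality p C b F 1 f u" and super: "kruzhkov_inequality p C b F (-1) g v"
begin

lemma M_nonneg: "0 \<le> M" using u_bound[of 0] by linarith

lemma L_nonneg: "0 \<le> L" by (rule lipschitz_on_nonneg[OF F_lipschitz])

lemma A_nonneg: "0 \<le> A" using f_bound[of 0] by linarith

lemma max_bound: "\<bar>max (u x - v y) 0\<bar> \<le> 2 * M"
  using u_bound[of x] v_bound[of y] by auto

lemma heaviside_abs: "\<bar>heaviside t\<bar> \<le> 1" by (simp add: heaviside_def)

lemma flux_bound: "norm (heaviside (u x - v y) *\<^sub>R (F (u x) - F (v y))) \<le> L * max (u x - v y) 0"
proof (cases "u x - v y > 0")
  case True
  have "u x \<in> {-M..M}" "v y \<in> {-M..M}" using u_bound[of x] v_bound[of y] by (auto simp: abs_le_iff)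
  from lipschitz_onD[OF F_lipschitz this] True show ?thesis by (simp add: heaviside_def dist_norm)
qed (simp add: heaviside_def L_nonneg)

text \<open>The integrand left after adding the inequality for \<open>u\<close> in \<open>x\<close> with \<open>k = v y\<close> and that for \<open>v\<close> in \<open>y\<close> with \<open>k = u x\<close>,
  without the near part.\<close>

definition doubled :: "(real^'n \<Rightarrow> real) \<Rightarrow> (real^'n \<Rightarrow> real) \<Rightarrow> real \<Rightarrow> (real^'n) \<times> (real^'n) \<Rightarrow> real" where
  "doubled \<phi> \<rho> r = (\<lambda>(x, y). ((f x - g y) - (b (u x) - b (v y))) * heaviside (u x - v y) * (\<phi> x * \<rho> (x - y))
          + \<rho> (x - y) * ((heaviside (u x - v y) *\<^sub>R (F (u x) - F (v y))) \<bullet> grad \<phi> x)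
          + C * (heaviside (u x - v y) * (far_operator p r u x - far_operator p r v y) * (\<phi> x * \<rho> (x - y))))"

text \<open>For fixed \<open>y\<close> the near part is at most a multiple of \<open>near_mass\<close>, and it is 0 unless \<open>y\<close> lies in a fixed ball;
  likewise for fixed \<open>x\<close>. Estimating it before the second integration leaves only terms that are
  integrable on the product.\<close>

lemma doubling_step:
  fixes \<phi> \<rho> :: "real^'n \<Rightarrow> real"
  assumes \<phi>: "test_function \<phi>" "\<And>x. 0 \<le> \<phi> x" and \<rho>: "test_function \<rho>" "\<And>x. 0 \<le> \<rho> x"
  obtains E where "0 \<le> E" "\<And>r. 0 < r \<Longrightarrow> r \<le> 1 \<Longrightarrow> integrable \<PP> (doubled \<phi> \<rho> r)" "\<And>r. 0 < r \<Longrightarrow> r \<le> 1 \<Longrightarrow>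
    0 \<le> integral\<^sup>L \<PP> (doubled \<phi> \<rho> r)
        + E * near_mass p TYPE(real^'n) r"
proof -
  note [measurable] = grad_measurable[OF \<phi>(1)] test_function_measurable[OF \<phi>(1)] grad_measurable[OF \<rho>(1)] test_function_measurable[OF \<rho>(1)]
  obtain B1 where B1: "tame B1 \<phi> (grad \<phi>)" using tame_test_function[OF \<phi>(1)] by blast
  obtain B2 where B2: "tame B2 \<rho> (grad \<rho>)" using tame_test_function[OF \<rho>(1)] by blast
  obtain R1 where R1: "R1 > 0" "\<And>x. norm x > R1 \<Longrightarrow> \<phi> x = 0" using test_function_support[OF \<phi>(1)] by blast
  obtain R2 where R2: "R2 > 0" "\<And>x. norm x > R2 \<Longrightarrow> \<rho> x = 0" using test_function_support[OF \<rho>(1)] by blast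
  have B0: "0 \<le> B1" "0 \<le> B2" "\<And>x. \<bar>\<phi> x\<bar> \<le> B1" using B1 B2 by (auto simp: tame_def)
  define B where "B = 3 * B1 * B2"
  have tX: "tame B (\<lambda>x. \<phi> x * \<rho> (x - y)) (grad (\<lambda>x. \<phi> x * \<rho> (x - y)))" for y
    unfolding double_test_fst[OF \<phi>(1) \<rho>(1)] B_def by (rule tame_mult[OF B1 tame_translate[OF B2]])
  have tY: "tame B (\<lambda>y. \<phi> x * \<rho> (x - y)) (grad (\<lambda>y. \<phi> x * \<rho> (x - y)))" for x
  proof -
    have t: "tame (\<bar>\<phi> x\<bar> * B2) (\<lambda>y. \<phi> x * \<rho> (x - y)) (grad (\<lambda>y. \<phi> x * \<rho> (x - y)))"
      using tame_scaleR[OF tame_reflect[OF B2, of x], of "\<phi> x"] unfolding double_test_snd[OF \<rho>(1)] by simp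
    have "\<bar>\<phi> x\<bar> * B2 \<le> B1 * B2" using B0 by (intro mult_right_mono) auto
    moreover have "0 \<le> B1 * B2" using B0 by simp
    ultimately have "\<bar>\<phi> x\<bar> * B2 \<le> B" unfolding B_def mult.assoc by linarith
    with t show ?thesis by (rule tame_mono)
  qed
  define V where "V R = measure lborel (cball (0::real^'n) R)" for R
  have V: "0 \<le> V R" for R by (simp add: V_def)
  define Q1 where "Q1 = 2 * M * B * V (R1 + 1)"
  define Q2 where "Q2 = 2 * M * B * V (R2 + 1)"
  have Q: "0 \<le> Q1" "0 \<le> Q2" using M_nonneg B0 V by (auto simp: Q1_def Q2_def B_def)
  define E where "E = C * (Q1 * V (R1 + R2) + Q2 * V R1)"
  show ?thesis
  proof (rule that[of E])
    show "0 \<le> E" using Q V C_nonneg by (simp add: E_def)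
    have "integrable \<PP> (doubled \<phi> \<rho> r) \<and> 0 \<le> integral\<^sup>L \<PP> (doubled \<phi> \<rho> r) + E * near_mass p TYPE(real^'n) r"
      if r: "0 < r" "r \<le> 1" for r
    proof -
    define \<kappa> where "\<kappa> = near_mass p TYPE(real^'n) r"
    have \<kappa>: "0 \<le> \<kappa>" unfolding \<kappa>_def by (rule near_mass_nonneg)
    define J where "J = (LBINT z::real^'n. far_kernel p r z * (2 * M))"
    have Ju: "\<bar>far_operator p r u x\<bar> \<le> J" for x unfolding J_def by (rule far_operator_bound[where u=u, OF levy r(1) u_bound])
    have Jv: "\<bar>far_operator p r v x\<bar> \<le> J" for x unfolding J_def by (rule far_operator_bound[where u=v, OF levy r(1) v_bound])
    have J0: "0 \<le> J" using Ju[of 0] by linarith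
    define H where "H x y = heaviside (u x - v y)" for x y
    define G where "G x y = heaviside (u x - v y) *\<^sub>R (F (u x) - F (v y))" for x y
    define \<Psi> where "\<Psi> x y = \<phi> x * \<rho> (x - y)" for x y
    define a1 where "a1 x y = (f x - b (u x)) * H x y * \<Psi> x y + G x y \<bullet> (\<phi> x *\<^sub>R grad \<rho> (x - y) + \<rho> (x - y) *\<^sub>R grad \<phi> x)" for x y
    define a2 where "a2 x y = H x y * \<Psi> x y * far_operator p r u x" for x y
    define c1 where "c1 x y = (g y - b (v y)) * (- H x y) * \<Psi> x y + G x y \<bullet> (- (\<phi> x *\<^sub>R grad \<rho> (x - y)))" for x y
    define c2 where "c2 x y = (- H x y) * \<Psi> x y * far_operator p r v y" for x y
    have H1: "\<bar>H x y\<bar> \<le> 1" for x y unfolding H_def by (rule heaviside_abs)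
    have G1: "norm (G x y) \<le> L * (2 * M)" for x y
      unfolding G_def using mult_left_mono[OF max_bound L_nonneg, of x y] flux_bound[of x y] by simp
    have \<Psi>0: "0 \<le> \<Psi> x y" for x y using \<phi> \<rho> by (simp add: \<Psi>_def)
    have [measurable]: "case_prod \<Psi> \<in> borel_measurable \<PP>" "case_prod H \<in> borel_measurable \<PP>" "case_prod G \<in> borel_measurable \<PP>"
      unfolding \<Psi>_def H_def G_def by measurable
    \<comment> \<open>one integrable majorant for all four terms\<close>
    define w where "w = (\<lambda>(x, y). (A + C * J + J) * (\<phi> x * \<rho> (x - y)) + L * (2 * M) * (\<phi> x * norm (grad \<rho> (x - y))) + L * (2 * M) * (norm (grad \<phi> x) * \<rho> (x - y)))"
    have iw: "integrable \<PP> w"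
    proof -
      have "integrable \<PP> (\<lambda>(x, y). \<phi> x * \<rho> (x - y))"
        by (rule integrable_conv_fst[OF test_function_integrable[OF \<phi>(1)] test_function_integrable[OF \<rho>(1)]])
      moreover have "integrable \<PP> (\<lambda>(x, y). \<phi> x * norm (grad \<rho> (x - y)))"
        by (rule integrable_conv_fst[OF test_function_integrable[OF \<phi>(1)] integrable_norm[OF grad_integrable[OF \<rho>(1)]]])
      moreover have "integrable \<PP> (\<lambda>(x, y). norm (grad \<phi> x) * \<rho> (x - y))"
        by (rule integrable_conv_fst[OF integrable_norm[OF grad_integrable[OF \<phi>(1)]] test_function_integrable[OF \<rho>(1)]])
      ultimately show ?thesis unfolding w_def case_prod_beta'
        by (intro Bochner_Integration.integrable_add integrable_mult_right)
    qed
    have CJ: "0 \<le> C * J" using C_nonneg J0 by simp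
    have L2M: "0 \<le> L * (2 * M)" using L_nonneg M_nonneg by simp
    have b1: "\<bar>q * H x y * \<Psi> x y\<bar> \<le> A * \<Psi> x y" if "\<bar>q\<bar> \<le> A" for q x y
    proof -
      have "\<bar>q * H x y\<bar> \<le> A * 1" unfolding abs_mult using that H1[of x y] A_nonneg by (intro mult_mono) auto
      then show ?thesis unfolding abs_mult[of _ "\<Psi> x y"] using \<Psi>0[of x y] by (simp add: mult_right_mono)
    qed
    have b2: "\<bar>H x y * \<Psi> x y * q\<bar> \<le> J * \<Psi> x y" if "\<bar>q\<bar> \<le> J" for q x y
    proof -
      have "\<bar>q * H x y\<bar> \<le> J * 1" unfolding abs_mult using that H1[of x y] J0 by (intro mult_mono) auto
      then have "\<bar>q * H x y\<bar> * \<Psi> x y \<le> J * \<Psi> x y" using \<Psi>0[of x y] by (simp add: mult_right_mono)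
      then show ?thesis using \<Psi>0[of x y] by (simp add: abs_mult mult_ac)
    qed
    have b3: "\<bar>G x y \<bullet> (\<phi> x *\<^sub>R grad \<rho> (x - y))\<bar> \<le> L * (2 * M) * (\<phi> x * norm (grad \<rho> (x - y)))" for x y
      using order_trans[OF Cauchy_Schwarz_ineq2 mult_right_mono[OF G1 norm_ge_zero], of x y "\<phi> x *\<^sub>R grad \<rho> (x - y)"] \<phi>(2)[of x] by simp
    have b4: "\<bar>G x y \<bullet> (\<rho> (x - y) *\<^sub>R grad \<phi> x)\<bar> \<le> L * (2 * M) * (norm (grad \<phi> x) * \<rho> (x - y))" for x y
      using order_trans[OF Cauchy_Schwarz_ineq2 mult_right_mono[OF G1 norm_ge_zero], of x y "\<rho> (x - y) *\<^sub>R grad \<phi> x"] \<rho>(2)[of "x - y"] by (simp add: mult_ac)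
    have wge: "w (x, y) = A * \<Psi> x y + C * J * \<Psi> x y + J * \<Psi> x y + L * (2 * M) * (\<phi> x * norm (grad \<rho> (x - y))) + L * (2 * M) * (norm (grad \<phi> x) * \<rho> (x - y))"
      "0 \<le> A * \<Psi> x y" "0 \<le> C * J * \<Psi> x y" "0 \<le> J * \<Psi> x y" "0 \<le> L * (2 * M) * (\<phi> x * norm (grad \<rho> (x - y)))" "0 \<le> L * (2 * M) * (norm (grad \<phi> x) * \<rho> (x - y))" for x y
    proof -
      show "w (x, y) = A * \<Psi> x y + C * J * \<Psi> x y + J * \<Psi> x y + L * (2 * M) * (\<phi> x * norm (grad \<rho> (x - y))) + L * (2 * M) * (norm (grad \<phi> x) * \<rho> (x - y))"
        by (simp add: w_def \<Psi>_def algebra_simps)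
      show "0 \<le> A * \<Psi> x y" "0 \<le> C * J * \<Psi> x y" "0 \<le> J * \<Psi> x y"
        by (rule mult_nonneg_nonneg[OF _ \<Psi>0], fact A_nonneg CJ J0)+
      show "0 \<le> L * (2 * M) * (\<phi> x * norm (grad \<rho> (x - y)))" "0 \<le> L * (2 * M) * (norm (grad \<phi> x) * \<rho> (x - y))"
        by (rule mult_nonneg_nonneg[OF L2M], simp add: \<phi>(2) \<rho>(2))+
    qed
    have ia1: "integrable \<PP> (case_prod a1)"
    proof (rule integrable_dominated[OF iw])
      show "\<bar>case_prod a1 (x, y)\<bar> \<le> w (x, y)" for x y
        using b1[OF f_bound, of x x y] b3[of x y] b4[of x y] wge[of x y]
        unfolding a1_def prod.case inner_add_right by linarith
    qed (unfold a1_def[abs_def], measurable)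
    have ia2: "integrable \<PP> (case_prod a2)"
    proof (rule integrable_dominated[OF iw])
      show "\<bar>case_prod a2 (x, y)\<bar> \<le> w (x, y)" for x y
        using b2[OF Ju, of x y x] wge[of x y] unfolding a2_def prod.case by linarith
    qed (unfold a2_def[abs_def], measurable)
    have ic1: "integrable \<PP> (case_prod c1)"
    proof (rule integrable_dominated[OF iw])
      show "\<bar>case_prod c1 (x, y)\<bar> \<le> w (x, y)" for x y
        using b1[OF g_bound, of y x y] b3[of x y] wge[of x y]
        unfolding c1_def prod.case inner_minus_right mult_minus_right mult_minus_left by linarith
    qed (unfold c1_def[abs_def], measurable)
    have ic2: "integrable \<PP> (case_prod c2)"
    proof (rule integrable_dominated[OF iw])
      show "\<bar>case_prod c2 (x, y)\<bar> \<le> w (x, y)" for x y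
        using b2[OF Jv, of x y y] wge[of x y] unfolding c2_def prod.case mult_minus_left by linarith
    qed (unfold c2_def[abs_def], measurable)
    have near0: "near_operator p r (\<lambda>x::real^'n. 0) = (\<lambda>x. 0)"
    proof
      fix x :: "real^'n"
      have "grad (\<lambda>x::real^'n. 0) x = 0" by (rule grad_eq) simp
      then show "near_operator p r (\<lambda>x::real^'n. 0) x = 0" by (simp add: near_operator_def)
    qed
    have I1: "- (C * (Q1 * \<kappa>)) * indicator (cball 0 (R1 + R2)) y \<le> (LBINT x. a1 x y) + C * (LBINT x. a2 x y)" for y
    proof -
      let ?X = "\<lambda>x. \<phi> x * \<rho> (x - y)"
      have "0 \<le> (LBINT x. a1 x y) + C * (LBINT x. a2 x y) + C * (LBINT x. max (u x - v y) 0 * near_operator p r ?X x)"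
        using sub[unfolded kruzhkov_inequality_def, rule_format, OF r double_test_fst(1)[OF \<phi>(1) \<rho>(1), of y], of "v y"] \<phi>(2) \<rho>(2)
        unfolding double_test_fst(2)[OF \<phi>(1) \<rho>(1)] a1_def a2_def H_def G_def \<Psi>_def by (simp add: mult.assoc)
      moreover have "(LBINT x. max (u x - v y) 0 * near_operator p r ?X x) \<le> Q1 * \<kappa> * indicator (cball 0 (R1 + R2)) y"
      proof (cases "norm y \<le> R1 + R2")
        case True
        have "(LBINT x. max (u x - v y) 0 * near_operator p r ?X x) \<le> 2 * M * (B * near_mass p TYPE(real^'n) r) * measure lborel (cball (0::real^'n) (R1 + 1))"
          by (rule near_operator_weighted_bound[where c=0, OF levy r tX double_test_fst(1)[OF \<phi>(1) \<rho>(1)] _ _ max_bound])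
             (use R1 in auto)
        then show ?thesis using True by (simp add: Q1_def V_def \<kappa>_def mult_ac)
      next
        case False
        have "?X = (\<lambda>x. 0)"
        proof
          fix x
          show "\<phi> x * \<rho> (x - y) = 0"
          proof (cases "norm x > R1")
            case False
            then have "norm (x - y) > R2" using \<open>\<not> norm y \<le> R1 + R2\<close> norm_triangle_ineq3[of x y] by linarith
            then show ?thesis using R2 by simp
          qed (use R1 in simp)
        qed
        then have "near_operator p r ?X = (\<lambda>x. 0)" using near0 by simp
        then show ?thesis using False by simp
      qed
      ultimately show ?thesis using mult_left_mono[OF _ C_nonneg] by (smt (verit, best) mult.assoc mult_minus_left)
    qed
    have I2: "- (C * (Q2 * \<kappa>)) * indicator (cball 0 R1) x \<le> (LBINT y. c1 x y) + C * (LBINT y. c2 x y)" for x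
    proof -
      let ?Y = "\<lambda>y. \<phi> x * \<rho> (x - y)"
      have G_eq: "(- heaviside (u x - v y)) *\<^sub>R (F (v y) - F (u x)) = G x y" for y
        by (simp add: G_def algebra_simps)
      have "0 \<le> (LBINT y. c1 x y) + C * (LBINT y. c2 x y) + C * (LBINT y. max (u x - v y) 0 * near_operator p r ?Y y)"
        using super[unfolded kruzhkov_inequality_def, rule_format, OF r double_test_snd(1)[OF \<rho>(1), of "\<phi> x" x], of "u x"] \<phi>(2) \<rho>(2)
        unfolding double_test_snd(2)[OF \<rho>(1)] mult_minus1 minus_diff_eq G_eq c1_def c2_def H_def \<Psi>_def by (simp add: mult.assoc)
      moreover have "(LBINT y. max (u x - v y) 0 * near_operator p r ?Y y) \<le> Q2 * \<kappa> * indicator (cball 0 R1) x"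
      proof (cases "norm x \<le> R1")
        case True
        have "(LBINT y. max (u x - v y) 0 * near_operator p r ?Y y) \<le> 2 * M * (B * near_mass p TYPE(real^'n) r) * measure lborel (cball (0::real^'n) (R2 + 1))"
          by (rule near_operator_weighted_bound[where c=x, OF levy r tY double_test_snd(1)[OF \<rho>(1)] _ _ max_bound])
             (use R2 in \<open>auto simp: norm_minus_commute\<close>)
        then show ?thesis using True by (simp add: Q2_def V_def \<kappa>_def mult_ac)
      next
        case False
        then have "near_operator p r ?Y = (\<lambda>x. 0)" using near0 R1 by simp
        then show ?thesis using False by simp
      qed
      ultimately show ?thesis using mult_left_mono[OF _ C_nonneg] by (smt (verit, best) mult.assoc mult_minus_left)
    qed
    have ind: "integrable lborel (\<lambda>x::real^'n. c * indicator (cball 0 R) x)" "(LBINT x::real^'n. c * indicator (cball 0 R) x) = c * V R" for c R :: real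
      using emeasure_lborel_cball_finite[of "0::real^'n" R] by (auto simp: V_def intro!: integrable_mult_right integrable_real_indicator)
    have "- (C * (Q1 * \<kappa>)) * V (R1 + R2) \<le> (LBINT y. (LBINT x. a1 x y) + C * (LBINT x. a2 x y))"
      unfolding ind(2)[symmetric]
      by (intro integral_mono ind(1) I1 Bochner_Integration.integrable_add integrable_mult_right
          lborel_pair.integrable_snd[OF ia1] lborel_pair.integrable_snd[OF ia2])
    also have "\<dots> = integral\<^sup>L \<PP> (case_prod a1) + C * integral\<^sup>L \<PP> (case_prod a2)"
      using lborel_pair.integrable_snd[OF ia1] lborel_pair.integrable_snd[OF ia2]
      by (simp add: lborel_pair.integral_snd[OF ia1] lborel_pair.integral_snd[OF ia2])
    finally have S1: "- (C * (Q1 * \<kappa>)) * V (R1 + R2) \<le> integral\<^sup>L \<PP> (case_prod a1) + C * integral\<^sup>L \<PP> (case_prod a2)" .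
    have "- (C * (Q2 * \<kappa>)) * V R1 \<le> (LBINT x. (LBINT y. c1 x y) + C * (LBINT y. c2 x y))"
      unfolding ind(2)[symmetric]
      by (intro integral_mono ind(1) I2 Bochner_Integration.integrable_add integrable_mult_right
          lborel_pair.integrable_fst[OF ic1] lborel_pair.integrable_fst[OF ic2])
    also have "\<dots> = integral\<^sup>L \<PP> (case_prod c1) + C * integral\<^sup>L \<PP> (case_prod c2)"
      using lborel_pair.integrable_fst[OF ic1] lborel_pair.integrable_fst[OF ic2]
      by (simp add: lborel_pair.integral_fst[OF ic1] lborel_pair.integral_fst[OF ic2])
    finally have S2: "- (C * (Q2 * \<kappa>)) * V R1 \<le> integral\<^sup>L \<PP> (case_prod c1) + C * integral\<^sup>L \<PP> (case_prod c2)" .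
    have eq: "(\<lambda>w. (case_prod a1 w + C * case_prod a2 w) + (case_prod c1 w + C * case_prod c2 w)) = doubled \<phi> \<rho> r"
      by (auto simp: fun_eq_iff doubled_def a1_def a2_def c1_def c2_def H_def G_def \<Psi>_def inner_add_right algebra_simps)
    have "integrable \<PP> (doubled \<phi> \<rho> r)"
      unfolding eq[symmetric] by (intro Bochner_Integration.integrable_add integrable_mult_right ia1 ia2 ic1 ic2)
    moreover have "integral\<^sup>L \<PP> (doubled \<phi> \<rho> r) = integral\<^sup>L \<PP> (case_prod a1) + C * integral\<^sup>L \<PP> (case_prod a2)
        + (integral\<^sup>L \<PP> (case_prod c1) + C * integral\<^sup>L \<PP> (case_prod c2))"
      unfolding eq[symmetric] using ia1 ia2 ic1 ic2 by simp
    ultimately show ?thesis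
      using S1 S2 unfolding \<kappa>_def[symmetric] E_def by (simp add: algebra_simps)
    qed
    then show "\<And>r. 0 < r \<Longrightarrow> r \<le> 1 \<Longrightarrow> integrable \<PP> (doubled \<phi> \<rho> r)"
      "\<And>r. 0 < r \<Longrightarrow> r \<le> 1 \<Longrightarrow> 0 \<le> integral\<^sup>L \<PP> (doubled \<phi> \<rho> r) + E * near_mass p TYPE(real^'n) r"
      by blast+
  qed
qed

text \<open>The pointwise estimates for the three terms of \<open>doubled\<close> use monotonicity of \<open>b\<close>, the Lipschitz bound of \<open>F\<close>,
  and \<open>heaviside a * (c - a) \<le> max c 0 - max a 0\<close>. The last one makes the joint shift by \<open>(z, z)\<close> appear,
  which is then moved to \<open>\<phi> x * \<rho> (x - y)\<close> and acts on \<open>\<phi>\<close> alone. The assumption on \<open>far_kernel\<close> is uniform in \<open>r\<close>,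
  so \<open>r\<close> can be chosen small at the end.\<close>

lemma doubling:
  fixes \<phi> \<rho> :: "real^'n \<Rightarrow> real"
  assumes \<phi>: "test_function \<phi>" "\<And>x. 0 \<le> \<phi> x" and \<rho>: "test_function \<rho>" "\<And>x. 0 \<le> \<rho> x"
    and grad_le: "\<And>x. norm (grad \<phi> x) \<le> G"
    and far_le: "\<And>r x. 0 < r \<Longrightarrow> \<bar>LBINT z. far_kernel p r z * (\<phi> (x - z) - \<phi> x)\<bar> \<le> c"
    and int: "integrable lborel f" "integrable lborel g" "integrable lborel (\<lambda>x. b (u x))" "integrable lborel (\<lambda>x. b (v x))"
  shows "(LINT (x, y)|\<PP>. max (b (u x) - b (v y)) 0 * (\<phi> x * \<rho> (x - y)))
     \<le> (LINT (x, y)|\<PP>. max (f x - g y) 0 * (\<phi> x * \<rho> (x - y)))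
       + (L * G + C * c) * (LINT (x, y)|\<PP>. max (u x - v y) 0 * \<rho> (x - y))"
proof -
  note [measurable] = grad_measurable[OF \<phi>(1)] test_function_measurable[OF \<phi>(1)] grad_measurable[OF \<rho>(1)] test_function_measurable[OF \<rho>(1)]
  obtain E where E: "0 \<le> E" "\<And>r. 0 < r \<Longrightarrow> r \<le> 1 \<Longrightarrow> integrable \<PP> (doubled \<phi> \<rho> r)"
    "\<And>r. 0 < r \<Longrightarrow> r \<le> 1 \<Longrightarrow> 0 \<le> integral\<^sup>L \<PP> (doubled \<phi> \<rho> r) + E * near_mass p TYPE(real^'n) r"
    using doubling_step[OF \<phi> \<rho>] by blast
  obtain B where B: "B > 0" "\<And>x. \<bar>\<phi> x\<bar> \<le> B" using test_function_bounded[OF \<phi>(1)] by blast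
  have \<rho>i: "integrable lborel \<rho>" by (rule test_function_integrable[OF \<rho>(1)])
  define \<Psi> where "\<Psi> = (\<lambda>(x, y). \<phi> x * \<rho> (x - y))"
  define W where "W = (\<lambda>(x, y). max (u x - v y) 0)"
  define D where "D r w = (LBINT z. far_kernel p r z * (W (w + (z, z)) - W w))" for r and w :: "(real^'n) \<times> (real^'n)"
  have [measurable]: "\<Psi> \<in> borel_measurable (borel \<Otimes>\<^sub>M borel)" "W \<in> borel_measurable (borel \<Otimes>\<^sub>M borel)"
    unfolding \<Psi>_def W_def by measurable
  have [measurable]: "\<Psi> \<in> borel_measurable borel" "W \<in> borel_measurable borel"
    using \<open>\<Psi> \<in> borel_measurable (borel \<Otimes>\<^sub>M borel)\<close> \<open>W \<in> borel_measurable (borel \<Otimes>\<^sub>M borel)\<close> by (simp_all add: borel_prod)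
  have W: "\<bar>W w\<bar> \<le> 2 * M" for w unfolding W_def using max_bound by (auto split: prod.split)
  have \<Psi>0: "0 \<le> \<Psi> w" for w unfolding \<Psi>_def using \<phi> \<rho> by (auto split: prod.split)
  have i\<Psi>: "integrable \<PP> \<Psi>" unfolding \<Psi>_def by (rule integrable_conv_fst[OF test_function_integrable[OF \<phi>(1)] \<rho>i])
  define mf mb mu where "mf = (\<lambda>(x, y). max (f x - g y) 0 * (\<phi> x * \<rho> (x - y)))"
    and "mb = (\<lambda>(x, y). max (b (u x) - b (v y)) 0 * (\<phi> x * \<rho> (x - y)))"
    and "mu = (\<lambda>(x, y). max (u x - v y) 0 * \<rho> (x - y))"
  have imf: "integrable \<PP> mf" unfolding mf_def
    by (rule integrable_pos_part_weighted[OF int(1,2) \<rho>i \<rho>(2) _ B(2)]) measurable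
  have imb: "integrable \<PP> mb" unfolding mb_def
    by (rule integrable_pos_part_weighted[OF int(3,4) \<rho>i \<rho>(2) _ B(2)]) measurable
  have imu: "integrable \<PP> mu" unfolding mu_def by (rule integrable_pos_part[OF u_int v_int \<rho>i \<rho>(2)])
  have mu0: "0 \<le> mu w" for w unfolding mu_def using \<rho> by (auto split: prod.split)
  have main: "integral\<^sup>L \<PP> mb \<le> integral\<^sup>L \<PP> mf + (L * G + C * c) * integral\<^sup>L \<PP> mu + E * near_mass p TYPE(real^'n) r"
    if r: "0 < r" "r \<le> 1" for r
  proof -
    have ifar: "integrable lborel (far_kernel p r :: real^'n \<Rightarrow> real)" by (rule far_kernel_integrable[OF levy r(1)])
    \<comment> \<open>\<open>D r w\<close> is the far operator at 0 of \<open>W\<close> restricted to the diagonal direction through \<open>w\<close>\<close>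
    define S where "S w z = W (w + (z, z))" for w and z :: "real^'n"
    have [measurable]: "S w \<in> borel_measurable borel" for w unfolding S_def[abs_def] by measurable
    have SM: "\<bar>S w z\<bar> \<le> 2 * M" for w z unfolding S_def by (rule W)
    have iD: "integrable lborel (\<lambda>z. far_kernel p r z * (W (w + (z, z)) - W w))" for w
      using far_operator_integrable[where x=0 and u="S w", OF levy r(1) _ SM] by (simp add: S_def zero_prod_def[symmetric])
    define K where "K = (LBINT z::real^'n. far_kernel p r z * (2 * (2 * M)))"
    have D_bound: "\<bar>D r w\<bar> \<le> K" for w
      using far_operator_bound[where x=0 and u="S w", OF levy r(1) SM] by (simp add: D_def K_def far_operator_def S_def zero_prod_def[symmetric])
    have [measurable]: "D r \<in> borel_measurable borel" unfolding D_def[abs_def] by measurable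
    have [measurable]: "D r \<in> borel_measurable \<PP>"
      using \<open>D r \<in> borel_measurable borel\<close> unfolding lborel_prod by simp
    have i\<Psi>D: "integrable \<PP> (\<lambda>w. \<Psi> w * D r w)"
    proof (rule Bochner_Integration.integrable_bound)
      show "integrable \<PP> (\<lambda>w. K * \<Psi> w)"
        using i\<Psi> by (rule integrable_mult_right)
      show "AE w in \<PP>. norm (\<Psi> w * D r w) \<le> norm (K * \<Psi> w)"
      proof (rule AE_I2)
        fix w
        have "\<bar>\<Psi> w * D r w\<bar> \<le> K * \<Psi> w"
          unfolding abs_mult using D_bound[of w] \<Psi>0[of w] by (simp only: abs_of_nonneg mult.commute[of "\<Psi> w"] mult_right_mono)
        then show "norm (\<Psi> w * D r w) \<le> norm (K * \<Psi> w)"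
          unfolding real_norm_def by (rule order_trans[OF _ abs_ge_self])
      qed
    qed measurable
    have nonlocal: "heaviside (u x - v y) * (far_operator p r u x - far_operator p r v y) \<le> D r (x, y)" for x y
    proof -
      have iu: "integrable lborel (\<lambda>z. far_kernel p r z * (u (x + z) - u x))" by (rule far_operator_integrable[where u=u, OF levy r(1) meas(1) u_bound])
      have iv: "integrable lborel (\<lambda>z. far_kernel p r z * (v (y + z) - v y))" by (rule far_operator_integrable[where u=v, OF levy r(1) meas(2) v_bound])
      have "heaviside (u x - v y) * (far_operator p r u x - far_operator p r v y)
        = (LBINT z. heaviside (u x - v y) * (far_kernel p r z * (u (x + z) - u x) - far_kernel p r z * (v (y + z) - v y)))"
        unfolding far_operator_def using iu iv by simp
      also have "\<dots> \<le> (LBINT z. far_kernel p r z * (W ((x, y) + (z, z)) - W (x, y)))"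
      proof (rule integral_mono[OF _ iD])
        show "integrable lborel (\<lambda>z. heaviside (u x - v y) * (far_kernel p r z * (u (x + z) - u x) - far_kernel p r z * (v (y + z) - v y)))"
          by (intro integrable_mult_right Bochner_Integration.integrable_diff iu iv)
        fix z
        have "heaviside (u x - v y) * ((u (x + z) - v (y + z)) - (u x - v y)) \<le> W ((x, y) + (z, z)) - W (x, y)"
          by (auto simp: heaviside_def W_def)
        from mult_left_mono[OF this far_kernel_nonneg[of p r z]]
        show "heaviside (u x - v y) * (far_kernel p r z * (u (x + z) - u x) - far_kernel p r z * (v (y + z) - v y)) \<le> far_kernel p r z * (W ((x, y) + (z, z)) - W (x, y))"
          by (simp add: algebra_simps)
      qed
      finally show ?thesis by (simp add: D_def)
    qed
    have pointwise: "doubled \<phi> \<rho> r w \<le> mf w - mb w + L * G * mu w + C * (\<Psi> w * D r w)" for w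
    proof (cases w)
      case (Pair x y)
      have "((f x - g y) - (b (u x) - b (v y))) * heaviside (u x - v y) \<le> max (f x - g y) 0 - max (b (u x) - b (v y)) 0"
      proof (cases "u x > v y")
        case True
        then have "b (v y) \<le> b (u x)" by (intro monoD[OF b_mono]) simp
        then show ?thesis using True by (simp add: heaviside_def)
      next
        case False
        then have "b (u x) \<le> b (v y)" by (intro monoD[OF b_mono]) simp
        then show ?thesis using False by (simp add: heaviside_def)
      qed
      from mult_right_mono[OF this \<Psi>0[of "(x, y)"]]
      have 1: "((f x - g y) - (b (u x) - b (v y))) * heaviside (u x - v y) * (\<phi> x * \<rho> (x - y)) \<le> mf w - mb w"
        by (simp add: Pair \<Psi>_def mf_def mb_def left_diff_distrib)
      have "(heaviside (u x - v y) *\<^sub>R (F (u x) - F (v y))) \<bullet> grad \<phi> x \<le> (L * max (u x - v y) 0) * G"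
        by (rule order_trans[OF norm_cauchy_schwarz mult_mono[OF flux_bound grad_le]]) (auto simp: L_nonneg)
      from mult_left_mono[OF this \<rho>(2)[of "x - y"]]
      have 2: "\<rho> (x - y) * ((heaviside (u x - v y) *\<^sub>R (F (u x) - F (v y))) \<bullet> grad \<phi> x) \<le> L * G * mu w"
        by (simp add: Pair mu_def mult_ac)
      have "heaviside (u x - v y) * (far_operator p r u x - far_operator p r v y) * \<Psi> (x, y) \<le> D r (x, y) * \<Psi> (x, y)"
        by (rule mult_right_mono[OF nonlocal \<Psi>0])
      from mult_left_mono[OF this C_nonneg]
      have 3: "C * (heaviside (u x - v y) * (far_operator p r u x - far_operator p r v y) * (\<phi> x * \<rho> (x - y))) \<le> C * (\<Psi> w * D r w)"
        by (simp add: Pair \<Psi>_def mult_ac)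
      show ?thesis using 1 2 3 by (simp add: Pair doubled_def)
    qed
    have "integral\<^sup>L \<PP> (doubled \<phi> \<rho> r) \<le> (LINT w|\<PP>. mf w - mb w + L * G * mu w + C * (\<Psi> w * D r w))"
      by (intro integral_mono E(2)[OF r] pointwise Bochner_Integration.integrable_add Bochner_Integration.integrable_diff
          integrable_mult_right imf imb imu i\<Psi>D)
    also have "\<dots> = integral\<^sup>L \<PP> mf - integral\<^sup>L \<PP> mb + L * G * integral\<^sup>L \<PP> mu + C * (LINT w|\<PP>. \<Psi> w * D r w)"
      using imf imb imu i\<Psi>D by simp
    also have "(LINT w|\<PP>. \<Psi> w * D r w) = (LINT w|\<PP>. W w * (LBINT z. far_kernel p r z * (\<Psi> (w - (z, z)) - \<Psi> w)))"
      unfolding lborel_prod D_def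
      by (rule diff_adjoint[OF ifar _ _ _ W]) (use i\<Psi> in \<open>auto simp: lborel_prod\<close>)
    also have "\<dots> \<le> (LINT w|\<PP>. c * mu w)"
    proof (rule order_trans[OF abs_ge_self integral_abs_le])
      show "integrable \<PP> (\<lambda>w. c * mu w)" using imu by (rule integrable_mult_right)
      fix w :: "(real^'n) \<times> (real^'n)"
      obtain x y where w: "w = (x, y)" by (cases w)
      have "(LBINT z. far_kernel p r z * (\<Psi> (w - (z, z)) - \<Psi> w)) = (LBINT z. \<rho> (x - y) * (far_kernel p r z * (\<phi> (x - z) - \<phi> x)))"
        by (simp add: w \<Psi>_def algebra_simps)
      also have "\<dots> = \<rho> (x - y) * (LBINT z. far_kernel p r z * (\<phi> (x - z) - \<phi> x))" by (rule integral_mult_right_zero)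
      finally have "\<bar>W w * (LBINT z. far_kernel p r z * (\<Psi> (w - (z, z)) - \<Psi> w))\<bar>
        = mu w * \<bar>LBINT z. far_kernel p r z * (\<phi> (x - z) - \<phi> x)\<bar>"
        using \<rho>(2)[of "x - y"] by (simp add: w abs_mult W_def mu_def)
      also have "\<dots> \<le> mu w * c" by (rule mult_left_mono[OF far_le[OF r(1)] mu0])
      finally show "\<bar>W w * (LBINT z. far_kernel p r z * (\<Psi> (w - (z, z)) - \<Psi> w))\<bar> \<le> c * mu w" by (simp add: mult.commute)
    qed
    finally have "integral\<^sup>L \<PP> (doubled \<phi> \<rho> r) \<le> integral\<^sup>L \<PP> mf - integral\<^sup>L \<PP> mb + L * G * integral\<^sup>L \<PP> mu + C * (c * integral\<^sup>L \<PP> mu)"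
      using C_nonneg by (simp add: mult_left_mono)
    with E(3)[OF r] show ?thesis by (simp add: algebra_simps)
  qed
  have "integral\<^sup>L \<PP> mb \<le> integral\<^sup>L \<PP> mf + (L * G + C * c) * integral\<^sup>L \<PP> mu"
  proof (rule field_le_epsilon)
    fix e :: real assume "e > 0"
    then obtain r where r: "0 < r" "r \<le> 1" "near_mass p TYPE(real^'n) r < e / (E + 1)"
      using near_mass_small[OF levy, of "e / (E + 1)"] E(1) by auto
    have "E * near_mass p TYPE(real^'n) r \<le> E * (e / (E + 1))" using r(3) E(1) by (intro mult_left_mono) auto
    also have "\<dots> \<le> e" using E(1) \<open>e > 0\<close> by (simp add: field_simps)
    finally show "integral\<^sup>L \<PP> mb \<le> integral\<^sup>L \<PP> mf + (L * G + C * c) * integral\<^sup>L \<PP> mu + e"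
      using main[OF r(1,2)] by linarith
  qed
  then show ?thesis by (simp only: mf_def mb_def mu_def)
qed

end

section \<open>Passing to the limit\<close>

context kruzhkov_pair
begin

lemma pos_part_cutoff_limit:
  fixes h k \<rho> \<phi> :: "real^'n \<Rightarrow> real"
  assumes "integrable lborel h" "integrable lborel k" "integrable lborel \<rho>" "\<And>x. 0 \<le> \<rho> x"
    and \<phi>: "continuous_on UNIV \<phi>" "\<phi> 0 = 1" "\<And>x. \<bar>\<phi> x\<bar> \<le> B"
  shows "(\<lambda>n. LINT (x, y)|\<PP>. max (h x - k y) 0 * (\<phi> (x /\<^sub>R real (Suc n)) * \<rho> (x - y)))
    \<longlonglongrightarrow> (LINT (x, y)|\<PP>. max (h x - k y) 0 * \<rho> (x - y))"
proof (rule integral_dominated_convergence)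
  have [measurable]: "h \<in> borel_measurable borel" "k \<in> borel_measurable borel" "\<rho> \<in> borel_measurable borel"
    "\<phi> \<in> borel_measurable borel"
    using assms by (auto intro: borel_measurable_continuous_onI)
  show "(\<lambda>(x, y). max (h x - k y) 0 * \<rho> (x - y)) \<in> borel_measurable \<PP>" by measurable
  show "(\<lambda>(x, y). max (h x - k y) 0 * (\<phi> (x /\<^sub>R real (Suc n)) * \<rho> (x - y))) \<in> borel_measurable \<PP>" for n by measurable
  show "integrable \<PP> (\<lambda>w. B * (case w of (x, y) \<Rightarrow> max (h x - k y) 0 * \<rho> (x - y)))"
    using integrable_pos_part[OF assms(1-4)] by (rule integrable_mult_right)
  show "AE w in \<PP>. (\<lambda>n. case w of (x, y) \<Rightarrow> max (h x - k y) 0 * (\<phi> (x /\<^sub>R real (Suc n)) * \<rho> (x - y)))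
     \<longlonglongrightarrow> (case w of (x, y) \<Rightarrow> max (h x - k y) 0 * \<rho> (x - y))"
  proof (rule AE_I2)
    fix w :: "(real^'n) \<times> (real^'n)"
    obtain x y where w: "w = (x, y)" by (cases w)
    have "(\<lambda>n. inverse (real (Suc n)) *\<^sub>R x) \<longlonglongrightarrow> 0 *\<^sub>R x"
      by (intro tendsto_intros LIMSEQ_inverse_real_of_nat)
    then have "(\<lambda>n. x /\<^sub>R real (Suc n)) \<longlonglongrightarrow> 0" by simp
    then have "(\<lambda>n. \<phi> (x /\<^sub>R real (Suc n))) \<longlonglongrightarrow> \<phi> 0"
      by (rule continuous_on_tendsto_compose[OF \<phi>(1)]) auto
    then have "(\<lambda>n. max (h x - k y) 0 * (\<phi> (x /\<^sub>R real (Suc n)) * \<rho> (x - y))) \<longlonglongrightarrow> max (h x - k y) 0 * (1 * \<rho> (x - y))"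
      unfolding \<phi>(2) by (intro tendsto_intros)
    then show "(\<lambda>n. case w of (x, y) \<Rightarrow> max (h x - k y) 0 * (\<phi> (x /\<^sub>R real (Suc n)) * \<rho> (x - y)))
       \<longlonglongrightarrow> (case w of (x, y) \<Rightarrow> max (h x - k y) 0 * \<rho> (x - y))" by (simp add: w)
  qed
  show "AE w in \<PP>. norm (case w of (x, y) \<Rightarrow> max (h x - k y) 0 * (\<phi> (x /\<^sub>R real (Suc n)) * \<rho> (x - y)))
     \<le> B * (case w of (x, y) \<Rightarrow> max (h x - k y) 0 * \<rho> (x - y))" for n
  proof (rule AE_I2)
    fix w :: "(real^'n) \<times> (real^'n)"
    obtain x y where w: "w = (x, y)" by (cases w)
    show "norm (case w of (x, y) \<Rightarrow> max (h x - k y) 0 * (\<phi> (x /\<^sub>R real (Suc n)) * \<rho> (x - y)))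
     \<le> B * (case w of (x, y) \<Rightarrow> max (h x - k y) 0 * \<rho> (x - y))"
      using mult_right_mono[OF \<phi>(3)[of "x /\<^sub>R real (Suc n)"], of "max (h x - k y) 0 * \<rho> (x - y)"] assms(4)[of "x - y"]
      by (simp add: w abs_mult mult_ac del: of_nat_Suc)
  qed
qed

text \<open>With \<open>\<phi> (x / k)\<close> in \<open>doubling\<close>, the factor of the integral of \<open>(u x - v y)\<^sup>+ * \<rho> (x - y)\<close> tends to 0 as \<open>k\<close> grows. This
  integral is finite because \<open>u\<close> and \<open>v\<close> are integrable.\<close>

lemma mollified_contraction:
  fixes \<rho> :: "real^'n \<Rightarrow> real"
  assumes \<rho>: "test_function \<rho>" "\<And>x. 0 \<le> \<rho> x"
    and int: "integrable lborel f" "integrable lborel g" "integrable lborel (\<lambda>x. b (u x))" "integrable lborel (\<lambda>x. b (v x))"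
  shows "(LINT (x, y)|\<PP>. max (b (u x) - b (v y)) 0 * \<rho> (x - y)) \<le> (LINT (x, y)|\<PP>. max (f x - g y) 0 * \<rho> (x - y))"
proof -
  obtain \<phi> :: "real^'n \<Rightarrow> real" where \<phi>: "test_function \<phi>" "\<And>x. 0 \<le> \<phi> x" "\<phi> 0 = 1"
      and "\<And>x. norm x > 1 \<Longrightarrow> \<phi> x = 0"
    by (rule bump_exists[where 'n = 'n, OF zero_less_one]; rule that)
  obtain B where B: "tame B \<phi> (grad \<phi>)" using tame_test_function[OF \<phi>(1)] by blast
  have B': "0 \<le> B" "\<And>x. \<bar>\<phi> x\<bar> \<le> B" "\<And>x. norm (grad \<phi> x) \<le> B" using B by (auto simp: tame_def)
  have \<rho>i: "integrable lborel \<rho>" by (rule test_function_integrable[OF \<rho>(1)])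
  obtain R where R: "R > 0" "\<And>x. norm x > R \<Longrightarrow> \<phi> x = 0" using test_function_support[OF \<phi>(1)] by blast
  define c where "c n = second_diff_mass p TYPE(real^'n) B (real (Suc n))" for n
  define I where "I = (LINT (x, y)|\<PP>. max (u x - v y) 0 * \<rho> (x - y))"
  have step: "(LINT (x, y)|\<PP>. max (b (u x) - b (v y)) 0 * (\<phi> (x /\<^sub>R real (Suc n)) * \<rho> (x - y)))
     \<le> (LINT (x, y)|\<PP>. max (f x - g y) 0 * (\<phi> (x /\<^sub>R real (Suc n)) * \<rho> (x - y)))
       + (L * (B * inverse (real (Suc n))) + C * c n) * I" for n
  proof -
    define k where "k = real (Suc n)"
    have k: "k \<ge> 1" by (simp add: k_def)
    have t: "test_function (\<lambda>x. \<phi> (x /\<^sub>R k))"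
    proof (rule test_functionI[of _ "R * k"])
      have "Ck m (\<lambda>x. \<phi> (inverse k *\<^sub>R x + 0))" for m
        using \<phi>(1) by (intro Ck_affine) (auto simp: test_function_def)
      then show "Ck m (\<lambda>x. \<phi> (x /\<^sub>R k))" for m by simp
      show "\<phi> (x /\<^sub>R k) = 0" if "norm x > R * k" for x
        using that k by (intro R(2)) (simp add: field_simps)
    qed
    have g: "grad (\<lambda>x. \<phi> (x /\<^sub>R k)) x = inverse k *\<^sub>R grad \<phi> (x /\<^sub>R k)" for x
    proof (rule grad_eq)
      have "((\<lambda>x. \<phi> (x /\<^sub>R k)) has_derivative (\<lambda>z. grad \<phi> (x /\<^sub>R k) \<bullet> (z /\<^sub>R k))) (at x)"
        by (rule has_derivative_compose[OF _ test_function_has_derivative[OF \<phi>(1)]]) (auto intro!: derivative_eq_intros)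
      then show "((\<lambda>x. \<phi> (x /\<^sub>R k)) has_derivative (\<bullet>) (inverse k *\<^sub>R grad \<phi> (x /\<^sub>R k))) (at x)"
        by (rule has_derivative_eq_rhs) (simp add: fun_eq_iff)
    qed
    show ?thesis
      unfolding I_def k_def[symmetric]
    proof (rule doubling[OF t _ \<rho>])
      show "norm (grad (\<lambda>x. \<phi> (x /\<^sub>R k)) x) \<le> B * inverse k" for x
        unfolding g using B'(3)[of "x /\<^sub>R k"] k by (simp add: mult.commute mult_right_mono)
      show "\<bar>LBINT z. far_kernel p r z * (\<phi> ((x - z) /\<^sub>R k) - \<phi> (x /\<^sub>R k))\<bar> \<le> c n" if "0 < r" for r x
        unfolding c_def k_def[symmetric] by (rule far_diff_bound[OF levy that k B test_function_measurable[OF \<phi>(1)]])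
    qed (use int \<phi>(2) in auto)
  qed
  show ?thesis
  proof (rule LIMSEQ_le)
    show "(\<lambda>n. LINT (x, y)|\<PP>. max (b (u x) - b (v y)) 0 * (\<phi> (x /\<^sub>R real (Suc n)) * \<rho> (x - y)))
      \<longlonglongrightarrow> (LINT (x, y)|\<PP>. max (b (u x) - b (v y)) 0 * \<rho> (x - y))"
      by (rule pos_part_cutoff_limit[OF int(3,4) \<rho>i \<rho>(2) test_function_continuous[OF \<phi>(1)] \<phi>(3) B'(2)])
    have "(\<lambda>n. (LINT (x, y)|\<PP>. max (f x - g y) 0 * (\<phi> (x /\<^sub>R real (Suc n)) * \<rho> (x - y)))
       + (L * (B * inverse (real (Suc n))) + C * c n) * I) \<longlonglongrightarrow> (LINT (x, y)|\<PP>. max (f x - g y) 0 * \<rho> (x - y)) + (L * (B * 0) + C * 0) * I"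
      unfolding c_def
      by (intro tendsto_intros LIMSEQ_inverse_real_of_nat second_diff_mass_tendsto(1)[OF levy B'(1)]
          pos_part_cutoff_limit[OF int(1,2) \<rho>i \<rho>(2) test_function_continuous[OF \<phi>(1)] \<phi>(3) B'(2)])
    then show "(\<lambda>n. (LINT (x, y)|\<PP>. max (f x - g y) 0 * (\<phi> (x /\<^sub>R real (Suc n)) * \<rho> (x - y)))
       + (L * (B * inverse (real (Suc n))) + C * c n) * I) \<longlonglongrightarrow> (LINT (x, y)|\<PP>. max (f x - g y) 0 * \<rho> (x - y))" by simp
    show "\<exists>N. \<forall>n\<ge>N. (LINT (x, y)|\<PP>. max (b (u x) - b (v y)) 0 * (\<phi> (x /\<^sub>R real (Suc n)) * \<rho> (x - y)))
     \<le> (LINT (x, y)|\<PP>. max (f x - g y) 0 * (\<phi> (x /\<^sub>R real (Suc n)) * \<rho> (x - y)))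
       + (L * (B * inverse (real (Suc n))) + C * c n) * I"
      using step by blast
  qed
qed

end

lemma translation_average:
  fixes p \<rho> :: "'a::euclidean_space \<Rightarrow> real"
  assumes p: "integrable lborel p" and \<rho>: "integrable lborel \<rho>" "\<And>x. 0 \<le> \<rho> x"
    and small: "\<And>h. \<rho> h \<noteq> 0 \<Longrightarrow> (LBINT x. \<bar>p (x + h) - p x\<bar>) \<le> e"
  shows "integrable \<PP> (\<lambda>(x, y). \<bar>p x - p y\<bar> * \<rho> (x - y))"
    and "(LINT (x, y)|\<PP>. \<bar>p x - p y\<bar> * \<rho> (x - y)) \<le> e * (LBINT x. \<rho> x)"
proof -
  have [measurable]: "p \<in> borel_measurable borel" "\<rho> \<in> borel_measurable borel" using p \<rho> by auto
  show i: "integrable \<PP> (\<lambda>(x, y). \<bar>p x - p y\<bar> * \<rho> (x - y))"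
  proof (rule integrable_dominated)
    show "integrable \<PP> (\<lambda>w. (case w of (x, y) \<Rightarrow> \<bar>p x\<bar> * \<rho> (x - y)) + (case w of (x, y) \<Rightarrow> \<bar>p y\<bar> * \<rho> (x - y)))"
      using p \<rho> by (intro Bochner_Integration.integrable_add integrable_conv_fst integrable_conv_snd integrable_abs)
    show "\<bar>case (x, y) of (x, y) \<Rightarrow> \<bar>p x - p y\<bar> * \<rho> (x - y)\<bar>
      \<le> (case (x, y) of (x, y) \<Rightarrow> \<bar>p x\<bar> * \<rho> (x - y)) + (case (x, y) of (x, y) \<Rightarrow> \<bar>p y\<bar> * \<rho> (x - y))" for x y
      using mult_right_mono[OF abs_triangle_ineq4[of "p x" "p y"] \<rho>(2)[of "x - y"]] \<rho>(2)[of "x - y"]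
      by (simp add: abs_mult algebra_simps)
  qed measurable
  define N where "N h y = \<rho> h * \<bar>p (y + h) - p y\<bar>" for h y
  have it: "integrable lborel (\<lambda>y. \<bar>p (y + h) - p y\<bar>)" for h
    by (intro integrable_abs Bochner_Integration.integrable_diff integrable_translate p)
  have N: "(LBINT y. N h y) \<le> \<rho> h * e" for h
  proof -
    have "(LBINT y. N h y) = \<rho> h * (LBINT y. \<bar>p (y + h) - p y\<bar>)"
      unfolding N_def by (rule integral_mult_right_zero)
    also have "\<dots> \<le> \<rho> h * e" using small[of h] \<rho>(2)[of h] by (cases "\<rho> h = 0") (auto intro: mult_left_mono)
    finally show ?thesis .
  qed
  have iN: "integrable \<PP> (case_prod N)"
  proof (rule integrable_pair_bound)
    show "case_prod N \<in> borel_measurable (borel \<Otimes>\<^sub>M borel)" unfolding N_def[abs_def] by measurable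
    show "integrable lborel (N h)" for h unfolding N_def[abs_def] by (rule integrable_mult_right[OF it])
    show "(LBINT y. \<bar>N h y\<bar>) \<le> \<rho> h * e" for h using N[of h] \<rho>(2)[of h] by (simp add: N_def abs_mult)
    show "integrable lborel (\<lambda>h. \<rho> h * e)" using \<rho>(1) by simp
  qed
  have "(LINT (x, y)|\<PP>. \<bar>p x - p y\<bar> * \<rho> (x - y)) = (LBINT y. LBINT x. \<bar>p x - p y\<bar> * \<rho> (x - y))"
    by (rule lborel_pair.integral_snd[OF i, symmetric])
  also have "\<dots> = (LBINT y. LBINT h. N h y)"
  proof (rule Bochner_Integration.integral_cong[OF refl])
    fix y
    show "(LBINT x. \<bar>p x - p y\<bar> * \<rho> (x - y)) = (LBINT h. N h y)"
      using integral_translate[of "\<lambda>x. \<bar>p x - p y\<bar> * \<rho> (x - y)" y] by (simp add: N_def add.commute mult.commute)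
  qed
  also have "\<dots> = (LBINT h. LBINT y. N h y)"
    by (simp only: lborel_pair.integral_snd[OF iN] lborel_pair.integral_fst[OF iN])
  also have "\<dots> \<le> (LBINT h. \<rho> h * e)"
    by (intro integral_mono N lborel_pair.integrable_fst[OF iN]) (use \<rho> in simp)
  finally show "(LINT (x, y)|\<PP>. \<bar>p x - p y\<bar> * \<rho> (x - y)) \<le> e * (LBINT x. \<rho> x)"
    by (simp add: mult.commute)
qed

text \<open>Replacing \<open>p x\<close> by \<open>p y\<close> costs at most the average of \<open>\<bar>p x - p y\<bar>\<close>, after which the integral
  over \<open>x\<close> sees only \<open>\<rho>\<close>.\<close>

lemma pos_part_mollified_limit:
  fixes p q :: "'a::euclidean_space \<Rightarrow> real"
  assumes p: "integrable lborel p" and q: "integrable lborel q" and "e > 0"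
  obtains d where "d > 0" "\<And>\<rho>. integrable lborel \<rho> \<Longrightarrow> (\<And>x. 0 \<le> \<rho> x) \<Longrightarrow> (LBINT x. \<rho> x) = 1 \<Longrightarrow>
      (\<And>x. norm x \<ge> d \<Longrightarrow> \<rho> x = 0) \<Longrightarrow>
      \<bar>(LINT (x, y)|\<PP>. max (p x - q y) 0 * \<rho> (x - y)) - (LBINT x. max (p x - q x) 0)\<bar> \<le> e"
proof -
  have [measurable]: "p \<in> borel_measurable borel" "q \<in> borel_measurable borel" using p q by auto
  obtain d where d: "d > 0" "\<And>h. norm h < d \<Longrightarrow> (LBINT x. \<bar>p (x + h) - p x\<bar>) < e"
    using L1_translation_continuous[OF p \<open>e > 0\<close>] by blast
  show ?thesis
  proof (rule that[OF d(1)])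
    fix \<rho> :: "'a \<Rightarrow> real"
    assume \<rho>: "integrable lborel \<rho>" "\<And>x. 0 \<le> \<rho> x" "(LBINT x. \<rho> x) = 1" "\<And>x. norm x \<ge> d \<Longrightarrow> \<rho> x = 0"
    have [measurable]: "\<rho> \<in> borel_measurable borel" using \<rho> by auto
    have "(LBINT x. \<bar>p (x + h) - p x\<bar>) \<le> e" if "\<rho> h \<noteq> 0" for h
      using d(2)[of h] \<rho>(4)[of h] that by (meson less_imp_le not_le)
    note T = translation_average[OF p \<rho>(1,2) this]
    have pq: "integrable lborel (\<lambda>x. max (p x - q x) 0)" using p q by auto
    have i2: "integrable \<PP> (\<lambda>(x, y). max (p y - q y) 0 * \<rho> (x - y))"
      by (rule integrable_conv_snd[OF pq \<rho>(1)])
    have diff: "\<bar>max (p x - q y) 0 * \<rho> (x - y) - max (p y - q y) 0 * \<rho> (x - y)\<bar> \<le> \<bar>p x - p y\<bar> * \<rho> (x - y)" for x y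
    proof -
      have "\<bar>max (p x - q y) 0 - max (p y - q y) 0\<bar> \<le> \<bar>p x - p y\<bar>" by auto
      from mult_right_mono[OF this \<rho>(2)[of "x - y"]] \<rho>(2)[of "x - y"] show ?thesis
        by (simp add: left_diff_distrib[symmetric] abs_mult)
    qed
    have i3: "integrable \<PP> (\<lambda>(x, y). max (p x - q y) 0 * \<rho> (x - y) - max (p y - q y) 0 * \<rho> (x - y))"
      by (rule Bochner_Integration.integrable_bound[OF T(1)])
         (measurable, auto intro!: AE_I2 order_trans[OF diff abs_ge_self])
    have i1: "integrable \<PP> (\<lambda>(x, y). max (p x - q y) 0 * \<rho> (x - y))"
      using Bochner_Integration.integrable_add[OF i3 i2] by (simp add: case_prod_beta')
    have "(LINT (x, y)|\<PP>. max (p x - q y) 0 * \<rho> (x - y)) - (LBINT x. max (p x - q x) 0)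
      = (LINT (x, y)|\<PP>. max (p x - q y) 0 * \<rho> (x - y) - max (p y - q y) 0 * \<rho> (x - y))"
      using Bochner_Integration.integral_diff[OF i1 i2] integral_conv_snd[OF pq \<rho>(1)] \<rho>(3)
      by (simp add: case_prod_beta')
    also have "\<bar>\<dots>\<bar> \<le> (LINT (x, y)|\<PP>. \<bar>p x - p y\<bar> * \<rho> (x - y))"
      by (rule integral_abs_le[OF T(1)]) (use diff in \<open>auto split: prod.split\<close>)
    also have "\<dots> \<le> e" using T(2) \<rho>(3) by simp
    finally show "\<bar>(LINT (x, y)|\<PP>. max (p x - q y) 0 * \<rho> (x - y)) - (LBINT x. max (p x - q x) 0)\<bar> \<le> e" .
  qed
qed

lemma (in kruzhkov_pair) contraction:
  assumes int: "integrable lborel f" "integrable lborel g" "integrable lborel (\<lambda>x. b (u x))" "integrable lborel (\<lambda>x. b (v x))"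
  shows "(LBINT x. max (b (u x) - b (v x)) 0) \<le> (LBINT x. max (f x - g x) 0)"
proof (rule field_le_epsilon)
  fix e :: real assume "e > 0"
  then have e: "e / 2 > 0" by simp
  obtain d1 where d1: "d1 > 0" "\<And>\<rho>. integrable lborel \<rho> \<Longrightarrow> (\<And>x. 0 \<le> \<rho> x) \<Longrightarrow> (LBINT x. \<rho> x) = 1 \<Longrightarrow>
      (\<And>x. norm x \<ge> d1 \<Longrightarrow> \<rho> x = 0) \<Longrightarrow>
      \<bar>(LINT (x, y)|\<PP>. max (f x - g y) 0 * \<rho> (x - y)) - (LBINT x. max (f x - g x) 0)\<bar> \<le> e / 2"
    using pos_part_mollified_limit[OF int(1,2) e] by blast
  obtain d2 where d2: "d2 > 0" "\<And>\<rho>. integrable lborel \<rho> \<Longrightarrow> (\<And>x. 0 \<le> \<rho> x) \<Longrightarrow> (LBINT x. \<rho> x) = 1 \<Longrightarrow>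
      (\<And>x. norm x \<ge> d2 \<Longrightarrow> \<rho> x = 0) \<Longrightarrow>
      \<bar>(LINT (x, y)|\<PP>. max (b (u x) - b (v y)) 0 * \<rho> (x - y)) - (LBINT x. max (b (u x) - b (v x)) 0)\<bar> \<le> e / 2"
    using pos_part_mollified_limit[OF int(3,4) e] by blast
  have "min d1 d2 / 2 > 0" using d1 d2 by simp
  then obtain \<rho> :: "real^'n \<Rightarrow> real" where \<rho>: "test_function \<rho>" "\<And>x. 0 \<le> \<rho> x" "(LBINT x. \<rho> x) = 1"
    "\<And>x. norm x > min d1 d2 / 2 \<Longrightarrow> \<rho> x = 0"
    using mollifier_exists by blast
  have s: "\<rho> x = 0" if "norm x \<ge> d1 \<or> norm x \<ge> d2" for x
    using \<rho>(4)[of x] that d1(1) d2(1) by (auto simp: min_def split: if_splits)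
  have "\<bar>(LINT (x, y)|\<PP>. max (f x - g y) 0 * \<rho> (x - y)) - (LBINT x. max (f x - g x) 0)\<bar> \<le> e / 2"
    using s by (intro d1(2) test_function_integrable \<rho>(1-3)) auto
  moreover have "\<bar>(LINT (x, y)|\<PP>. max (b (u x) - b (v y)) 0 * \<rho> (x - y)) - (LBINT x. max (b (u x) - b (v x)) 0)\<bar> \<le> e / 2"
    using s by (intro d2(2) test_function_integrable \<rho>(1-3)) auto
  moreover note mollified_contraction[OF \<rho>(1,2) int]
  ultimately show "(LBINT x. max (b (u x) - b (v x)) 0) \<le> (LBINT x. max (f x - g x) 0) + e"
    unfolding abs_le_iff by linarith
qed

section \<open>The contraction for entropy solutions\<close>

lemma ess_bounded_borel_representative:
  fixes u :: "real^'n \<Rightarrow> real"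
  assumes "ess_bounded u"
  obtains v M where "v \<in> borel_measurable borel" "AE x in lebesgue. u x = v x" "\<And>x. \<bar>v x\<bar> \<le> M"
proof -
  obtain M where u: "u \<in> borel_measurable lebesgue" "AE x in lebesgue. \<bar>u x\<bar> \<le> M"
    using assms by (auto simp: ess_bounded_def)
  obtain w where w: "w \<in> borel_measurable lborel" "AE x in lborel. u x = w x"
    using completion_ex_borel_measurable_real[OF u(1)] by blast
  define v where "v x = max (- \<bar>M\<bar>) (min \<bar>M\<bar> (w x))" for x
  show ?thesis
  proof (rule that[of v "\<bar>M\<bar>"])
    show "v \<in> borel_measurable borel" using w(1) unfolding v_def[abs_def] by measurable
    show "AE x in lebesgue. u x = v x"
      using u(2) AE_completion[OF w(2)] by eventually_elim (auto simp: v_def)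
    show "\<bar>v x\<bar> \<le> \<bar>M\<bar>" for x by (auto simp: v_def)
  qed
qed

lemma integrable_borel_representative:
  fixes u v :: "real^'n \<Rightarrow> real"
  assumes "integrable lebesgue u" "AE x in lebesgue. u x = v x" and v: "v \<in> borel_measurable borel"
  shows "integrable lborel v"
proof -
  have "integrable lebesgue v"
    by (rule integrable_cong_AE_imp[OF assms(1)]) (use v assms(2) in \<open>auto simp: measurable_completion elim: AE_mp\<close>)
  then show ?thesis using v by (simp add: integrable_completion)
qed

lemma C_const_nonneg: "0 < s \<Longrightarrow> s \<le> 1 \<Longrightarrow> 0 \<le> C_const n s"
  unfolding C_const_def by (intro divide_nonneg_nonneg mult_nonneg_nonneg less_imp_le[OF Gamma_real_pos]) auto

lemma entropy_contraction:
  fixes s lam :: real and b :: "real \<Rightarrow> real" and F :: "real \<Rightarrow> real ^ 'n"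
    and f f' u u' :: "real ^ 'n \<Rightarrow> real"
  assumes s: "0 < s" "s \<le> 1"
    and b: "\<exists>L. L-lipschitz_on UNIV b" "mono b"
    and lam: "0 < lam" "\<And>r. b r * r \<ge> lam * \<bar>r\<bar>\<^sup>2"
    and F: "locally_lipschitz F"
    and f: "integrable lebesgue f" "ess_bounded f"
    and f': "integrable lebesgue f'" "ess_bounded f'"
    and sol: "entropy_solution b F s f u" and sol': "entropy_solution b F s f' u'"
    and bu: "integrable lebesgue (\<lambda>x. b (u x))" and bu': "integrable lebesgue (\<lambda>x. b (u' x))"
  shows "(LINT x|lebesgue. max (b (u x) - b (u' x)) 0) \<le> (LINT x|lebesgue. max (f x - f' x) 0)"
proof -
  have eb: "ess_bounded u" "ess_bounded u'" using sol sol' by (auto simp: entropy_solution_def)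
  obtain v M1 where v: "v \<in> borel_measurable borel" "AE x in lebesgue. u x = v x" "\<And>x. \<bar>v x\<bar> \<le> M1"
    using ess_bounded_borel_representative[OF eb(1)] by blast
  obtain v' M2 where v': "v' \<in> borel_measurable borel" "AE x in lebesgue. u' x = v' x" "\<And>x. \<bar>v' x\<bar> \<le> M2"
    using ess_bounded_borel_representative[OF eb(2)] by blast
  obtain g K1 where g: "g \<in> borel_measurable borel" "AE x in lebesgue. f x = g x" "\<And>x. \<bar>g x\<bar> \<le> K1"
    using ess_bounded_borel_representative[OF f(2)] by blast
  obtain g' K2 where g': "g' \<in> borel_measurable borel" "AE x in lebesgue. f' x = g' x" "\<And>x. \<bar>g' x\<bar> \<le> K2"
    using ess_bounded_borel_representative[OF f'(2)] by blast
  have "continuous_on UNIV b" using b(1) lipschitz_on_continuous_on by blast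
  then have bm [measurable]: "b \<in> borel_measurable borel" by (rule borel_measurable_continuous_onI)
  have "continuous_on UNIV F"
    using F unfolding locally_lipschitz_def by (rule local_lipschitz_continuous_on) auto
  then have Fm: "F \<in> borel_measurable borel" by (rule borel_measurable_continuous_onI)
  note [measurable] = v(1) v'(1) g(1) g'(1)
  define M where "M = max M1 M2"
  have vM: "\<bar>v x\<bar> \<le> M" "\<bar>v' x\<bar> \<le> M" for x using v(3)[of x] v'(3)[of x] by (auto simp: M_def)
  define A where "A = max K1 K2 + \<bar>b M\<bar> + \<bar>b (- M)\<bar>"
  have bM: "\<bar>b r\<bar> \<le> \<bar>b M\<bar> + \<bar>b (- M)\<bar>" if "\<bar>r\<bar> \<le> M" for r
    using monoD[OF b(2), of r M] monoD[OF b(2), of "- M" r] that by (simp add: abs_le_iff) linarith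
  have gA: "\<bar>g x - b (v x)\<bar> \<le> A" for x
    using g(3)[of x] bM[OF vM(1)[of x]] max.cobounded1[of K1 K2] unfolding A_def by linarith
  have gA': "\<bar>g' x - b (v' x)\<bar> \<le> A" for x
    using g'(3)[of x] bM[OF vM(2)[of x]] max.cobounded2[of K2 K1] unfolding A_def by linarith
  obtain L where L: "L-lipschitz_on {-M..M} F" using locally_lipschitz_on_Icc[OF F] by blast
  have levy: "integrable lborel (levy (real CARD('n) + s) :: real^'n \<Rightarrow> real)"
    using s by (intro levy_integrable) auto
  have int: "integrable lborel (\<lambda>x. b (v x))" "integrable lborel (\<lambda>x. b (v' x))" "integrable lborel g" "integrable lborel g'"
  proof -
    show "integrable lborel (\<lambda>x. b (v x))"
      by (rule integrable_borel_representative[OF bu]) (use v(2) in eventually_elim, simp, measurable)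
    show "integrable lborel (\<lambda>x. b (v' x))"
      by (rule integrable_borel_representative[OF bu']) (use v'(2) in eventually_elim, simp, measurable)
    show "integrable lborel g" by (rule integrable_borel_representative[OF f(1) g(2,1)])
    show "integrable lborel g'" by (rule integrable_borel_representative[OF f'(1) g'(2,1)])
  qed
  \<comment> \<open>this is what makes the solutions themselves integrable\<close>
  have br: "lam * \<bar>r\<bar> \<le> \<bar>b r\<bar>" for r
  proof (cases "r = 0")
    case False
    have "lam * \<bar>r\<bar> * \<bar>r\<bar> \<le> \<bar>b r\<bar> * \<bar>r\<bar>"
      using lam(2)[of r] abs_ge_self[of "b r * r"] by (simp add: power2_eq_square abs_mult mult.assoc)
    then show ?thesis using False by simp
  qed simp
  have int_id: "integrable lborel w" if [measurable]: "w \<in> borel_measurable borel" and i: "integrable lborel (\<lambda>x. b (w x))"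
    for w :: "real^'n \<Rightarrow> real"
  proof (rule Bochner_Integration.integrable_bound)
    show "integrable lborel (\<lambda>x. b (w x) / lam)" using i by simp
    show "AE x in lborel. norm (w x) \<le> norm (b (w x) / lam)"
      using br lam(1) by (intro AE_I2) (simp add: field_simps)
  qed measurable
  interpret kruzhkov_pair b F "real CARD('n) + s" M A L "C_const CARD('n) s" v v' g g'
  proof
    show "kruzhkov_inequality (real CARD('n) + s) (C_const CARD('n) s) b F 1 g v"
      by (rule entropy_solution_kruzhkov[OF sol F v(2) g(2) v(1) g(1) bm vM(1) gA levy]) simp
    show "kruzhkov_inequality (real CARD('n) + s) (C_const CARD('n) s) b F (-1) g' v'"
      by (rule entropy_solution_kruzhkov[OF sol' F v'(2) g'(2) v'(1) g'(1) bm vM(2) gA' levy]) simp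
  qed (fact v(1) v'(1) g(1) g'(1) bm Fm vM gA gA' b(2) L levy C_const_nonneg[OF s] int_id[OF v(1) int(1)] int_id[OF v'(1) int(2)])+
  have "(LINT x|lebesgue. max (b (u x) - b (u' x)) 0) = (LBINT x. max (b (v x) - b (v' x)) 0)"
    by (rule lebesgue_integral_eq_lborel, measurable) (use v(2) v'(2) in eventually_elim, simp)
  also have "\<dots> \<le> (LBINT x. max (g x - g' x) 0)" by (rule contraction[OF int(3,4,1,2)])
  also have "\<dots> = (LINT x|lebesgue. max (f x - f' x) 0)"
    by (rule lebesgue_integral_eq_lborel[symmetric], measurable) (use g(2) g'(2) in eventually_elim, simp)
  finally show ?thesis .
qed

theorem mainTheorem3:
  fixes s lam :: real
    and b :: "real \<Rightarrow> real"
    and F :: "real \<Rightarrow> real ^ 'n"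
    and f f' u u' :: "real ^ 'n \<Rightarrow> real"
  assumes "0 < s" and "s \<le> 1"
    and "\<exists>L. L-lipschitz_on UNIV b" and "mono b" and "b 0 = 0"
    and "0 < lam" and "\<And>r. b r * r \<ge> lam * \<bar>r\<bar>\<^sup>2"
    and "locally_lipschitz F" and "F 0 = 0"
    and "integrable lebesgue f" and "ess_bounded f"
    and "integrable lebesgue f'" and "ess_bounded f'"
    and "entropy_solution b F s f u" and "entropy_solution b F s f' u'"
    and "integrable lebesgue (\<lambda>x. b (u x))" and "integrable lebesgue (\<lambda>x. b (u' x))"
  shows "(LINT x|lebesgue. max (b (u x) - b (u' x)) 0) \<le> (LINT x|lebesgue. max (f x - f' x) 0)
    \<and> (LINT x|lebesgue. max (- (b (u x) - b (u' x))) 0) \<le> (LINT x|lebesgue. max (- (f x - f' x)) 0)"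
proof
  show "(LINT x|lebesgue. max (b (u x) - b (u' x)) 0) \<le> (LINT x|lebesgue. max (f x - f' x) 0)"
    by (rule entropy_contraction) (fact assms)+
  show "(LINT x|lebesgue. max (- (b (u x) - b (u' x))) 0) \<le> (LINT x|lebesgue. max (- (f x - f' x)) 0)"
    unfolding minus_diff_eq by (rule entropy_contraction) (fact assms)+
qed

end
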